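(* Let $(R,\mathfrak m)$ be a noetherian local complete Cohen-Macaulay ring with coefficient field $k$, let $i\geq 1$, and let $x_1,\dots,x_i\in R$ be a regular sequence in $R$. Set $I:=(x_1,\dots,x_i)R$. Then there is an isomorphism of $R$-modules $$H^i_I(D(H^i_I(R)))\cong E_R(k).$$
   Context: For a noetherian local ring $(R,\mathfrak m)$ and an ideal $I$ of $R$, $H^i_I(M)$ denotes the $i$-th local cohomology module of an $R$-module $M$ supported in $I$. A coefficient field of $R$ is a subfield $k\subseteq R$ that maps isomorphically onto $R/\mathfrak m$; thus $k$ is identified with the residue field $R/\mathfrak m$. $E_R(k)=E_R(R/\mathfrak m)$ denotes a fixed $R$-injective hull of the residue field, and $D$ is the Matlis dual functor $D(M)=\operatorname{Hom}_R(M,E_R(R/\mathfrak m))$ on the category of all $R$-modules. Complete means complete with respect to the $\mathfrak m$-adic topology. *)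

theory Defs
  imports "HOL-Algebra.Algebra" "HOL-Library.Extended_Nat"
begin

section \<open>Local rings, regular sequences, Cohen-Macaulay rings\<close>

definition local_ring :: "('a, 'm) ring_scheme \<Rightarrow> 'a set \<Rightarrow> bool" where
  "local_ring R \<mm> \<longleftrightarrow>
     cring R \<and> maximalideal \<mm> R \<and> (\<forall>\<nn>. maximalideal \<nn> R \<longrightarrow> \<nn> = \<mm>)"

definition coefficient_field :: "('a, 'm) ring_scheme \<Rightarrow> 'a set \<Rightarrow> 'a set \<Rightarrow> bool" where
  "coefficient_field R \<mm> k \<longleftrightarrow>
     subfield k R \<and> bij_betw (\<lambda>a. \<mm> +>\<^bsub>R\<^esub> a) k (carrier (R Quot \<mm>))"

text \<open>The power of an ideal is taken in the library's monoid of ideals \<^const>\<open>ideals_set\<close>, whose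
  multiplication is the product of ideals and whose unit is the whole ring.\<close>

abbreviation ideal_power :: "('a, 'm) ring_scheme \<Rightarrow> 'a set \<Rightarrow> nat \<Rightarrow> 'a set" where
  "ideal_power R I n \<equiv> I [^]\<^bsub>ideals_set R\<^esub> n"

text \<open>Completeness includes separatedness.\<close>

definition adic_complete :: "('a, 'm) ring_scheme \<Rightarrow> 'a set \<Rightarrow> bool" where
  "adic_complete R I \<longleftrightarrow>
     (\<Inter>n. ideal_power R I n) = {\<zero>\<^bsub>R\<^esub>} \<and>
     (\<forall>s :: nat \<Rightarrow> 'a.
        range s \<subseteq> carrier R \<and>
        (\<forall>n. \<exists>N. \<forall>p\<ge>N. \<forall>q\<ge>N. s p \<ominus>\<^bsub>R\<^esub> s q \<in> ideal_power R I n) \<longrightarrow>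
        (\<exists>l\<in>carrier R. \<forall>n. \<exists>N. \<forall>p\<ge>N. s p \<ominus>\<^bsub>R\<^esub> l \<in> ideal_power R I n))"

definition regular_sequence :: "('a, 'm) ring_scheme \<Rightarrow> 'a list \<Rightarrow> bool" where
  "regular_sequence R xs \<longleftrightarrow>
     set xs \<subseteq> carrier R \<and>
     (\<forall>j<length xs. \<forall>r\<in>carrier R.
        r \<otimes>\<^bsub>R\<^esub> xs ! j \<in> Idl\<^bsub>R\<^esub> (set (take j xs)) \<longrightarrow> r \<in> Idl\<^bsub>R\<^esub> (set (take j xs))) \<and>
     Idl\<^bsub>R\<^esub> (set xs) \<noteq> carrier R"

definition krull_dim :: "('a, 'm) ring_scheme \<Rightarrow> enat" where
  "krull_dim R = Sup {enat n |n. \<exists>P :: nat \<Rightarrow> 'a set.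
     (\<forall>j\<le>n. primeideal (P j) R) \<and> (\<forall>j<n. P j \<subset> P (Suc j))}"

definition depth :: "('a, 'm) ring_scheme \<Rightarrow> 'a set \<Rightarrow> enat" where
  "depth R \<mm> = Sup {enat (length xs) |xs. set xs \<subseteq> \<mm> \<and> regular_sequence R xs}"

definition cohen_macaulay :: "('a, 'm) ring_scheme \<Rightarrow> 'a set \<Rightarrow> bool" where
  "cohen_macaulay R \<mm> \<longleftrightarrow>
     local_ring R \<mm> \<and> noetherian_ring R \<and> depth R \<mm> = krull_dim R"


section \<open>Homomorphisms, quotients and Hom modules\<close>

text \<open>The module record of the library extends the ring record; the fields \<open>mult\<close> and \<open>one\<close>
  of a module carry no meaning.\<close>

definition mod_hom ::
    "('a, 'm) ring_scheme \<Rightarrow> ('a, 'b) module \<Rightarrow> ('a, 'c) module \<Rightarrow> ('b \<Rightarrow> 'c) set" where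
  "mod_hom R M N = {f \<in> carrier M \<rightarrow> carrier N.
     (\<forall>x\<in>carrier M. \<forall>y\<in>carrier M. f (x \<oplus>\<^bsub>M\<^esub> y) = f x \<oplus>\<^bsub>N\<^esub> f y) \<and>
     (\<forall>r\<in>carrier R. \<forall>x\<in>carrier M. f (r \<odot>\<^bsub>M\<^esub> x) = r \<odot>\<^bsub>N\<^esub> f x)}"

definition mod_isomorphic ::
    "('a, 'm) ring_scheme \<Rightarrow> ('a, 'b) module \<Rightarrow> ('a, 'c) module \<Rightarrow> bool" where
  "mod_isomorphic R M N \<longleftrightarrow> (\<exists>f\<in>mod_hom R M N. bij_betw f (carrier M) (carrier N))"

definition ring_module :: "('a, 'm) ring_scheme \<Rightarrow> ('a, 'a) module" where
  "ring_module R = \<lparr>carrier = carrier R, monoid.mult = monoid.mult R, one = one R,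
     ring.zero = ring.zero R, add = add R, smult = monoid.mult R\<rparr>"

definition quotient_module :: "('a, 'b) module \<Rightarrow> 'b set \<Rightarrow> ('a, 'b set) module" where
  "quotient_module M N = \<lparr>carrier = a_rcosets\<^bsub>M\<^esub> N, monoid.mult = undefined, one = undefined,
     ring.zero = N, add = set_add M, smult = (\<lambda>r S. \<Union>x\<in>S. N +>\<^bsub>M\<^esub> (r \<odot>\<^bsub>M\<^esub> x))\<rparr>"

definition residue_module :: "('a, 'm) ring_scheme \<Rightarrow> 'a set \<Rightarrow> ('a, 'a set) module" where
  "residue_module R \<mm> = quotient_module (ring_module R) \<mm>"

text \<open>Homomorphisms are normalised to be \<^const>\<open>undefined\<close> off \<^term>\<open>carrier M\<close>, so that equality
  of elements of the Hom module is equality of maps.\<close>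

definition hom_module ::
    "('a, 'm) ring_scheme \<Rightarrow> ('a, 'b) module \<Rightarrow> ('a, 'c) module \<Rightarrow> ('a, 'b \<Rightarrow> 'c) module" where
  "hom_module R M N = \<lparr>carrier = mod_hom R M N \<inter> extensional (carrier M),
     monoid.mult = undefined, one = undefined,
     ring.zero = (\<lambda>x\<in>carrier M. \<zero>\<^bsub>N\<^esub>),
     add = (\<lambda>f g. \<lambda>x\<in>carrier M. f x \<oplus>\<^bsub>N\<^esub> g x),
     smult = (\<lambda>r f. \<lambda>x\<in>carrier M. r \<odot>\<^bsub>N\<^esub> f x)\<rparr>"


section \<open>Injective modules and injective hulls\<close>

text \<open>A definition cannot quantify over types, so the test modules of the lifting property are
  restricted to those whose carrier lies in the type of the ring. This is no restriction:
  \<open>injective_module_lift\<close> below derives the lifting property for modules over arbitrary types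
  (Baer's criterion).\<close>

definition injective_module :: "('a, 'm) ring_scheme \<Rightarrow> ('a, 'e) module \<Rightarrow> bool" where
  "injective_module R E \<longleftrightarrow> module R E \<and>
     (\<forall>(A :: ('a, 'a) module) (B :: ('a, 'a) module) f g.
        module R A \<and> module R B \<and> f \<in> mod_hom R A B \<and> inj_on f (carrier A) \<and> g \<in> mod_hom R A E
        \<longrightarrow> (\<exists>h\<in>mod_hom R B E. \<forall>x\<in>carrier A. h (f x) = g x))"

definition injective_hull ::
    "('a, 'm) ring_scheme \<Rightarrow> ('a, 'b) module \<Rightarrow> ('a, 'e) module \<Rightarrow> bool" where
  "injective_hull R M E \<longleftrightarrow> injective_module R E \<and>
     (\<exists>e\<in>mod_hom R M E. inj_on e (carrier M) \<and>
        (\<forall>H. submodule H R E \<and> H \<noteq> {\<zero>\<^bsub>E\<^esub>} \<longrightarrow> H \<inter> e ` carrier M \<noteq> {\<zero>\<^bsub>E\<^esub>}))"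

definition matlis_dual ::
    "('a, 'm) ring_scheme \<Rightarrow> ('a, 'e) module \<Rightarrow> ('a, 'b) module \<Rightarrow> ('a, 'b \<Rightarrow> 'e) module" where
  "matlis_dual R E M = hom_module R M E"


section \<open>Local cohomology\<close>

definition injective_resolution ::
    "('a, 'm) ring_scheme \<Rightarrow> ('a, 'b) module \<Rightarrow> (nat \<Rightarrow> ('a, 'j) module) \<Rightarrow> (nat \<Rightarrow> 'j \<Rightarrow> 'j) \<Rightarrow> bool"
  where
  "injective_resolution R M J d \<longleftrightarrow> module R M \<and>
     (\<forall>n. injective_module R (J n)) \<and>
     (\<forall>n. d n \<in> mod_hom R (J n) (J (Suc n))) \<and>
     (\<exists>e\<in>mod_hom R M (J 0). inj_on e (carrier M) \<and>
        e ` carrier M = {x \<in> carrier (J 0). d 0 x = \<zero>\<^bsub>J 1\<^esub>}) \<and>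
     (\<forall>n. d n ` carrier (J n) = {x \<in> carrier (J (Suc n)). d (Suc n) x = \<zero>\<^bsub>J (Suc (Suc n))\<^esub>})"

definition torsion_part :: "('a, 'm) ring_scheme \<Rightarrow> 'a set \<Rightarrow> ('a, 'b) module \<Rightarrow> 'b set" where
  "torsion_part R I M =
     {x \<in> carrier M. \<exists>n. \<forall>a\<in>ideal_power R I n. a \<odot>\<^bsub>M\<^esub> x = \<zero>\<^bsub>M\<^esub>}"

text \<open>The \<open>i\<close>-th right derived functor of the \<open>I\<close>-torsion functor, computed from an injective
  resolution \<open>(J, d)\<close> of the module in question: the \<open>i\<close>-th cohomology of the complex
  of \<open>I\<close>-torsion submodules of the \<open>J n\<close>. Up to isomorphism it does not depend on the resolution,
  so statements about it quantify over all injective resolutions.\<close>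

definition local_cohomology ::
    "('a, 'm) ring_scheme \<Rightarrow> 'a set \<Rightarrow> nat \<Rightarrow> (nat \<Rightarrow> ('a, 'j) module) \<Rightarrow> (nat \<Rightarrow> 'j \<Rightarrow> 'j)
      \<Rightarrow> ('a, 'j set) module" where
  "local_cohomology R I i J d =
     quotient_module
       ((J i)\<lparr>carrier := {x \<in> torsion_part R I (J i). d i x = \<zero>\<^bsub>J (Suc i)\<^esub>}\<rparr>)
       (if i = 0 then {\<zero>\<^bsub>J 0\<^esub>} else d (i - 1) ` torsion_part R I (J (i - 1)))"


section \<open>Baer's criterion\<close>

lemma mod_homD:
  assumes "f \<in> mod_hom R M N"
  shows "x \<in> carrier M \<Longrightarrow> f x \<in> carrier N"
    and "x \<in> carrier M \<Longrightarrow> y \<in> carrier M \<Longrightarrow> f (x \<oplus>\<^bsub>M\<^esub> y) = f x \<oplus>\<^bsub>N\<^esub> f y"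
    and "r \<in> carrier R \<Longrightarrow> x \<in> carrier M \<Longrightarrow> f (r \<odot>\<^bsub>M\<^esub> x) = r \<odot>\<^bsub>N\<^esub> f x"
  using assms by (auto simp: mod_hom_def)

lemma mod_hom_zero:
  assumes "module R M" "module R N" "f \<in> mod_hom R M N"
  shows "f \<zero>\<^bsub>M\<^esub> = \<zero>\<^bsub>N\<^esub>"
proof -
  interpret M: module R M by fact
  interpret N: module R N by fact
  have "f (\<zero>\<^bsub>R\<^esub> \<odot>\<^bsub>M\<^esub> \<zero>\<^bsub>M\<^esub>) = \<zero>\<^bsub>R\<^esub> \<odot>\<^bsub>N\<^esub> f \<zero>\<^bsub>M\<^esub>"
    by (rule mod_homD(3)[OF assms(3)]) auto
  then show ?thesis using mod_homD(1)[OF assms(3), of "\<zero>\<^bsub>M\<^esub>"] by simp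
qed

lemma module_ring_module:
  assumes "cring R" shows "module R (ring_module R)"
proof -
  interpret cring R by fact
  have "abelian_group (ring_module R)"
    by (rule abelian_groupI)
       (auto simp: ring_module_def a_ac intro!: bexI[of _ "\<ominus>\<^bsub>R\<^esub> _"] l_neg)
  then show ?thesis
    by (intro moduleI) (auto simp: ring_module_def assms l_distr r_distr m_assoc)
qed

lemma injective_module_extend_ideal:
  assumes E: "injective_module R E" and I: "ideal I R" and R: "cring R"
    and add: "\<And>r s. r \<in> I \<Longrightarrow> s \<in> I \<Longrightarrow> \<phi> (r \<oplus>\<^bsub>R\<^esub> s) = \<phi> r \<oplus>\<^bsub>E\<^esub> \<phi> s"
    and sm: "\<And>r s. r \<in> carrier R \<Longrightarrow> s \<in> I \<Longrightarrow> \<phi> (r \<otimes>\<^bsub>R\<^esub> s) = r \<odot>\<^bsub>E\<^esub> \<phi> s"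
    and cl: "\<And>r. r \<in> I \<Longrightarrow> \<phi> r \<in> carrier E"
  obtains e where "e \<in> carrier E" "\<And>r. r \<in> I \<Longrightarrow> \<phi> r = r \<odot>\<^bsub>E\<^esub> e"
proof -
  interpret cring R by fact
  interpret I: ideal I R by fact
  interpret RM: module R "ring_module R" by (rule module_ring_module[OF R])
  let ?A = "(ring_module R)\<lparr>carrier := I\<rparr>"
  have "submodule I R (ring_module R)"
  proof (rule RM.submoduleI)
    fix a assume a: "a \<in> I"
    have "\<ominus>\<^bsub>ring_module R\<^esub> a = \<ominus>\<^bsub>R\<^esub> a"
      using a I.Icarr by (intro RM.minus_equality) (auto simp: ring_module_def l_neg)
    then show "\<ominus>\<^bsub>ring_module R\<^esub> a \<in> I" using a by simp
  qed (use I.Icarr I.I_l_closed in \<open>auto simp: ring_module_def\<close>)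
  then have A: "module R ?A" by (rule submodule.submodule_is_module) (rule RM.module_axioms)
  have id: "(\<lambda>x. x) \<in> mod_hom R ?A (ring_module R)"
    using I.Icarr by (auto simp: mod_hom_def ring_module_def)
  have phi: "\<phi> \<in> mod_hom R ?A E"
    using add sm cl by (auto simp: mod_hom_def ring_module_def)
  obtain h where h: "h \<in> mod_hom R (ring_module R) E" "\<forall>x\<in>carrier ?A. h x = \<phi> x"
    using E A id phi RM.module_axioms unfolding injective_module_def inj_on_def by blast
  show ?thesis
  proof
    show "h \<one>\<^bsub>R\<^esub> \<in> carrier E" using mod_homD(1)[OF h(1)] by (simp add: ring_module_def)
    fix r assume r: "r \<in> I"
    have "h (r \<odot>\<^bsub>ring_module R\<^esub> \<one>\<^bsub>R\<^esub>) = r \<odot>\<^bsub>E\<^esub> h \<one>\<^bsub>R\<^esub>"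
      using r I.Icarr by (intro mod_homD(3)[OF h(1)]) (auto simp: ring_module_def)
    then show "\<phi> r = r \<odot>\<^bsub>E\<^esub> h \<one>\<^bsub>R\<^esub>" using h(2) r I.Icarr by (simp add: ring_module_def)
  qed
qed

lemma injective_module_lift:
  fixes A :: "('a, 'b) module" and B :: "('a, 'c) module" and E :: "('a, 'e) module"
  assumes E: "injective_module R E" and A: "module R A" and B: "module R B"
    and f: "f \<in> mod_hom R A B" and inj: "inj_on f (carrier A)" and g: "g \<in> mod_hom R A E"
  shows "\<exists>h\<in>mod_hom R B E. \<forall>x\<in>carrier A. h (f x) = g x"
proof -
  have EM: "module R E" using E by (simp add: injective_module_def)
  have R: "cring R" using B by (simp add: module_def)
  interpret R: cring R by fact
  interpret A: module R A by fact
  interpret B: module R B by fact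
  interpret E: module R E by fact
  define lin where "lin G \<longleftrightarrow> G \<subseteq> carrier B \<times> carrier E \<and>
      (\<forall>x\<in>carrier A. (f x, g x) \<in> G) \<and>
      (\<forall>x e y e'. (x, e) \<in> G \<longrightarrow> (y, e') \<in> G \<longrightarrow> (x \<oplus>\<^bsub>B\<^esub> y, e \<oplus>\<^bsub>E\<^esub> e') \<in> G) \<and>
      (\<forall>r x e. r \<in> carrier R \<longrightarrow> (x, e) \<in> G \<longrightarrow> (r \<odot>\<^bsub>B\<^esub> x, r \<odot>\<^bsub>E\<^esub> e) \<in> G) \<and>
      (\<forall>e. (\<zero>\<^bsub>B\<^esub>, e) \<in> G \<longrightarrow> e = \<zero>\<^bsub>E\<^esub>)" for G :: "('c \<times> 'e) set"
  have linA: "(x \<oplus>\<^bsub>B\<^esub> y, e \<oplus>\<^bsub>E\<^esub> e') \<in> G" if "lin G" "(x, e) \<in> G" "(y, e') \<in> G" for G x y e e'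
    using that unfolding lin_def by simp
  have linS: "(r \<odot>\<^bsub>B\<^esub> x, r \<odot>\<^bsub>E\<^esub> e) \<in> G" if "lin G" "r \<in> carrier R" "(x, e) \<in> G" for G r x e
    using that unfolding lin_def by simp
  have linZ: "e = \<zero>\<^bsub>E\<^esub>" if "lin G" "(\<zero>\<^bsub>B\<^esub>, e) \<in> G" for G e
    using that unfolding lin_def by simp
  have linC: "x \<in> carrier B \<and> e \<in> carrier E" if "lin G" "(x, e) \<in> G" for G x e
    using that unfolding lin_def by auto
  have linF: "(f x, g x) \<in> G" if "lin G" "x \<in> carrier A" for G x
    using that unfolding lin_def by simp
  define G0 where "G0 = (\<lambda>x. (f x, g x)) ` carrier A"
  have "lin G0"
    unfolding lin_def
  proof (intro conjI allI impI ballI)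
    show "G0 \<subseteq> carrier B \<times> carrier E"
      using mod_homD(1)[OF f] mod_homD(1)[OF g] by (auto simp: G0_def)
    fix x e y e' assume "(x, e) \<in> G0" "(y, e') \<in> G0"
    then obtain u v where u: "u \<in> carrier A" "v \<in> carrier A" "x = f u" "e = g u" "y = f v" "e' = g v"
      by (auto simp: G0_def)
    then show "(x \<oplus>\<^bsub>B\<^esub> y, e \<oplus>\<^bsub>E\<^esub> e') \<in> G0"
      unfolding G0_def using mod_homD(2)[OF f] mod_homD(2)[OF g]
      by (intro image_eqI[of _ _ "u \<oplus>\<^bsub>A\<^esub> v"]) auto
  next
    fix r x e assume "r \<in> carrier R" "(x, e) \<in> G0"
    then obtain u where u: "r \<in> carrier R" "u \<in> carrier A" "x = f u" "e = g u"
      by (auto simp: G0_def)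
    then show "(r \<odot>\<^bsub>B\<^esub> x, r \<odot>\<^bsub>E\<^esub> e) \<in> G0"
      unfolding G0_def using mod_homD(3)[OF f] mod_homD(3)[OF g]
      by (intro image_eqI[of _ _ "r \<odot>\<^bsub>A\<^esub> u"]) auto
  next
    fix e assume "(\<zero>\<^bsub>B\<^esub>, e) \<in> G0"
    then obtain u where u: "u \<in> carrier A" "f u = \<zero>\<^bsub>B\<^esub>" "e = g u" by (auto simp: G0_def)
    then have "u = \<zero>\<^bsub>A\<^esub>"
      using inj_onD[OF inj, of u "\<zero>\<^bsub>A\<^esub>"] mod_hom_zero[OF A B f] by simp
    then show "e = \<zero>\<^bsub>E\<^esub>" using u mod_hom_zero[OF A EM g] by simp
  qed (auto simp: G0_def)
  then have "Collect lin \<noteq> {}" by auto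
  moreover have "\<Union>C \<in> Collect lin" if C: "C \<noteq> {}" "subset.chain (Collect lin) C" for C
  proof -
    have l: "lin S" if "S \<in> C" for S using C that by (auto simp: subset.chain_def)
    have tot: "S \<subseteq> T \<or> T \<subseteq> S" if "S \<in> C" "T \<in> C" for S T
      using C that by (auto simp: subset_chain_def)
    have "lin (\<Union>C)"
      unfolding lin_def
    proof (intro conjI allI impI ballI)
      show "\<Union>C \<subseteq> carrier B \<times> carrier E" using l linC by auto
      show "(f x, g x) \<in> \<Union>C" if "x \<in> carrier A" for x
        using l C(1) that linF by blast
      show "(r \<odot>\<^bsub>B\<^esub> x, r \<odot>\<^bsub>E\<^esub> e) \<in> \<Union>C" if "r \<in> carrier R" "(x, e) \<in> \<Union>C" for r x e
        using l that linS by blast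
      show "e = \<zero>\<^bsub>E\<^esub>" if "(\<zero>\<^bsub>B\<^esub>, e) \<in> \<Union>C" for e
        using l that linZ by blast
      fix x e y e' assume "(x, e) \<in> \<Union>C" "(y, e') \<in> \<Union>C"
      then obtain S T where ST: "S \<in> C" "(x, e) \<in> S" "T \<in> C" "(y, e') \<in> T" by auto
      then obtain Z where "Z \<in> C" "(x, e) \<in> Z" "(y, e') \<in> Z" using tot[of S T] by blast
      then show "(x \<oplus>\<^bsub>B\<^esub> y, e \<oplus>\<^bsub>E\<^esub> e') \<in> \<Union>C" using linA l by blast
    qed
    then show ?thesis by simp
  qed
  ultimately obtain G where "lin G" and max: "\<And>S. lin S \<Longrightarrow> G \<subseteq> S \<Longrightarrow> S = G"
    using subset_Zorn_nonempty[of "Collect lin"] by auto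
  note linG = linC[OF \<open>lin G\<close>] linF[OF \<open>lin G\<close>] linA[OF \<open>lin G\<close>] linS[OF \<open>lin G\<close>] linZ[OF \<open>lin G\<close>]
  then have Gc: "\<And>x e. (x, e) \<in> G \<Longrightarrow> x \<in> carrier B \<and> e \<in> carrier E"
    and Gf: "\<And>x. x \<in> carrier A \<Longrightarrow> (f x, g x) \<in> G"
    and Ga: "\<And>x e y e'. (x, e) \<in> G \<Longrightarrow> (y, e') \<in> G \<Longrightarrow> (x \<oplus>\<^bsub>B\<^esub> y, e \<oplus>\<^bsub>E\<^esub> e') \<in> G"
    and Gs: "\<And>r x e. r \<in> carrier R \<Longrightarrow> (x, e) \<in> G \<Longrightarrow> (r \<odot>\<^bsub>B\<^esub> x, r \<odot>\<^bsub>E\<^esub> e) \<in> G"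
    and Gz: "\<And>e. (\<zero>\<^bsub>B\<^esub>, e) \<in> G \<Longrightarrow> e = \<zero>\<^bsub>E\<^esub>"
    by blast+
  have G0: "(\<zero>\<^bsub>B\<^esub>, \<zero>\<^bsub>E\<^esub>) \<in> G"
    using Gf[of "\<zero>\<^bsub>A\<^esub>"] mod_hom_zero[OF A B f] mod_hom_zero[OF A EM g] by simp
  have uniq: "e = e'" if "(x, e) \<in> G" "(x, e') \<in> G" for x e e'
  proof -
    have c: "x \<in> carrier B" "e \<in> carrier E" "e' \<in> carrier E" using Gc that by auto
    have "(\<ominus>\<^bsub>R\<^esub> \<one>\<^bsub>R\<^esub> \<odot>\<^bsub>B\<^esub> x, \<ominus>\<^bsub>R\<^esub> \<one>\<^bsub>R\<^esub> \<odot>\<^bsub>E\<^esub> e') \<in> G" using Gs[OF _ that(2)] by simp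
    then have "(\<ominus>\<^bsub>B\<^esub> x, \<ominus>\<^bsub>E\<^esub> e') \<in> G"
      using c B.smult_l_minus[of "\<one>\<^bsub>R\<^esub>" x] E.smult_l_minus[of "\<one>\<^bsub>R\<^esub>" e'] by simp
    from Ga[OF that(1) this] have "(\<zero>\<^bsub>B\<^esub>, e \<oplus>\<^bsub>E\<^esub> \<ominus>\<^bsub>E\<^esub> e') \<in> G"
      using c by (simp add: B.M.r_neg)
    from Gz[OF this] show ?thesis using c E.M.minus_equality E.M.minus_minus
      by (metis E.M.a_inv_closed)
  qed
  have dom: "\<exists>e. (b, e) \<in> G" if b: "b \<in> carrier B" for b
  proof -
    define I where "I = {r \<in> carrier R. \<exists>e. (r \<odot>\<^bsub>B\<^esub> b, e) \<in> G}"
    define \<phi> where "\<phi> r = (THE e. (r \<odot>\<^bsub>B\<^esub> b, e) \<in> G)" for r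
    have phiI: "\<phi> r = e" if "(r \<odot>\<^bsub>B\<^esub> b, e) \<in> G" for r e
      unfolding \<phi>_def using that uniq by blast
    have phi: "r \<in> carrier R \<and> (r \<odot>\<^bsub>B\<^esub> b, \<phi> r) \<in> G" if "r \<in> I" for r
      using that phiI by (auto simp: I_def)
    have Isum: "r \<oplus>\<^bsub>R\<^esub> s \<in> I \<and> \<phi> (r \<oplus>\<^bsub>R\<^esub> s) = \<phi> r \<oplus>\<^bsub>E\<^esub> \<phi> s" if "r \<in> I" "s \<in> I" for r s
    proof -
      have "((r \<oplus>\<^bsub>R\<^esub> s) \<odot>\<^bsub>B\<^esub> b, \<phi> r \<oplus>\<^bsub>E\<^esub> \<phi> s) \<in> G"
        using phi[OF that(1)] phi[OF that(2)] b Ga by (simp add: B.smult_l_distr)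
      then show ?thesis using phiI phi[OF that(1)] phi[OF that(2)] by (auto simp: I_def)
    qed
    have Ism: "r \<otimes>\<^bsub>R\<^esub> s \<in> I \<and> \<phi> (r \<otimes>\<^bsub>R\<^esub> s) = r \<odot>\<^bsub>E\<^esub> \<phi> s" if "r \<in> carrier R" "s \<in> I" for r s
    proof -
      have "((r \<otimes>\<^bsub>R\<^esub> s) \<odot>\<^bsub>B\<^esub> b, r \<odot>\<^bsub>E\<^esub> \<phi> s) \<in> G"
        using phi[OF that(2)] that(1) b Gs by (simp add: B.smult_assoc1)
      then show ?thesis using phiI phi[OF that(2)] that(1) by (auto simp: I_def)
    qed
    have Iz: "\<zero>\<^bsub>R\<^esub> \<in> I" using G0 b by (auto simp: I_def)
    have Id: "ideal I R"
    proof (rule idealI)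
      show "ring R" by (rule R.ring_axioms)
      show "subgroup I (add_monoid R)"
      proof (rule subgroup.intro)
        show "I \<subseteq> carrier (add_monoid R)" by (auto simp: I_def)
        show "x \<otimes>\<^bsub>add_monoid R\<^esub> y \<in> I" if "x \<in> I" "y \<in> I" for x y using Isum that by simp
        show "\<one>\<^bsub>add_monoid R\<^esub> \<in> I" using Iz by simp
        fix x assume x: "x \<in> I"
        then have "\<ominus>\<^bsub>R\<^esub> \<one>\<^bsub>R\<^esub> \<otimes>\<^bsub>R\<^esub> x \<in> I" using Ism by simp
        then have "\<ominus>\<^bsub>R\<^esub> x \<in> I" using x phi by (simp add: R.l_minus)
        then show "inv\<^bsub>add_monoid R\<^esub> x \<in> I" by (simp add: a_inv_def)
      qed
      show "x \<otimes>\<^bsub>R\<^esub> a \<in> I" if "a \<in> I" "x \<in> carrier R" for a x using Ism that by simp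
      show "a \<otimes>\<^bsub>R\<^esub> x \<in> I" if "a \<in> I" "x \<in> carrier R" for a x
        using Ism that phi R.m_comm[of a x] by simp
    qed
    obtain e0 where e0: "e0 \<in> carrier E" "\<And>r. r \<in> I \<Longrightarrow> \<phi> r = r \<odot>\<^bsub>E\<^esub> e0"
      using injective_module_extend_ideal[OF E Id R, of \<phi>] Isum Ism phi Gc by metis
    define G' where
      "G' = {(x \<oplus>\<^bsub>B\<^esub> r \<odot>\<^bsub>B\<^esub> b, e \<oplus>\<^bsub>E\<^esub> r \<odot>\<^bsub>E\<^esub> e0) |x r e. r \<in> carrier R \<and> (x, e) \<in> G}"
    have G'I: "(x \<oplus>\<^bsub>B\<^esub> r \<odot>\<^bsub>B\<^esub> b, e \<oplus>\<^bsub>E\<^esub> r \<odot>\<^bsub>E\<^esub> e0) \<in> G'"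
      if "r \<in> carrier R" "(x, e) \<in> G" for x r e using that unfolding G'_def by blast
    have sub: "G \<subseteq> G'"
    proof
      fix p assume "p \<in> G"
      then obtain x e where p: "p = (x, e)" "(x, e) \<in> G" by (cases p) auto
      from G'I[OF R.zero_closed p(2)] show "p \<in> G'" using p Gc[OF p(2)] b e0(1) by simp
    qed
    have "lin G'"
      unfolding lin_def
    proof (intro conjI allI impI ballI)
      show "G' \<subseteq> carrier B \<times> carrier E" using Gc b e0(1) by (auto simp: G'_def)
      show "(f x, g x) \<in> G'" if "x \<in> carrier A" for x using sub Gf that by blast
    next
      fix x e y e' assume "(x, e) \<in> G'" "(y, e') \<in> G'"
      then obtain u r a v s c where *: "r \<in> carrier R" "s \<in> carrier R" "(u, a) \<in> G" "(v, c) \<in> G"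
        and eq: "x = u \<oplus>\<^bsub>B\<^esub> r \<odot>\<^bsub>B\<^esub> b" "e = a \<oplus>\<^bsub>E\<^esub> r \<odot>\<^bsub>E\<^esub> e0"
          "y = v \<oplus>\<^bsub>B\<^esub> s \<odot>\<^bsub>B\<^esub> b" "e' = c \<oplus>\<^bsub>E\<^esub> s \<odot>\<^bsub>E\<^esub> e0"
        by (auto simp: G'_def)
      have "x \<oplus>\<^bsub>B\<^esub> y = (u \<oplus>\<^bsub>B\<^esub> v) \<oplus>\<^bsub>B\<^esub> (r \<oplus>\<^bsub>R\<^esub> s) \<odot>\<^bsub>B\<^esub> b"
        using * Gc[OF *(3)] Gc[OF *(4)] b by (simp add: eq B.smult_l_distr B.M.a_ac)
      moreover have "e \<oplus>\<^bsub>E\<^esub> e' = (a \<oplus>\<^bsub>E\<^esub> c) \<oplus>\<^bsub>E\<^esub> (r \<oplus>\<^bsub>R\<^esub> s) \<odot>\<^bsub>E\<^esub> e0"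
        using * Gc[OF *(3)] Gc[OF *(4)] e0(1) by (simp add: eq E.smult_l_distr E.M.a_ac)
      ultimately show "(x \<oplus>\<^bsub>B\<^esub> y, e \<oplus>\<^bsub>E\<^esub> e') \<in> G'"
        using G'I[OF _ Ga[OF *(3,4)], of "r \<oplus>\<^bsub>R\<^esub> s"] *(1,2) by simp
    next
      fix t x e assume t: "t \<in> carrier R" and "(x, e) \<in> G'"
      then obtain u r a where *: "r \<in> carrier R" "(u, a) \<in> G"
        and eq: "x = u \<oplus>\<^bsub>B\<^esub> r \<odot>\<^bsub>B\<^esub> b" "e = a \<oplus>\<^bsub>E\<^esub> r \<odot>\<^bsub>E\<^esub> e0"
        by (auto simp: G'_def)
      have "t \<odot>\<^bsub>B\<^esub> x = t \<odot>\<^bsub>B\<^esub> u \<oplus>\<^bsub>B\<^esub> (t \<otimes>\<^bsub>R\<^esub> r) \<odot>\<^bsub>B\<^esub> b"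
        using t * Gc[OF *(2)] b by (simp add: eq B.smult_r_distr B.smult_assoc1)
      moreover have "t \<odot>\<^bsub>E\<^esub> e = t \<odot>\<^bsub>E\<^esub> a \<oplus>\<^bsub>E\<^esub> (t \<otimes>\<^bsub>R\<^esub> r) \<odot>\<^bsub>E\<^esub> e0"
        using t * Gc[OF *(2)] e0(1) by (simp add: eq E.smult_r_distr E.smult_assoc1)
      ultimately show "(t \<odot>\<^bsub>B\<^esub> x, t \<odot>\<^bsub>E\<^esub> e) \<in> G'"
        using G'I[OF _ Gs[OF t *(2)], of "t \<otimes>\<^bsub>R\<^esub> r"] t *(1) by simp
    next
      fix e assume "(\<zero>\<^bsub>B\<^esub>, e) \<in> G'"
      then obtain u r a where *: "r \<in> carrier R" "(u, a) \<in> G"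
        and eq: "u \<oplus>\<^bsub>B\<^esub> r \<odot>\<^bsub>B\<^esub> b = \<zero>\<^bsub>B\<^esub>" "e = a \<oplus>\<^bsub>E\<^esub> r \<odot>\<^bsub>E\<^esub> e0"
        by (auto simp: G'_def)
      have c: "u \<in> carrier B" "a \<in> carrier E" using Gc[OF *(2)] by auto
      have rb: "r \<odot>\<^bsub>B\<^esub> b = \<ominus>\<^bsub>B\<^esub> u"
        using eq(1) c * b B.M.minus_equality[of "r \<odot>\<^bsub>B\<^esub> b" u] by (simp add: B.M.a_comm)
      have "(\<ominus>\<^bsub>R\<^esub> \<one>\<^bsub>R\<^esub> \<odot>\<^bsub>B\<^esub> u, \<ominus>\<^bsub>R\<^esub> \<one>\<^bsub>R\<^esub> \<odot>\<^bsub>E\<^esub> a) \<in> G" using Gs[OF _ *(2)] by simp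
      then have "(r \<odot>\<^bsub>B\<^esub> b, \<ominus>\<^bsub>E\<^esub> a) \<in> G"
        using c rb B.smult_l_minus[of "\<one>\<^bsub>R\<^esub>" u] E.smult_l_minus[of "\<one>\<^bsub>R\<^esub>" a] by simp
      moreover from this have "r \<in> I" using *(1) by (auto simp: I_def)
      ultimately have "r \<odot>\<^bsub>E\<^esub> e0 = \<ominus>\<^bsub>E\<^esub> a" using phiI e0(2) by metis
      then show "e = \<zero>\<^bsub>E\<^esub>" using c by (simp add: eq E.M.r_neg)
    qed
    from max[OF this sub] have "G' = G" .
    moreover have "(b, e0) \<in> G'" using G'I[OF R.one_closed G0] b e0(1) by simp
    ultimately show ?thesis by auto
  qed
  define h where "h b = (THE e. (b, e) \<in> G)" for b
  have hI: "h b = e" if "(b, e) \<in> G" for b e unfolding h_def using that uniq by blast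
  have hG: "(b, h b) \<in> G" if "b \<in> carrier B" for b using dom[OF that] hI by auto
  have "h \<in> mod_hom R B E"
    unfolding mod_hom_def using hG Gc hI Ga Gs by auto
  moreover have "\<forall>x\<in>carrier A. h (f x) = g x" using Gf hI by blast
  ultimately show ?thesis by blast
qed


section \<open>Hom modules and quotient modules are modules\<close>

lemma module_hom_module:
  assumes M: "module R M" and N: "module R N"
  shows "module R (hom_module R M N)"
proof -
  have R: "cring R" using M by (simp add: module_def)
  interpret R: cring R by fact
  interpret M: module R M by fact
  interpret N: module R N by fact
  have "abelian_group (hom_module R M N)"
  proof (rule abelian_groupI)
    fix f assume f: "f \<in> carrier (hom_module R M N)"
    then have fN: "f x \<in> carrier N" if "x \<in> carrier M" for x
      using that by (auto simp: hom_module_def mod_hom_def)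
    let ?g = "\<lambda>x\<in>carrier M. \<ominus>\<^bsub>N\<^esub> f x"
    have "?g \<in> carrier (hom_module R M N)"
      using f by (auto simp: hom_module_def mod_hom_def N.M.minus_add Pi_iff N.smult_r_minus N.M.a_comm
          simp flip: N.M.minus_add)
    moreover have "?g \<oplus>\<^bsub>hom_module R M N\<^esub> f = \<zero>\<^bsub>hom_module R M N\<^esub>"
      using fN by (auto simp: hom_module_def fun_eq_iff N.M.l_neg)
    ultimately show "\<exists>g\<in>carrier (hom_module R M N). g \<oplus>\<^bsub>hom_module R M N\<^esub> f = \<zero>\<^bsub>hom_module R M N\<^esub>"
      by blast
  qed (auto simp: hom_module_def mod_hom_def Pi_iff N.M.a_ac N.smult_r_distr fun_eq_iff
      extensional_def restrict_def)
  then show ?thesis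
    by (intro moduleI R)
       (auto simp: hom_module_def mod_hom_def Pi_iff N.M.a_ac N.smult_r_distr N.smult_l_distr
          N.smult_assoc1 fun_eq_iff extensional_def restrict_def R.m_comm simp flip: N.smult_assoc1)
qed

lemma module_quotient_module:
  assumes M: "module R M" and N: "submodule N R M"
  shows "module R (quotient_module M N)"
proof -
  have R: "cring R" using M by (simp add: module_def)
  interpret R: cring R by fact
  interpret M: module R M by fact
  interpret N: submodule N R M by fact
  interpret N: abelian_subgroup N M
    by (rule abelian_subgroupI3)
       (auto simp: additive_subgroup_def N.subgroup_axioms M.M.abelian_group_axioms)
  have sm: "r \<odot>\<^bsub>quotient_module M N\<^esub> (N +>\<^bsub>M\<^esub> x) = N +>\<^bsub>M\<^esub> (r \<odot>\<^bsub>M\<^esub> x)"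
    if r: "r \<in> carrier R" and x: "x \<in> carrier M" for r x
  proof -
    have "N +>\<^bsub>M\<^esub> (r \<odot>\<^bsub>M\<^esub> y) = N +>\<^bsub>M\<^esub> (r \<odot>\<^bsub>M\<^esub> x)" if "y \<in> N +>\<^bsub>M\<^esub> x" for y
    proof -
      obtain n where n: "n \<in> N" "y = n \<oplus>\<^bsub>M\<^esub> x" using \<open>y \<in> _\<close> by (auto simp: a_r_coset_def r_coset_def)
      have nM: "n \<in> carrier M" using n N.a_subset by auto
      have "r \<odot>\<^bsub>M\<^esub> y = r \<odot>\<^bsub>M\<^esub> n \<oplus>\<^bsub>M\<^esub> r \<odot>\<^bsub>M\<^esub> x" using n nM r x by (simp add: M.smult_r_distr)
      then have "r \<odot>\<^bsub>M\<^esub> y \<in> N +>\<^bsub>M\<^esub> (r \<odot>\<^bsub>M\<^esub> x)"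
        using n r by (auto simp: a_r_coset_def r_coset_def)
      then show ?thesis using N.a_repr_independence' r x by (metis M.smult_closed)
    qed
    moreover have "x \<in> N +>\<^bsub>M\<^esub> x" using x N.a_rcos_self by simp
    ultimately have "(\<Union>y\<in>N +>\<^bsub>M\<^esub> x. N +>\<^bsub>M\<^esub> (r \<odot>\<^bsub>M\<^esub> y)) = N +>\<^bsub>M\<^esub> (r \<odot>\<^bsub>M\<^esub> x)" by blast
    then show ?thesis by (simp only: quotient_module_def module.select_convs)
  qed
  have car: "carrier (quotient_module M N) = (\<lambda>x. N +>\<^bsub>M\<^esub> x) ` carrier M"
    by (auto simp: quotient_module_def A_RCOSETS_def RCOSETS_def a_r_coset_def)
  have ad: "(N +>\<^bsub>M\<^esub> x) \<oplus>\<^bsub>quotient_module M N\<^esub> (N +>\<^bsub>M\<^esub> y) = N +>\<^bsub>M\<^esub> (x \<oplus>\<^bsub>M\<^esub> y)"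
    if "x \<in> carrier M" "y \<in> carrier M" for x y
    using that N.a_rcos_sum by (simp add: quotient_module_def)
  have z: "\<zero>\<^bsub>quotient_module M N\<^esub> = N +>\<^bsub>M\<^esub> \<zero>\<^bsub>M\<^esub>"
    using M.M.a_coset_add_zero N.a_subset by (simp add: quotient_module_def)
  have "abelian_group (quotient_module M N)"
  proof (rule abelian_groupI)
    fix S assume "S \<in> carrier (quotient_module M N)"
    then obtain x where x: "x \<in> carrier M" "S = N +>\<^bsub>M\<^esub> x" by (auto simp: car)
    then show "\<exists>T\<in>carrier (quotient_module M N). T \<oplus>\<^bsub>quotient_module M N\<^esub> S = \<zero>\<^bsub>quotient_module M N\<^esub>"
      by (intro bexI[of _ "N +>\<^bsub>M\<^esub> (\<ominus>\<^bsub>M\<^esub> x)"]) (auto simp: car ad z M.M.l_neg)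
  qed (auto simp: car ad z M.M.a_ac)
  then show ?thesis
    by (intro moduleI R)
       (auto simp: car ad sm M.smult_l_distr M.smult_r_distr M.smult_assoc1)
qed

end

theory Submission
  imports Defs
begin

text \<open>
  Write \<open>\<pi> = x\<^sub>1 \<cdots> x\<^sub>i\<close> and \<open>(x\<^sup>n)\<close> for the ideal generated by the \<open>n\<close>-th powers of the
  \<open>x\<^sub>j\<close>. For every module \<open>M\<close> there is an isomorphism
  \<open>H\<^sup>i\<^sub>I(M) \<cong> colim M/(x\<^sup>n)M\<close>, the transition maps being multiplication by \<open>\<pi>\<close>. The argument uses
  this description twice, for \<open>R\<close> and for the dual of \<open>H = H\<^sup>i\<^sub>I(R)\<close>.

  For \<open>R\<close> the sequence is regular, so the transition maps are injective: \<open>H\<close> is the union of the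
  cyclic modules generated by elements \<open>h n\<close> with \<open>\<pi> h (n + 1) = h n\<close> and annihilator \<open>(x\<^sup>n)\<close>.
  Moreover \<open>R h n\<close> consists of \<^emph>\<open>all\<close> elements of \<open>H\<close> killed by \<open>(x\<^sup>n)\<close>; this is the colon formula
  \<open>(x\<^sup>N) : (x\<^sup>n) = \<pi>\<^bsup>N-n\<^esup> R + (x\<^sup>N)\<close>.

  For \<open>D = Hom(H, E)\<close>, consider the evaluation \<open>D \<rightarrow> E\<close>, \<open>f \<mapsto> f (h n)\<close>. A functional with
  \<open>f (h n) = 0\<close> vanishes on the elements killed by \<open>(x\<^sup>n)\<close>, and the injectivity of \<open>E\<close> then puts it
  into \<open>(x\<^sup>n) D\<close>; so the kernel of the evaluation is \<open>(x\<^sup>n) D\<close>. Its image is the submodule of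
  \<open>E\<close> killed by \<open>(x\<^sup>n)\<close>, again by injectivity. Under \<open>D/(x\<^sup>n)D \<cong> 0 :\<^sub>E (x\<^sup>n)\<close> multiplication by
  \<open>\<pi>\<close> becomes the inclusion, because \<open>(\<pi> f) (h (n + 1)) = f (h n)\<close>. Hence \<open>H\<^sup>i\<^sub>I(D)\<close> is the union of
  the submodules \<open>0 :\<^sub>E (x\<^sup>n)\<close> of \<open>E\<close>, and this union is \<open>E\<close> since every element of the injective hull
  of the residue field is killed by a power of each element of the maximal ideal.

  The colimit description is obtained inside an arbitrary injective resolution \<open>J\<close>, by adding one
  element of the sequence at a time to the set \<open>S\<close> in the subcomplex of \<open>S\<close>-torsion elements. The only
  input about the modules of the resolution is that every element is divisible by \<open>x\<^sup>n\<close> up to \<open>x\<close>-torsion,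
  without losing annihilators (\<open>injective_divide\<close>). The results that carry the proof are
  \<open>rep_boundary_iff\<close> (the colimit), \<open>cancel_list_prod_power\<close> and \<open>colon_of_powers\<close> (regular
  sequences), \<open>hom_in_lspan\<close> (duality) and \<open>injective_hull_torsion\<close>.
\<close>

section \<open>Regular sequences in noetherian local rings\<close>

text \<open>The ideal generated by an ideal \<open>U\<close> and the entries of a list, in the concrete form of linear
  combinations, so that membership can be unfolded one generator at a time.\<close>

primrec adjoin :: "('a, 'm) ring_scheme \<Rightarrow> 'a set \<Rightarrow> 'a list \<Rightarrow> 'a set" where
  "adjoin R U [] = U"
| "adjoin R U (y # ys) = {u \<oplus>\<^bsub>R\<^esub> y \<otimes>\<^bsub>R\<^esub> r |u r. u \<in> adjoin R U ys \<and> r \<in> carrier R}"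

text \<open>Recursion along the sequence, with a base ideal that absorbs the elements already used, makes it
  possible to exchange two neighbours at the front without touching the rest.\<close>

primrec weakly_regular :: "('a, 'm) ring_scheme \<Rightarrow> 'a set \<Rightarrow> 'a list \<Rightarrow> bool" where
  "weakly_regular R U [] \<longleftrightarrow> True"
| "weakly_regular R U (y # ys) \<longleftrightarrow>
     (\<forall>r\<in>carrier R. y \<otimes>\<^bsub>R\<^esub> r \<in> U \<longrightarrow> r \<in> U) \<and> weakly_regular R (adjoin R U [y]) ys"

abbreviation powers :: "('a, 'm) ring_scheme \<Rightarrow> nat \<Rightarrow> 'a list \<Rightarrow> 'a list" where
  "powers R n ys \<equiv> map (\<lambda>y. y [^]\<^bsub>R\<^esub> n) ys"

primrec list_prod :: "('a, 'm) ring_scheme \<Rightarrow> 'a list \<Rightarrow> 'a" where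
  "list_prod R [] = \<one>\<^bsub>R\<^esub>"
| "list_prod R (y # ys) = y \<otimes>\<^bsub>R\<^esub> list_prod R ys"

lemma weakly_regularD:
  assumes "weakly_regular R U (y # ys)"
  shows "r \<in> carrier R \<Longrightarrow> y \<otimes>\<^bsub>R\<^esub> r \<in> U \<Longrightarrow> r \<in> U"
    and "weakly_regular R (adjoin R U [y]) ys"
  using assms by (auto simp del: adjoin.simps)

context cring
begin

lemma ideal_memD:
  assumes "ideal U R"
  shows "u \<in> U \<Longrightarrow> u \<in> carrier R" "\<zero> \<in> U"
    and "u \<in> U \<Longrightarrow> v \<in> U \<Longrightarrow> u \<oplus> v \<in> U" "u \<in> U \<Longrightarrow> v \<in> U \<Longrightarrow> u \<ominus> v \<in> U"
    and "u \<in> U \<Longrightarrow> r \<in> carrier R \<Longrightarrow> r \<otimes> u \<in> U" "u \<in> U \<Longrightarrow> r \<in> carrier R \<Longrightarrow> u \<otimes> r \<in> U"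
proof -
  interpret ideal U R by fact
  show "u \<in> U \<Longrightarrow> u \<in> carrier R" "\<zero> \<in> U"
    "u \<in> U \<Longrightarrow> v \<in> U \<Longrightarrow> u \<oplus> v \<in> U"
    "u \<in> U \<Longrightarrow> r \<in> carrier R \<Longrightarrow> r \<otimes> u \<in> U" "u \<in> U \<Longrightarrow> r \<in> carrier R \<Longrightarrow> u \<otimes> r \<in> U"
    using Icarr I_l_closed I_r_closed by auto
  show "u \<in> U \<Longrightarrow> v \<in> U \<Longrightarrow> u \<ominus> v \<in> U" by (simp add: a_minus_def)
qed

lemma list_prod_closed [simp, intro]: "set ys \<subseteq> carrier R \<Longrightarrow> list_prod R ys \<in> carrier R"
  by (induction ys) auto

lemma adjoin_consI:
  "u \<in> adjoin R U ys \<Longrightarrow> r \<in> carrier R \<Longrightarrow> u \<oplus> y \<otimes> r \<in> adjoin R U (y # ys)"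
  by auto

lemma adjoin_diffI:
  assumes "r \<in> carrier R" "y \<in> carrier R" "q \<in> carrier R" "r \<ominus> y \<otimes> q \<in> adjoin R U ys"
  shows "r \<in> adjoin R U (y # ys)"
proof -
  have "(r \<ominus> y \<otimes> q) \<oplus> y \<otimes> q = r" using assms by (simp add: a_minus_def a_assoc l_neg)
  then show ?thesis using adjoin_consI[OF assms(4,3), of y] by simp
qed

text \<open>The computation behind the exchange of \<open>x\<close> and \<open>y\<close>: an element of \<open>U + y R\<close> divisible by \<open>x\<close>
  yields a multiple of \<open>x\<close> in \<open>U + y U\<close>.\<close>

lemma exchange_coefficients:
  assumes "x \<otimes> r = u \<oplus> y \<otimes> t" "t = v \<oplus> x \<otimes> q"
    and R: "x \<in> carrier R" "y \<in> carrier R" "r \<in> carrier R" "u \<in> carrier R" "v \<in> carrier R" "q \<in> carrier R"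
  shows "x \<otimes> (r \<ominus> y \<otimes> q) = u \<oplus> y \<otimes> v"
proof -
  have "x \<otimes> (r \<ominus> y \<otimes> q) = x \<otimes> r \<ominus> y \<otimes> (x \<otimes> q)"
    using R by (simp add: a_minus_def r_distr r_minus m_lcomm)
  also have "\<dots> = u \<oplus> y \<otimes> v"
    unfolding assms(1,2) using R by (simp add: a_minus_def r_distr a_assoc r_neg)
  finally show ?thesis .
qed

lemma adjoin_ideal: "ideal U R \<Longrightarrow> set ys \<subseteq> carrier R \<Longrightarrow> ideal (adjoin R U ys) R"
proof (induction ys)
  case (Cons y ys)
  have "adjoin R U (y # ys) = adjoin R U ys <+>\<^bsub>R\<^esub> PIdl y"
    using Cons.prems m_comm[of y] by (force simp: set_add_def' cgenideal_def)
  then show ?case using Cons by (auto intro!: add_ideals cgenideal_ideal)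
qed simp

lemma adjoin_base: "ideal U R \<Longrightarrow> set ys \<subseteq> carrier R \<Longrightarrow> u \<in> U \<Longrightarrow> u \<in> adjoin R U ys"
proof (induction ys)
  case (Cons y ys)
  then show ?case
    using adjoin_consI[of u U ys \<zero> y] by (simp add: ideal_memD(1) del: adjoin.simps(2))
qed simp

lemma adjoin_tail:
  "ideal U R \<Longrightarrow> set (y # ys) \<subseteq> carrier R \<Longrightarrow> u \<in> adjoin R U ys \<Longrightarrow> u \<in> adjoin R U (y # ys)"
  using ideal_memD(1)[OF adjoin_ideal, of U ys u]
    adjoin_consI[of u U ys \<zero> y] by (simp del: adjoin.simps(2))

lemma adjoin_head:
  "ideal U R \<Longrightarrow> set (y # ys) \<subseteq> carrier R \<Longrightarrow> r \<in> carrier R \<Longrightarrow> y \<otimes> r \<in> adjoin R U (y # ys)"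
  using ideal_memD(2)[OF adjoin_ideal, of U ys]
    adjoin_consI[of \<zero> U ys r y] by (simp del: adjoin.simps(2))

lemma adjoin_member:
  assumes "ideal U R" "set ys \<subseteq> carrier R" "y \<in> set ys" shows "y \<in> adjoin R U ys"
  using assms
proof (induction ys)
  case (Cons a ys)
  show ?case
  proof (cases "y = a")
    case True
    then show ?thesis using adjoin_head[OF Cons.prems(1,2) one_closed] Cons.prems by simp
  next
    case False
    then show ?thesis using adjoin_tail[OF Cons.prems(1,2)] Cons by simp
  qed
qed simp

lemma adjoin_minimal:
  assumes "ideal U R" "set ys \<subseteq> carrier R" "ideal V R" "U \<subseteq> V" "set ys \<subseteq> V"
  shows "adjoin R U ys \<subseteq> V"
  using assms(2,5)
proof (induction ys)
  case (Cons y ys)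
  then show ?case
    by (auto intro!: ideal_memD(3)[OF assms(3)] ideal_memD(6)[OF assms(3)])
qed (use assms in simp)

lemma adjoin_eq_genideal:
  assumes "set ys \<subseteq> carrier R" shows "adjoin R {\<zero>} ys = Idl (set ys)"
proof
  show "adjoin R {\<zero>} ys \<subseteq> Idl (set ys)"
    using assms genideal_ideal[OF assms] genideal_self[OF assms]
    by (intro adjoin_minimal) (auto simp: zeroideal ideal_memD(2))
  show "Idl (set ys) \<subseteq> adjoin R {\<zero>} ys"
    using assms by (intro genideal_minimal adjoin_ideal) (auto simp: zeroideal intro: adjoin_member)
qed

lemma adjoin_set_cong:
  assumes "ideal U R" "set ys \<subseteq> carrier R" "set ys = set zs"
  shows "adjoin R U ys = adjoin R U zs"
  using assms
  by (intro equalityI adjoin_minimal adjoin_ideal) (auto intro: adjoin_base adjoin_member)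

lemma adjoin_adjoin:
  assumes "ideal U R" "set ys \<subseteq> carrier R" "set zs \<subseteq> carrier R"
  shows "adjoin R (adjoin R U ys) zs = adjoin R U (ys @ zs)"
proof
  show "adjoin R (adjoin R U ys) zs \<subseteq> adjoin R U (ys @ zs)"
    using assms
    using assms adjoin_base[OF assms(1), of "ys @ zs"] adjoin_member[OF assms(1), of "ys @ zs"]
    by (intro adjoin_minimal adjoin_ideal subsetI) auto
  have i: "ideal (adjoin R U ys) R" using assms adjoin_ideal by blast
  show "adjoin R U (ys @ zs) \<subseteq> adjoin R (adjoin R U ys) zs"
    using assms i adjoin_base[OF i, of zs] adjoin_member[OF i, of zs]
      adjoin_base[OF assms(1), of ys] adjoin_member[OF assms(1), of ys]
    by (intro adjoin_minimal adjoin_ideal subsetI) auto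
qed

lemma weakly_regular_append:
  assumes "ideal U R" "set (ys @ zs) \<subseteq> carrier R"
  shows "weakly_regular R U (ys @ zs) \<longleftrightarrow>
    weakly_regular R U ys \<and> weakly_regular R (adjoin R U ys) zs"
  using assms
proof (induction ys arbitrary: U)
  case (Cons y ys)
  have "ideal (adjoin R U [y]) R" using Cons.prems by (intro adjoin_ideal) auto
  moreover have "adjoin R (adjoin R U [y]) ys = adjoin R U (y # ys)"
    using Cons.prems by (subst adjoin_adjoin) auto
  ultimately show ?case using Cons.IH[of "adjoin R U [y]"] Cons.prems by auto
qed simp

lemma regular_sequence_imp_weakly_regular:
  assumes "regular_sequence R xs"
  shows "weakly_regular R {\<zero>} xs"
proof -
  have xs: "set xs \<subseteq> carrier R" using assms by (simp add: regular_sequence_def)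
  have "weakly_regular R {\<zero>} (take j xs)" if "j \<le> length xs" for j
    using that
  proof (induction j)
    case (Suc j)
    have tj: "set (take j xs) \<subseteq> carrier R" using xs set_take_subset by fastforce
    have xj: "xs ! j \<in> carrier R" using Suc.prems xs by auto
    have t: "take (Suc j) xs = take j xs @ [xs ! j]"
      using Suc.prems by (simp add: take_Suc_conv_app_nth)
    have "r \<in> adjoin R {\<zero>} (take j xs)"
      if "r \<in> carrier R" "xs ! j \<otimes> r \<in> adjoin R {\<zero>} (take j xs)" for r
      using that assms Suc.prems xj unfolding regular_sequence_def adjoin_eq_genideal[OF tj]
      by (auto simp: m_comm)
    then show ?case
      using Suc tj xj unfolding t by (subst weakly_regular_append) (auto simp: zeroideal)
  qed simp
  from this[of "length xs"] show ?thesis by simp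
qed

end

lemma (in noetherian_ring) ascending_ideals_stabilise:
  assumes "\<And>n. ideal (f n) R" "\<And>n. f n \<subseteq> f (Suc n)"
  obtains N :: nat where "\<And>n. f (N + n) = f N"
proof -
  have mono: "mono f" using assms(2) by (rule mono_iff_le_Suc[THEN iffD2, rule_format])
  have "f m \<subseteq> f n \<or> f n \<subseteq> f m" for m n using monoD[OF mono] nat_le_linear[of m n] by blast
  then have "subset.chain {I. ideal I R} (range f)"
    unfolding subset_chain_def using assms(1) by blast
  then have "\<Union>(range f) \<in> range f" by (intro ideal_chain_is_trivial) auto
  then obtain N where N: "\<Union>(range f) = f N" by auto
  have "f (N + n) = f N" for n using N monoD[OF mono, of N "N + n"] by auto
  then show ?thesis by (rule that)
qed

locale noetherian_local = noetherian_ring R + cring R for R (structure) +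
  fixes \<mm> :: "'a set"
  assumes local: "local_ring R \<mm>"
begin

lemma max: "maximalideal \<mm> R" and max_unique: "maximalideal \<nn> R \<Longrightarrow> \<nn> = \<mm>"
  using local by (auto simp: local_ring_def)

lemma max_ideal: "ideal \<mm> R" using max by (simp add: maximalideal_def)

text \<open>In a noetherian ring Zorn's lemma applied to the proper ideals above \<open>U\<close> gives a maximal ideal,
  and there is only one.\<close>

lemma proper_ideal_subset_max:
  assumes U: "ideal U R" and "\<one> \<notin> U"
  shows "U \<subseteq> \<mm>"
proof -
  define P where "P = {V. ideal V R \<and> U \<subseteq> V \<and> \<one> \<notin> V}"
  have "\<exists>V\<in>P. \<forall>W\<in>P. V \<subseteq> W \<longrightarrow> W = V"
  proof (rule subset_Zorn_nonempty)
    show "P \<noteq> {}" using assms by (auto simp: P_def)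
    fix C assume C: "C \<noteq> {}" "subset.chain P C"
    have "subset.chain {I. ideal I R} C" using C(2) by (auto simp: P_def subset.chain_def)
    from ideal_chain_is_trivial[OF C(1) this] show "\<Union>C \<in> P" using C(2) by (auto simp: subset.chain_def)
  qed
  then obtain V where V: "V \<in> P" "\<And>W. W \<in> P \<Longrightarrow> V \<subseteq> W \<Longrightarrow> W = V" by blast
  have "maximalideal V R"
  proof (rule maximalidealI)
    show "ideal V R" using V by (simp add: P_def)
    show "carrier R \<noteq> V" using V by (auto simp: P_def)
    fix W assume W: "ideal W R" "V \<subseteq> W" "W \<subseteq> carrier R"
    show "W = V \<or> W = carrier R"
      using V W ideal.one_imp_carrier[OF W(1)] by (cases "\<one> \<in> W") (auto simp: P_def)
  qed
  then show ?thesis using V max_unique by (auto simp: P_def)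
qed

lemma one_minus_unit:
  assumes x: "x \<in> \<mm>" and a: "a \<in> carrier R"
  obtains b where "b \<in> carrier R" "b \<otimes> (\<one> \<ominus> a \<otimes> x) = \<one>"
proof -
  have xR: "x \<in> carrier R" using x max_ideal ideal_memD(1) by blast
  let ?t = "\<one> \<ominus> a \<otimes> x"
  have tR: "?t \<in> carrier R" using xR a by simp
  have "\<one> \<in> PIdl ?t"
  proof (rule ccontr)
    assume "\<one> \<notin> PIdl ?t"
    then have "?t \<in> \<mm>"
      using proper_ideal_subset_max[OF cgenideal_ideal[OF tR]] cgenideal_self[OF tR] by auto
    then have "?t \<oplus> a \<otimes> x \<in> \<mm>" using x a max_ideal by (simp add: ideal_memD)
    moreover have "?t \<oplus> a \<otimes> x = \<one>" using xR a by (simp add: a_minus_def a_assoc l_neg)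
    ultimately have "\<mm> = carrier R" using ideal.one_imp_carrier[OF max_ideal] by simp
    then show False using max by (simp add: maximalideal_def maximalideal_axioms_def)
  qed
  then show ?thesis using that by (auto simp: cgenideal_def)
qed

text \<open>If \<open>x, y\<close> is regular modulo \<open>U\<close>, so is \<open>y, x\<close>. The regularity of \<open>y\<close> is where locality enters: an
  element \<open>r\<close> with \<open>y r \<in> U\<close> is congruent to \<open>x s\<close> with again \<open>y s \<in> U\<close>, and so on, which
  yields an ascending chain of ideals \<open>U + s\<^sub>n R\<close>. Where the chain stops, \<open>1 - a x\<close> annihilates
  \<open>s\<^bsub>N+1\<^esub>\<close> modulo \<open>U\<close>, and \<open>1 - a x\<close> is a unit. This replaces an appeal to Nakayama's lemma.\<close>

lemma regular_swap:
  assumes U: "ideal U R" and x: "x \<in> \<mm>" and y: "y \<in> carrier R"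
    and xreg: "\<And>r. r \<in> carrier R \<Longrightarrow> x \<otimes> r \<in> U \<Longrightarrow> r \<in> U"
    and yreg: "\<And>r. r \<in> carrier R \<Longrightarrow> y \<otimes> r \<in> adjoin R U [x] \<Longrightarrow> r \<in> adjoin R U [x]"
  shows "r \<in> carrier R \<Longrightarrow> y \<otimes> r \<in> U \<Longrightarrow> r \<in> U"
    and "r \<in> carrier R \<Longrightarrow> x \<otimes> r \<in> adjoin R U [y] \<Longrightarrow> r \<in> adjoin R U [y]"
proof -
  have xR: "x \<in> carrier R" using x max_ideal ideal_memD(1) by blast
  note U' = ideal_memD[OF U]
  show "r \<in> U" if r: "r \<in> carrier R" and yr: "y \<otimes> r \<in> U"
  proof -
    have step: "\<exists>k'. (k' \<in> carrier R \<and> y \<otimes> k' \<in> U) \<and> k \<ominus> x \<otimes> k' \<in> U"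
      if k: "k \<in> carrier R \<and> y \<otimes> k \<in> U" for k
    proof -
      have "k \<in> adjoin R U [x]"
        using k yreg adjoin_base[OF U, of "[x]"] xR by auto
      then obtain u k' where k': "u \<in> U" "k' \<in> carrier R" "k = u \<oplus> x \<otimes> k'" by auto
      have uR: "u \<in> carrier R" using k' U' by blast
      have "x \<otimes> (y \<otimes> k') = y \<otimes> k \<ominus> y \<otimes> u"
        using k' uR xR y by (simp add: r_distr a_minus_def m_lcomm a_ac r_neg r_neg1 r_neg2)
      then have "x \<otimes> (y \<otimes> k') \<in> U" using k k'(1) y U' by simp
      then have "y \<otimes> k' \<in> U" using xreg k' y by simp
      moreover have "k \<ominus> x \<otimes> k' = u" using k' uR xR by (simp add: a_minus_def a_assoc r_neg)
      ultimately show ?thesis using k' by auto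
    qed
    obtain s where s0: "s 0 = r" and s: "\<And>n. s n \<in> carrier R \<and> y \<otimes> s n \<in> U"
      and sS: "\<And>n. s n \<ominus> x \<otimes> s (Suc n) \<in> U"
    proof -
      \<comment> \<open>The clause for \<open>n = 0\<close> fixes the start of the sequence.\<close>
      have "\<exists>f. \<forall>n. (f n \<in> carrier R \<and> y \<otimes> f n \<in> U \<and> (n = 0 \<longrightarrow> f n = r)) \<and> f n \<ominus> x \<otimes> f (Suc n) \<in> U"
        by (rule dependent_nat_choice) (use r yr step in auto)
      then show ?thesis using that by metis
    qed
    have decomp: "s n = (s n \<ominus> x \<otimes> s (Suc n)) \<oplus> s (Suc n) \<otimes> x" for n
      using s xR by (simp add: a_minus_def a_assoc m_comm l_neg)
    define V where "V n = adjoin R U [s n]" for n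
    have Vi: "ideal (V n) R" for n unfolding V_def using s U by (intro adjoin_ideal) auto
    have "V n \<subseteq> V (Suc n)" for n
    proof -
      have "s n \<in> V (Suc n)"
        unfolding V_def using decomp[of n] sS[of n] xR by (auto intro!: exI)
      then show ?thesis
        unfolding V_def using s U
        by (intro adjoin_minimal) (auto intro!: adjoin_ideal adjoin_base simp del: adjoin.simps(2))
    qed
    then obtain N where N: "\<And>n. V (N + n) = V N" using ascending_ideals_stabilise[of V] Vi by blast
    have "s (Suc N) \<in> V (Suc N)" unfolding V_def using s U by (intro adjoin_member) auto
    then have "s (Suc N) \<in> V N" using N[of 1] by simp
    then obtain u a where ua: "u \<in> U" "a \<in> carrier R" "s (Suc N) = u \<oplus> s N \<otimes> a"
      by (auto simp: V_def)
    have uR: "u \<in> carrier R" using ua U' by blast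
    obtain b where b: "b \<in> carrier R" "b \<otimes> (\<one> \<ominus> a \<otimes> x) = \<one>" using one_minus_unit[OF x ua(2)] .
    have c: "s N \<in> carrier R" "s (Suc N) \<in> carrier R" using s by auto
    define w where "w = s N \<ominus> x \<otimes> s (Suc N)"
    have w: "w \<in> U" "w \<in> carrier R" using sS U' by (auto simp: w_def)
    have sN: "s N = w \<oplus> x \<otimes> s (Suc N)" using c xR by (simp add: w_def a_minus_def a_assoc l_neg)
    \<comment> \<open>Substituting \<open>s\<^sub>N = w + x s\<^bsub>N+1\<^esub>\<close> into \<open>s\<^bsub>N+1\<^esub> = u + a s\<^sub>N\<close>.\<close>
    have alg: "t \<ominus> (a \<otimes> x) \<otimes> t' = u \<oplus> w \<otimes> a"
      if "t = u \<oplus> (w \<oplus> x \<otimes> t') \<otimes> a" "t' \<in> carrier R" for t t'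
    proof -
      have "t = u \<oplus> (w \<otimes> a \<oplus> (a \<otimes> x) \<otimes> t')"
        unfolding that(1) using that(2) w xR uR ua(2) by (simp add: l_distr r_distr m_ac)
      then have "t \<ominus> (a \<otimes> x) \<otimes> t' = (u \<oplus> (w \<otimes> a \<oplus> (a \<otimes> x) \<otimes> t')) \<ominus> (a \<otimes> x) \<otimes> t'"
        by (rule arg_cong)
      also have "\<dots> = u \<oplus> w \<otimes> a"
        using that w xR uR ua(2) by (simp add: a_minus_def a_assoc r_neg)
      finally show ?thesis .
    qed
    have "s (Suc N) \<ominus> (a \<otimes> x) \<otimes> s (Suc N) = u \<oplus> w \<otimes> a"
      by (rule alg[OF _ c(2)]) (use ua(3) sN in simp)
    then have "(\<one> \<ominus> a \<otimes> x) \<otimes> s (Suc N) \<in> U"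
      using c w xR uR ua U' by (simp add: l_distr a_minus_def l_minus)
    then have "b \<otimes> ((\<one> \<ominus> a \<otimes> x) \<otimes> s (Suc N)) \<in> U" using b U' by simp
    then have "s (Suc N) \<in> U" using b c xR ua by (simp flip: m_assoc)
    moreover have down: "s n \<in> U" if "s (Suc n) \<in> U" for n
      using U'(3)[OF sS[of n] U'(6)[OF that xR]] by (subst decomp) simp
    have "s n \<in> U \<longrightarrow> s 0 \<in> U" for n by (induction n) (use down in auto)
    ultimately have "s 0 \<in> U" by blast
    then show ?thesis using s0 by simp
  qed
  show "r \<in> adjoin R U [y]" if r: "r \<in> carrier R" and xr: "x \<otimes> r \<in> adjoin R U [y]"
  proof -
    obtain u t where ut: "u \<in> U" "t \<in> carrier R" "x \<otimes> r = u \<oplus> y \<otimes> t" using xr by auto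
    have uR: "u \<in> carrier R" using ut U' by blast
    have "y \<otimes> t = (\<ominus> u) \<oplus> x \<otimes> r" using ut uR y by (simp add: r_neg1)
    moreover have "\<ominus> u \<in> U" using U'(4)[OF U'(2) ut(1)] uR by (simp add: a_minus_def)
    ultimately have "y \<otimes> t \<in> adjoin R U [x]" using r by auto
    then have "t \<in> adjoin R U [x]" by (rule yreg[OF ut(2)])
    then obtain v q where vq: "v \<in> U" "q \<in> carrier R" "t = v \<oplus> x \<otimes> q" by auto
    have vR: "v \<in> carrier R" using vq U' by blast
    have "x \<otimes> (r \<ominus> y \<otimes> q) = u \<oplus> y \<otimes> v"
      by (rule exchange_coefficients[OF ut(3) vq(3) xR y r uR vR vq(2)])
    moreover have "u \<oplus> y \<otimes> v \<in> U" using ut(1) vq(1) y by (intro U'(3) U'(5)) auto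
    ultimately have "r \<ominus> y \<otimes> q \<in> U" using xreg[of "r \<ominus> y \<otimes> q"] vq(2) y r by simp
    then show ?thesis using adjoin_diffI[OF r y vq(2), of U "[]"] by simp
  qed
qed

lemma weakly_regular_swap:
  assumes U: "ideal U R" and x: "x \<in> \<mm>" and y: "y \<in> carrier R" and ys: "set ys \<subseteq> carrier R"
    and reg: "weakly_regular R U (x # y # ys)"
  shows "weakly_regular R U (y # x # ys)"
proof -
  have xR: "x \<in> carrier R" using x max_ideal ideal_memD(1) by blast
  have eq: "adjoin R (adjoin R U [x]) [y] = adjoin R (adjoin R U [y]) [x]"
    using U xR y adjoin_set_cong[OF U, of "[x, y]" "[y, x]"]
    by (simp add: adjoin_adjoin insert_commute del: adjoin.simps(2))
  note D = weakly_regularD[OF reg] weakly_regularD[OF weakly_regularD(2)[OF reg]]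
  note sw = regular_swap[OF U x y D(1) D(3)]
  show ?thesis
    using sw D(4) unfolding eq weakly_regular.simps by blast
qed

lemma regular_power:
  assumes "ideal U R" "x \<in> carrier R" "\<And>r. r \<in> carrier R \<Longrightarrow> x \<otimes> r \<in> U \<Longrightarrow> r \<in> U"
    and "r \<in> carrier R" "x [^] (n::nat) \<otimes> r \<in> U"
  shows "r \<in> U"
  using assms(4,5)
proof (induction n arbitrary: r)
  case (Suc n)
  then have "x [^] n \<otimes> (x \<otimes> r) \<in> U" using assms(2) by (simp add: m_assoc)
  then have "x \<otimes> r \<in> U" using Suc.IH[of "x \<otimes> r"] Suc.prems(1) assms(2) by simp
  then show ?case using assms(3)[OF Suc.prems(1)] by blast
qed simp

text \<open>A regular sequence stays regular when its last element is replaced by a power, and \<open>x\<close> can be moved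
  to the end by exchanges. The induction exchanges \<open>x\<close> with the next element \<open>y\<close> and obtains the
  regularity of \<open>y\<close> modulo \<open>U + x\<^sup>a R\<close> from that of \<open>x\<^sup>a\<close> modulo \<open>U + y R\<close>.\<close>

lemma weakly_regular_adjoin_power:
  assumes "ideal U R" "x \<in> \<mm>" "set xs \<subseteq> \<mm>" "weakly_regular R U (x # xs)"
  shows "weakly_regular R (adjoin R U [x [^] (a::nat)]) xs"
  using assms
proof (induction xs arbitrary: U)
  case (Cons y ys)
  have mR: "\<And>z. z \<in> \<mm> \<Longrightarrow> z \<in> carrier R" using ideal_memD(1)[OF max_ideal] .
  note U = Cons.prems(1)
  have R: "x \<in> carrier R" "y \<in> carrier R" "set ys \<subseteq> carrier R" using Cons.prems(2,3) mR by auto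
  have iy: "ideal (adjoin R U [y]) R" using adjoin_ideal[OF U, of "[y]"] R by simp
  have sw: "weakly_regular R U (y # x # ys)"
    by (rule weakly_regular_swap[OF U Cons.prems(2) R(2,3) Cons.prems(4)])
  note yreg = weakly_regularD(1)[OF sw] and sw' = weakly_regularD(2)[OF sw]
  note xreg = weakly_regularD(1)[OF sw']
  have "weakly_regular R (adjoin R (adjoin R U [y]) [x [^] a]) ys"
    using Cons.IH[OF iy Cons.prems(2) _ sw'] Cons.prems(3) by simp
  moreover have "adjoin R (adjoin R U [y]) [x [^] a] = adjoin R (adjoin R U [x [^] a]) [y]"
    using adjoin_set_cong[OF U, of "[y, x [^] a]" "[x [^] a, y]"] U R
    by (simp add: adjoin_adjoin insert_commute del: adjoin.simps(2))
  moreover have "r \<in> adjoin R U [x [^] a]"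
    if r: "r \<in> carrier R" and yr: "y \<otimes> r \<in> adjoin R U [x [^] a]" for r
  proof -
    obtain u s where us: "u \<in> U" "s \<in> carrier R" "y \<otimes> r = u \<oplus> x [^] a \<otimes> s" using yr by auto
    have uR: "u \<in> carrier R" using us ideal_memD(1)[OF U] by blast
    have "x [^] a \<otimes> s = \<ominus> u \<oplus> y \<otimes> r" using us uR R by (simp add: r_neg1)
    moreover have "\<ominus> u \<in> U" using ideal_memD(4)[OF U ideal_memD(2)[OF U] us(1)] uR by (simp add: a_minus_def)
    ultimately have "x [^] a \<otimes> s \<in> adjoin R U [y]" using r by auto
    then have "s \<in> adjoin R U [y]" using regular_power[OF iy R(1) xreg us(2)] by blast
    then obtain v t where vt: "v \<in> U" "t \<in> carrier R" "s = v \<oplus> y \<otimes> t" by auto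
    have vR: "v \<in> carrier R" using vt ideal_memD(1)[OF U] by blast
    have eq: "y \<otimes> (r \<ominus> x [^] a \<otimes> t) = u \<oplus> x [^] a \<otimes> v"
      using R by (intro exchange_coefficients[OF us(3) vt(3) R(2) _ r uR vR vt(2)]) simp
    have "u \<oplus> x [^] a \<otimes> v \<in> U"
      using us(1) vt(1) R(1) by (intro ideal_memD(3)[OF U] ideal_memD(5)[OF U]) auto
    then have "y \<otimes> (r \<ominus> x [^] a \<otimes> t) \<in> U" unfolding eq .
    then have "r \<ominus> x [^] a \<otimes> t \<in> U" by (rule yreg[rotated]) (use r R vt(2) in simp)
    then show ?thesis using adjoin_diffI[OF r _ vt(2), of "x [^] a" U "[]"] R by simp
  qed
  ultimately show ?case by (simp del: adjoin.simps(2))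
qed simp

text \<open>Swap \<open>x\<close> behind the first of the other elements, replace that one by its power, and continue.\<close>

lemma regular_mod_powers:
  assumes "ideal U R" "x \<in> \<mm>" "set xs \<subseteq> \<mm>" "weakly_regular R U (x # xs)"
    and "r \<in> carrier R" "x \<otimes> r \<in> adjoin R U (powers R n xs)"
  shows "r \<in> adjoin R U (powers R n xs)"
  using assms(1,3,4,6)
proof (induction xs arbitrary: U)
  case Nil
  then show ?case using weakly_regularD(1)[OF Nil(3) assms(5)] by simp
next
  case (Cons y ys)
  have mR: "\<And>z. z \<in> \<mm> \<Longrightarrow> z \<in> carrier R" using ideal_memD(1)[OF max_ideal] .
  note U = Cons.prems(1)
  have R: "x \<in> carrier R" "y \<in> carrier R" "set ys \<subseteq> carrier R" using assms(2) Cons.prems(2) mR by auto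
  have sw: "weakly_regular R U (y # x # ys)"
    by (rule weakly_regular_swap[OF U assms(2) R(2,3) Cons.prems(3)])
  have reg: "weakly_regular R (adjoin R U [y [^] n]) (x # ys)"
    using Cons.prems(2) assms(2) by (intro weakly_regular_adjoin_power[OF U _ _ sw]) auto
  have iy: "ideal (adjoin R U [y [^] n]) R" using adjoin_ideal[OF U, of "[y [^] n]"] R by simp
  have "set (powers R n ys) \<subseteq> carrier R" using R by auto
  then have eq: "adjoin R U (powers R n (y # ys)) = adjoin R (adjoin R U [y [^] n]) (powers R n ys)"
    using adjoin_adjoin[OF U, of "[y [^] n]" "powers R n ys"] R by (simp del: adjoin.simps(2))
  show ?case
    using Cons.IH[OF iy _ reg] Cons.prems(2,4) unfolding eq by simp
qed

lemma adjoin_powers_Cons: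
  assumes "ideal U R" "x \<in> carrier R" "set xs \<subseteq> carrier R"
  shows "adjoin R (adjoin R U [x [^] (n::nat)]) (powers R k xs) = adjoin R U (x [^] n # powers R k xs)"
proof -
  have "set (powers R k xs) \<subseteq> carrier R" using assms by auto
  then show ?thesis using adjoin_adjoin[OF assms(1), of "[x [^] n]" "powers R k xs"] assms(2)
    by (simp del: adjoin.simps(2))
qed

lemma cancel_power:
  assumes V: "ideal V R" and x: "x \<in> carrier R"
    and reg: "\<And>r. r \<in> carrier R \<Longrightarrow> x \<otimes> r \<in> V \<Longrightarrow> r \<in> V"
    and r: "r \<in> carrier R" and mem: "x [^] (k::nat) \<otimes> r \<in> adjoin R V [x [^] (n + k)]"
  obtains t where "t \<in> carrier R" "r \<ominus> x [^] n \<otimes> t \<in> V"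
proof -
  obtain v t where vt: "v \<in> V" "t \<in> carrier R" "x [^] k \<otimes> r = v \<oplus> x [^] (n + k) \<otimes> t"
    using mem by auto
  have vR: "v \<in> carrier R" using vt ideal_memD(1)[OF V] by blast
  have "x [^] k \<otimes> (r \<ominus> x [^] n \<otimes> t) = v"
    using vt vR r x
    by (simp add: r_distr a_minus_def r_minus nat_pow_mult a_assoc r_neg add.commute[of k] flip: m_assoc)
  then have "r \<ominus> x [^] n \<otimes> t \<in> V"
    using regular_power[OF V x reg, of "r \<ominus> x [^] n \<otimes> t" k] vt r x by simp
  then show ?thesis using that vt by blast
qed

text \<open>The transition maps \<open>R/(x\<^sup>n) \<rightarrow> R/(x\<^bsup>n+k\<^esup>)\<close>, multiplication by the \<open>k\<close>-th power of the product,
  are injective: the factors \<open>x\<^sup>k\<close> are cancelled one after the other.\<close>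

lemma cancel_list_prod_power:
  assumes "ideal U R" "set xs \<subseteq> \<mm>" "weakly_regular R U xs" "r \<in> carrier R"
    and "list_prod R xs [^] k \<otimes> r \<in> adjoin R U (powers R (n + k) xs)"
  shows "r \<in> adjoin R U (powers R n xs)"
  using assms
proof (induction xs arbitrary: U r)
  case (Cons x xs)
  have mR: "\<And>z. z \<in> \<mm> \<Longrightarrow> z \<in> carrier R" using ideal_memD(1)[OF max_ideal] .
  note U = Cons.prems(1)
  have R: "x \<in> carrier R" "set xs \<subseteq> carrier R" and m: "x \<in> \<mm>" "set xs \<subseteq> \<mm>"
    using Cons.prems(2) mR by auto
  note r = Cons.prems(4)
  let ?U = "adjoin R U [x [^] (n + k)]" and ?V = "adjoin R U (powers R n xs)"
  have iU: "ideal ?U R" using adjoin_ideal[OF U, of "[x [^] (n + k)]"] R by simp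
  have pR: "set (powers R n xs) \<subseteq> carrier R" using R by auto
  have iV: "ideal ?V R" using adjoin_ideal[OF U pR] .
  have reg: "weakly_regular R ?U xs" by (rule weakly_regular_adjoin_power[OF U m Cons.prems(3)])
  have "list_prod R xs [^] k \<otimes> (x [^] k \<otimes> r) = list_prod R (x # xs) [^] k \<otimes> r"
    using R r by (simp add: nat_pow_distrib m_ac)
  then have "list_prod R xs [^] k \<otimes> (x [^] k \<otimes> r) \<in> adjoin R ?U (powers R (n + k) xs)"
    using Cons.prems(5) adjoin_powers_Cons[OF U R] by (simp del: adjoin.simps(2) list_prod.simps(2))
  then have "x [^] k \<otimes> r \<in> adjoin R ?U (powers R n xs)"
    using Cons.IH[OF iU m(2) reg, of "x [^] k \<otimes> r"] R r by simp
  then have "x [^] k \<otimes> r \<in> adjoin R ?V [x [^] (n + k)]"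
    unfolding adjoin_powers_Cons[OF U R] by simp
  then obtain t where t: "t \<in> carrier R" "r \<ominus> x [^] n \<otimes> t \<in> ?V"
    using cancel_power[OF iV R(1) regular_mod_powers[OF U m Cons.prems(3)] r] by metis
  then show ?case using adjoin_diffI[OF r _ t] R by (simp del: adjoin.simps(2))
qed simp

lemma list_prod_power_mult_adjoin:
  assumes "set xs \<subseteq> carrier R" "ideal U R" "r \<in> adjoin R U (powers R n xs)"
  shows "list_prod R xs [^] c \<otimes> r \<in> adjoin R U (powers R (n + c) xs)"
  using assms(1,3)
proof (induction xs arbitrary: r)
  case Nil
  then show ?case using ideal_memD(1)[OF assms(2)] by simp
next
  case (Cons x xs)
  then obtain u t where ut: "u \<in> adjoin R U (powers R n xs)" "t \<in> carrier R" "r = u \<oplus> x [^] n \<otimes> t"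
    by auto
  have R: "x \<in> carrier R" "set xs \<subseteq> carrier R" using Cons.prems by auto
  have pR: "set (powers R k xs) \<subseteq> carrier R" for k using R by auto
  have uR: "u \<in> carrier R" using ut ideal_memD(1)[OF adjoin_ideal[OF assms(2) pR]] by blast
  have "list_prod R (x # xs) [^] c \<otimes> r =
      x [^] c \<otimes> (list_prod R xs [^] c \<otimes> u) \<oplus> x [^] (n + c) \<otimes> (list_prod R xs [^] c \<otimes> t)"
    using ut uR R by (simp add: r_distr nat_pow_distrib nat_pow_mult[symmetric] m_ac)
  moreover have "x [^] c \<otimes> (list_prod R xs [^] c \<otimes> u) \<in> adjoin R U (powers R (n + c) xs)"
    using ideal_memD(5)[OF adjoin_ideal[OF assms(2) pR] Cons.IH[OF R(2) ut(1)]] R by simp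
  ultimately show ?case
    using adjoin_consI[of _ U "powers R (n + c) xs" _ "x [^] (n + c)"] R ut(2)
    by (simp del: adjoin.simps(2) list_prod.simps(2))
qed

text \<open>The ideal \<open>(x\<^bsup>n+c\<^esup>) : (x\<^sup>n)\<close> is generated by \<open>(x\<^bsup>n+c\<^esup>)\<close> and the \<open>c\<close>-th power of the product. In
  terms of local cohomology, every class killed by \<open>(x\<^sup>n)\<close> comes from level \<open>n\<close> of the direct
  system.\<close>

lemma colon_of_powers:
  assumes "ideal U R" "set xs \<subseteq> \<mm>" "weakly_regular R U xs" "r \<in> carrier R"
    and "\<And>x. x \<in> set xs \<Longrightarrow> x [^] n \<otimes> r \<in> adjoin R U (powers R (n + c) xs)"
  shows "\<exists>s\<in>carrier R. r \<ominus> list_prod R xs [^] c \<otimes> s \<in> adjoin R U (powers R (n + c) xs)"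
  using assms
proof (induction xs arbitrary: U)
  case Nil
  then show ?case by (auto intro!: bexI[of _ r] simp: a_minus_def r_neg ideal_memD(2))
next
  case (Cons x xs)
  have mR: "\<And>z. z \<in> \<mm> \<Longrightarrow> z \<in> carrier R" using ideal_memD(1)[OF max_ideal] .
  note U = Cons.prems(1)
  have R: "x \<in> carrier R" "set xs \<subseteq> carrier R" and m: "x \<in> \<mm>" "set xs \<subseteq> \<mm>"
    using Cons.prems(2) mR by auto
  note r = Cons.prems(4)
  let ?p = "list_prod R xs [^] c"
  let ?U = "adjoin R U [x [^] (n + c)]" and ?V = "adjoin R U (powers R n xs)"
  let ?W = "adjoin R U (powers R (n + c) (x # xs))"
  have pR: "?p \<in> carrier R" using R by simp
  have iU: "ideal ?U R" using adjoin_ideal[OF U, of "[x [^] (n + c)]"] R by simp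
  have "set (powers R n xs) \<subseteq> carrier R" using R by auto
  then have iV: "ideal ?V R" using adjoin_ideal[OF U] by blast
  have pW: "set (powers R (n + c) (x # xs)) \<subseteq> carrier R" using R by auto
  have iW: "ideal ?W R" using adjoin_ideal[OF U pW] .
  have UW: "adjoin R ?U (powers R (n + c) xs) = ?W"
    using adjoin_powers_Cons[OF U R] by simp
  have reg: "weakly_regular R ?U xs" by (rule weakly_regular_adjoin_power[OF U m Cons.prems(3)])
  have "y [^] n \<otimes> r \<in> adjoin R ?U (powers R (n + c) xs)" if "y \<in> set xs" for y
    unfolding UW using Cons.prems(5)[of y] that by simp
  from Cons.IH[OF iU m(2) reg r this]
  obtain s where s: "s \<in> carrier R" "r \<ominus> ?p \<otimes> s \<in> ?W" unfolding UW by blast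
  have "x [^] n \<otimes> r \<ominus> x [^] n \<otimes> (r \<ominus> ?p \<otimes> s) \<in> ?W"
    using Cons.prems(5)[of x] s R by (intro ideal_memD(4)[OF iW] ideal_memD(5)[OF iW s(2)]) auto
  moreover have "x [^] n \<otimes> r \<ominus> x [^] n \<otimes> (r \<ominus> ?p \<otimes> s) = ?p \<otimes> (x [^] n \<otimes> s)"
    using r s(1) R pR by (simp add: a_minus_def r_distr r_minus minus_add r_neg2 m_lcomm)
  ultimately have "?p \<otimes> (x [^] n \<otimes> s) \<in> adjoin R ?U (powers R (n + c) xs)" unfolding UW by simp
  then have "x [^] n \<otimes> s \<in> adjoin R ?U (powers R n xs)"
    using s R by (intro cancel_list_prod_power[OF iU m(2) reg]) auto
  then have "x [^] n \<otimes> s \<in> adjoin R ?V [x [^] (c + n)]"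
    unfolding adjoin_powers_Cons[OF U R] by (simp add: add.commute)
  then obtain t where t: "t \<in> carrier R" "s \<ominus> x [^] c \<otimes> t \<in> ?V"
    using cancel_power[OF iV R(1) regular_mod_powers[OF U m Cons.prems(3)] s(1)] by metis
  have "?p \<otimes> (s \<ominus> x [^] c \<otimes> t) \<in> adjoin R U (powers R (n + c) xs)"
    by (rule list_prod_power_mult_adjoin[OF R(2) U t(2)])
  then have "?p \<otimes> (s \<ominus> x [^] c \<otimes> t) \<in> ?W"
    using adjoin_tail[OF U pW[unfolded list.map]] by simp
  then have "(r \<ominus> ?p \<otimes> s) \<oplus> ?p \<otimes> (s \<ominus> x [^] c \<otimes> t) \<in> ?W"
    by (rule ideal_memD(3)[OF iW s(2)])
  moreover have "(r \<ominus> ?p \<otimes> s) \<oplus> ?p \<otimes> (s \<ominus> x [^] c \<otimes> t) = r \<ominus> list_prod R (x # xs) [^] c \<otimes> t"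
    using r s(1) t(1) R pR
    by (simp add: a_minus_def r_distr r_minus a_assoc r_neg1 nat_pow_distrib m_ac)
  ultimately show ?case using t(1) by auto
qed

end

section \<open>Torsion submodules\<close>

text \<open>Torsion tested on each generator separately. For a finite set of generators this is the torsion
  submodule of the ideal, see \<open>torsion_part_eq_torsion_on\<close>, but it can be enlarged one element at a
  time.\<close>

definition torsion_on :: "('a, 'm) ring_scheme \<Rightarrow> 'a set \<Rightarrow> ('a, 'b, 'n) module_scheme \<Rightarrow> 'b set" where
  "torsion_on R S M = {y \<in> carrier M. \<forall>x\<in>S. \<exists>n::nat. (x [^]\<^bsub>R\<^esub> n) \<odot>\<^bsub>M\<^esub> y = \<zero>\<^bsub>M\<^esub>}"

lemma torsion_onD:
  assumes "y \<in> torsion_on R S M"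
  shows "y \<in> carrier M" and "x \<in> S \<Longrightarrow> \<exists>n::nat. (x [^]\<^bsub>R\<^esub> n) \<odot>\<^bsub>M\<^esub> y = \<zero>\<^bsub>M\<^esub>"
  using assms by (auto simp: torsion_on_def)

lemma (in cring) idealI_cring:
  assumes "A \<subseteq> carrier R" "\<zero> \<in> A" "\<And>a b. a \<in> A \<Longrightarrow> b \<in> A \<Longrightarrow> a \<oplus> b \<in> A"
    and mult: "\<And>a r. a \<in> A \<Longrightarrow> r \<in> carrier R \<Longrightarrow> r \<otimes> a \<in> A"
  shows "ideal A R"
proof (rule idealI)
  show "subgroup A (add_monoid R)"
  proof (rule subgroup.intro)
    fix a assume a: "a \<in> A"
    then have "\<ominus> \<one> \<otimes> a \<in> A" by (intro mult) auto
    then show "inv\<^bsub>add_monoid R\<^esub> a \<in> A" using a assms(1) by (auto simp: l_minus a_inv_def[symmetric])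
  qed (use assms in auto)
  show "a \<otimes> r \<in> A" if "a \<in> A" "r \<in> carrier R" for a r
    using mult[OF that] that assms(1) by (metis m_comm subsetD)
qed (use mult in \<open>auto intro: ring_axioms\<close>)

lemma (in cring) colon_ideal:
  assumes "ideal A R" "c \<in> carrier R"
  shows "ideal {r \<in> carrier R. c \<otimes> r \<in> A} R"
  using assms(2) ideal_memD[OF assms(1)]
  by (intro idealI_cring) (auto simp: r_distr m_lcomm)

lemma (in cring) pow_mem_ideal_power:
  assumes "x \<in> I" "I \<subseteq> carrier R"
  shows "x [^] n \<in> ideal_power R I n"
proof (induction n)
  case 0
  then show ?case by (simp add: nat_pow_def ideals_set_def)
next
  case (Suc n)
  have "ideal_power R I (Suc n) = ideal_prod R (ideal_power R I n) I"
    by (simp add: nat_pow_def ideals_set_def)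
  then show ?case using Suc assms by (auto intro: ideal_prod.prod)
qed

lemma (in cring) ideal_power_Suc:
  "ideal_power R I (Suc n) = ideal_prod R (ideal_power R I n) I"
  by (simp add: nat_pow_def ideals_set_def)

lemma (in cring) ideal_power_is_ideal:
  assumes "ideal I R" shows "ideal (ideal_power R I n) R"
proof (induction n)
  case 0
  then show ?case by (simp add: nat_pow_def ideals_set_def oneideal)
next
  case (Suc n)
  then show ?case unfolding ideal_power_Suc by (rule ideal_prod_is_ideal[OF _ assms])
qed

text \<open>An ideal \<open>A\<close> containing powers of all generators contains a power of the generated ideal. The
  induction replaces \<open>A\<close> by the colon ideals \<open>A : x\<close>, which contain smaller powers.\<close>

lemma (in cring) ideal_power_subset:
  assumes S: "S \<subseteq> carrier R" "finite S"
    and "ideal A R" "\<And>x. x \<in> S \<Longrightarrow> x [^] (f x :: nat) \<in> A"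
  shows "ideal_power R (Idl S) (Suc (sum f S)) \<subseteq> A"
  using assms(3,4)
proof (induction "sum f S" arbitrary: f A rule: less_induct)
  case less
  note A = less.prems(1)
  have I: "ideal (Idl S) R" using genideal_ideal[OF S(1)] .
  note P = ideal_power_is_ideal[OF I]
  show ?case
  proof (cases "\<exists>x\<in>S. f x = 0")
    case True
    then have "\<one> \<in> A" using less.prems(2) by (metis nat_pow_0)
    then have "A = carrier R" using ideal.one_imp_carrier[OF A] by simp
    then show ?thesis using ideal_memD(1)[OF P] by blast
  next
    case False
    have "i \<otimes> j \<in> A" if i: "i \<in> ideal_power R (Idl S) (sum f S)" and j: "j \<in> Idl S" for i j
    proof -
      have iR: "i \<in> carrier R" using i ideal_memD(1)[OF P] by blast
      have "i \<otimes> x \<in> A" if x: "x \<in> S" for x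
      proof -
        define g where "g = f(x := f x - 1)"
        have xR: "x \<in> carrier R" using x S by auto
        have fx: "f x = Suc (g x)" using False x by (auto simp: g_def)
        have "sum f (S - {x}) = sum g (S - {x})" by (intro sum.cong) (auto simp: g_def)
        then have sum: "sum f S = Suc (sum g S)" using x S(2) fx by (simp add: sum.remove[of S x])
        have "ideal_power R (Idl S) (Suc (sum g S)) \<subseteq> {r \<in> carrier R. x \<otimes> r \<in> A}"
        proof (rule less.hyps[OF _ colon_ideal[OF A xR]])
          show "sum g S < sum f S" using sum by simp
          fix y assume y: "y \<in> S"
          have yR: "y \<in> carrier R" using y S by auto
          show "y [^] g y \<in> {r \<in> carrier R. x \<otimes> r \<in> A}"
          proof (cases "y = x")
            case True
            then show ?thesis using less.prems(2)[OF x] xR fx by (simp add: m_comm)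
          next
            case False
            then have "g y = f y" by (simp add: g_def)
            then show ?thesis using less.prems(2)[OF y] yR xR ideal_memD(5)[OF A] by simp
          qed
        qed
        then show ?thesis using i sum iR xR by (auto simp: m_comm)
      qed
      then have "Idl S \<subseteq> {r \<in> carrier R. i \<otimes> r \<in> A}"
        using S by (intro genideal_minimal colon_ideal A iR) auto
      then show ?thesis using j by blast
    qed
    then show ?thesis
      unfolding ideal_power_Suc
      by (intro subsetI) (erule ideal_prod.induct, auto intro: ideal_memD(3)[OF A])
  qed
qed

lemma (in abelian_group) diff_self: "x \<in> carrier G \<Longrightarrow> x \<ominus> x = \<zero>"
  by (simp add: a_minus_def r_neg)

lemma (in abelian_group) diff_zero_iff:
  assumes "x \<in> carrier G" "y \<in> carrier G" shows "x \<ominus> y = \<zero> \<longleftrightarrow> x = y"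
proof
  assume "x \<ominus> y = \<zero>"
  then have "(x \<ominus> y) \<oplus> y = y" using assms by simp
  then show "x = y" using assms by (simp add: a_minus_def a_assoc l_neg)
qed (use assms in \<open>simp add: diff_self\<close>)

lemma (in abelian_group) diff_add_cancel:
  "x \<in> carrier G \<Longrightarrow> y \<in> carrier G \<Longrightarrow> (x \<ominus> y) \<oplus> y = x"
  by (simp add: a_minus_def a_assoc l_neg)

context module
begin

lemma submodule_memD:
  assumes "submodule H R M"
  shows "u \<in> H \<Longrightarrow> u \<in> carrier M" "\<zero>\<^bsub>M\<^esub> \<in> H"
    and "u \<in> H \<Longrightarrow> v \<in> H \<Longrightarrow> u \<oplus>\<^bsub>M\<^esub> v \<in> H" "u \<in> H \<Longrightarrow> \<ominus>\<^bsub>M\<^esub> u \<in> H"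
    and "u \<in> H \<Longrightarrow> v \<in> H \<Longrightarrow> u \<ominus>\<^bsub>M\<^esub> v \<in> H" "u \<in> H \<Longrightarrow> r \<in> carrier R \<Longrightarrow> r \<odot>\<^bsub>M\<^esub> u \<in> H"
proof -
  note E = submoduleE[OF assms]
  show "u \<in> H \<Longrightarrow> u \<in> carrier M" "u \<in> H \<Longrightarrow> v \<in> H \<Longrightarrow> u \<oplus>\<^bsub>M\<^esub> v \<in> H" "u \<in> H \<Longrightarrow> \<ominus>\<^bsub>M\<^esub> u \<in> H"
    "u \<in> H \<Longrightarrow> r \<in> carrier R \<Longrightarrow> r \<odot>\<^bsub>M\<^esub> u \<in> H"
    using E by auto
  show "u \<in> H \<Longrightarrow> v \<in> H \<Longrightarrow> u \<ominus>\<^bsub>M\<^esub> v \<in> H" using E by (auto simp: a_minus_def)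
  obtain h where "h \<in> H" using E(2) by auto
  then have "\<zero> \<odot>\<^bsub>M\<^esub> h \<in> H" "h \<in> carrier M" using E by auto
  then show "\<zero>\<^bsub>M\<^esub> \<in> H" by simp
qed

lemma smult_minus:
  "a \<in> carrier R \<Longrightarrow> x \<in> carrier M \<Longrightarrow> y \<in> carrier M \<Longrightarrow>
    a \<odot>\<^bsub>M\<^esub> (x \<ominus>\<^bsub>M\<^esub> y) = a \<odot>\<^bsub>M\<^esub> x \<ominus>\<^bsub>M\<^esub> a \<odot>\<^bsub>M\<^esub> y"
  by (simp add: a_minus_def smult_r_distr smult_r_minus)

lemma smult_left_minus:
  "a \<in> carrier R \<Longrightarrow> b \<in> carrier R \<Longrightarrow> x \<in> carrier M \<Longrightarrow>
    (a \<ominus>\<^bsub>R\<^esub> b) \<odot>\<^bsub>M\<^esub> x = a \<odot>\<^bsub>M\<^esub> x \<ominus>\<^bsub>M\<^esub> b \<odot>\<^bsub>M\<^esub> x"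
  by (simp add: a_minus_def smult_l_distr smult_l_minus)

lemma smult_lcomm:
  "a \<in> carrier R \<Longrightarrow> b \<in> carrier R \<Longrightarrow> x \<in> carrier M \<Longrightarrow>
    a \<odot>\<^bsub>M\<^esub> (b \<odot>\<^bsub>M\<^esub> x) = b \<odot>\<^bsub>M\<^esub> (a \<odot>\<^bsub>M\<^esub> x)"
  by (simp add: m_comm flip: smult_assoc1)

lemma smult_pow_add:
  "a \<in> carrier R \<Longrightarrow> x \<in> carrier M \<Longrightarrow>
    a [^] (m + n :: nat) \<odot>\<^bsub>M\<^esub> x = a [^] m \<odot>\<^bsub>M\<^esub> (a [^] n \<odot>\<^bsub>M\<^esub> x)"
  by (simp add: nat_pow_mult flip: smult_assoc1)

lemma annihilator_ideal:
  assumes "y \<in> carrier M" shows "ideal {a \<in> carrier R. a \<odot>\<^bsub>M\<^esub> y = \<zero>\<^bsub>M\<^esub>} R"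
  using assms by (intro idealI_cring) (auto simp: smult_l_distr smult_assoc1)

lemma torsion_on_submodule:
  assumes S: "S \<subseteq> carrier R" shows "submodule (torsion_on R S M) R M"
proof (rule submoduleI)
  fix y z assume y: "y \<in> torsion_on R S M" and z: "z \<in> torsion_on R S M"
  have "\<exists>n::nat. x [^] n \<odot>\<^bsub>M\<^esub> (y \<oplus>\<^bsub>M\<^esub> z) = \<zero>\<^bsub>M\<^esub>" if x: "x \<in> S" for x
  proof -
    obtain m n :: nat where mn: "x [^] m \<odot>\<^bsub>M\<^esub> y = \<zero>\<^bsub>M\<^esub>" "x [^] n \<odot>\<^bsub>M\<^esub> z = \<zero>\<^bsub>M\<^esub>"
      using torsion_onD(2)[OF y x] torsion_onD(2)[OF z x] by blast
    have xR: "x \<in> carrier R" and c: "y \<in> carrier M" "z \<in> carrier M"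
      using S x y z by (auto simp: torsion_on_def)
    have "x [^] (n + m) \<odot>\<^bsub>M\<^esub> y = \<zero>\<^bsub>M\<^esub>" using mn xR c by (simp add: smult_pow_add)
    moreover have "x [^] (n + m) \<odot>\<^bsub>M\<^esub> z = \<zero>\<^bsub>M\<^esub>"
      using mn xR c by (subst add.commute) (simp add: smult_pow_add)
    ultimately have "x [^] (n + m) \<odot>\<^bsub>M\<^esub> (y \<oplus>\<^bsub>M\<^esub> z) = \<zero>\<^bsub>M\<^esub>"
      using xR c by (simp add: smult_r_distr)
    then show ?thesis by blast
  qed
  then show "y \<oplus>\<^bsub>M\<^esub> z \<in> torsion_on R S M" using y z by (auto simp: torsion_on_def)
next
  fix y assume "y \<in> torsion_on R S M"
  then show "\<ominus>\<^bsub>M\<^esub> y \<in> torsion_on R S M"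
    using S by (fastforce simp: torsion_on_def smult_r_minus)
next
  fix a y assume a: "a \<in> carrier R" and y: "y \<in> torsion_on R S M"
  have "x [^] (n::nat) \<odot>\<^bsub>M\<^esub> (a \<odot>\<^bsub>M\<^esub> y) = a \<odot>\<^bsub>M\<^esub> (x [^] n \<odot>\<^bsub>M\<^esub> y)" if "x \<in> S" for x n
    using that S a y by (intro smult_lcomm) (auto simp: torsion_on_def)
  then have "\<exists>n::nat. x [^] n \<odot>\<^bsub>M\<^esub> (a \<odot>\<^bsub>M\<^esub> y) = \<zero>\<^bsub>M\<^esub>" if "x \<in> S" for x
    using torsion_onD(2)[OF y that] that a smult_r_null by metis
  then show "a \<odot>\<^bsub>M\<^esub> y \<in> torsion_on R S M" using a y by (simp add: torsion_on_def)
qed (use S in \<open>auto simp: torsion_on_def\<close>)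

lemma torsion_cancel:
  assumes "y \<in> torsion_on R S M" "x \<in> carrier R"
    and "x [^] (n::nat) \<odot>\<^bsub>M\<^esub> y \<in> torsion_on R (insert x S) M"
  shows "y \<in> torsion_on R (insert x S) M"
proof -
  obtain k :: nat where "x [^] k \<odot>\<^bsub>M\<^esub> (x [^] n \<odot>\<^bsub>M\<^esub> y) = \<zero>\<^bsub>M\<^esub>"
    using assms(3) by (auto simp: torsion_on_def)
  then have "x [^] (k + n) \<odot>\<^bsub>M\<^esub> y = \<zero>\<^bsub>M\<^esub>"
    using assms(1,2) by (simp add: smult_pow_add torsion_on_def)
  then show ?thesis using assms(1) by (auto simp: torsion_on_def)
qed

end

lemma torsion_part_eq_torsion_on:
  assumes M: "module R M" and S: "S \<subseteq> carrier R" "finite S"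
  shows "torsion_part R (Idl\<^bsub>R\<^esub> S) M = torsion_on R S M"
proof (intro equalityI subsetI)
  interpret module R M by fact
  fix y assume "y \<in> torsion_part R (Idl\<^bsub>R\<^esub> S) M"
  moreover have "x [^]\<^bsub>R\<^esub> n \<in> ideal_power R (Idl\<^bsub>R\<^esub> S) n" if "x \<in> S" for x n
    using that genideal_self[OF S(1)] ideal_memD(1)[OF genideal_ideal[OF S(1)]]
    by (intro pow_mem_ideal_power) auto
  ultimately show "y \<in> torsion_on R S M" by (fastforce simp: torsion_part_def torsion_on_def)
next
  interpret module R M by fact
  fix y assume y: "y \<in> torsion_on R S M"
  then obtain f where f: "\<And>x. x \<in> S \<Longrightarrow> x [^]\<^bsub>R\<^esub> (f x :: nat) \<odot>\<^bsub>M\<^esub> y = \<zero>\<^bsub>M\<^esub>"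
    unfolding torsion_on_def by (auto simp: Bex_def) metis
  have yM: "y \<in> carrier M" using y by (simp add: torsion_on_def)
  have "ideal_power R (Idl\<^bsub>R\<^esub> S) (Suc (sum f S)) \<subseteq> {a \<in> carrier R. a \<odot>\<^bsub>M\<^esub> y = \<zero>\<^bsub>M\<^esub>}"
    using f S by (intro ideal_power_subset annihilator_ideal yM) auto
  then show "y \<in> torsion_part R (Idl\<^bsub>R\<^esub> S) M" using yM unfolding torsion_part_def by blast
qed

lemma torsion_on_mono: "y \<in> torsion_on R (insert x S) M \<Longrightarrow> y \<in> torsion_on R S M"
  by (simp add: torsion_on_def)

lemma mod_hom_minus:
  assumes "module R M" "module R N" "f \<in> mod_hom R M N" "x \<in> carrier M" "y \<in> carrier M"
  shows "f (x \<ominus>\<^bsub>M\<^esub> y) = f x \<ominus>\<^bsub>N\<^esub> f y"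
proof -
  interpret M: module R M by fact
  interpret N: module R N by fact
  note D = mod_homD[OF assms(3)]
  have "f (\<ominus>\<^bsub>M\<^esub> y) = f (\<ominus>\<^bsub>R\<^esub> \<one>\<^bsub>R\<^esub> \<odot>\<^bsub>M\<^esub> y)" using assms(5) by (simp add: M.smult_l_minus)
  also have "\<dots> = \<ominus>\<^bsub>N\<^esub> f y" using D(1)[of y] D(3)[of "\<ominus>\<^bsub>R\<^esub> \<one>\<^bsub>R\<^esub>" y] assms(5)
    by (simp add: N.smult_l_minus)
  finally show ?thesis using assms D by (simp add: a_minus_def)
qed

lemma torsion_on_hom:
  assumes "module R M" "module R N" "f \<in> mod_hom R M N" "S \<subseteq> carrier R" "y \<in> torsion_on R S M"
  shows "f y \<in> torsion_on R S N"
proof -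
  interpret M: module R M by fact
  note D = mod_homD[OF assms(3)]
  have y: "y \<in> carrier M" using assms(5) by (simp add: torsion_on_def)
  have "\<exists>n::nat. x [^]\<^bsub>R\<^esub> n \<odot>\<^bsub>N\<^esub> f y = \<zero>\<^bsub>N\<^esub>" if xS: "x \<in> S" for x
  proof -
    obtain n :: nat where "x [^]\<^bsub>R\<^esub> n \<odot>\<^bsub>M\<^esub> y = \<zero>\<^bsub>M\<^esub>"
      using torsion_onD(2)[OF assms(5) xS] by blast
    then have "x [^]\<^bsub>R\<^esub> n \<odot>\<^bsub>N\<^esub> f y = \<zero>\<^bsub>N\<^esub>"
      using D(3)[of "x [^]\<^bsub>R\<^esub> n" y] xS assms y mod_hom_zero[OF assms(1-3)] by (auto simp: subset_iff)
    then show ?thesis by blast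
  qed
  then show ?thesis using D(1) y by (auto simp: torsion_on_def)
qed

section \<open>Divisibility in injective modules\<close>

text \<open>For \<open>n = 1\<close> this says that \<open>E\<close> modulo its \<open>x\<close>-torsion is \<open>x\<close>-divisible, that is, \<open>E\<close> surjects onto its
  localisation at \<open>x\<close>. Let \<open>A\<close> be the annihilator of \<open>y\<close>. The map \<open>x\<^bsup>N+n\<^esup> r + a \<mapsto> x\<^sup>N r y\<close> on the ideal
  \<open>x\<^bsup>N+n\<^esup> R + A\<close> is well defined once the chain \<open>A : x\<^sup>N\<close> is stationary, and an element
  representing its extension to \<open>R\<close> is the required \<open>w\<close>. Including \<open>A\<close> in the domain makes \<open>w\<close>
  inherit every torsion property of \<open>y\<close>, so that torsion submodules of \<open>E\<close> are divisible in the same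
  sense without being known to be injective.\<close>

lemma injective_divide:
  assumes noeth: "noetherian_ring R" and E: "injective_module R E"
    and y: "y \<in> carrier E" and x: "x \<in> carrier R"
  obtains w and N :: nat where "w \<in> carrier E"
    and "x [^]\<^bsub>R\<^esub> (N + n) \<odot>\<^bsub>E\<^esub> w = x [^]\<^bsub>R\<^esub> N \<odot>\<^bsub>E\<^esub> y"
    and "\<And>a. a \<in> carrier R \<Longrightarrow> a \<odot>\<^bsub>E\<^esub> y = \<zero>\<^bsub>E\<^esub> \<Longrightarrow> a \<odot>\<^bsub>E\<^esub> w = \<zero>\<^bsub>E\<^esub>"
proof -
  have "module R E" using E by (simp add: injective_module_def)
  interpret E: module R E by fact
  have cr: "cring R" by (rule E.R.is_cring)
  interpret noetherian_ring R by fact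
  define A where "A = {a \<in> carrier R. a \<odot>\<^bsub>E\<^esub> y = \<zero>\<^bsub>E\<^esub>}"
  have A: "ideal A R" unfolding A_def by (rule E.annihilator_ideal[OF y])
  note A' = E.R.ideal_memD[OF A]
  define C where "C k = {r \<in> carrier R. x [^]\<^bsub>R\<^esub> k \<otimes>\<^bsub>R\<^esub> r \<in> A}" for k :: nat
  have "ideal (C k) R" for k unfolding C_def using x by (intro E.R.colon_ideal A) auto
  moreover have "C k \<subseteq> C (Suc k)" for k
  proof
    fix r assume r: "r \<in> C k"
    then have "x \<otimes>\<^bsub>R\<^esub> (x [^]\<^bsub>R\<^esub> k \<otimes>\<^bsub>R\<^esub> r) \<in> A" using x A'(5) by (simp add: C_def)
    moreover have "x \<otimes>\<^bsub>R\<^esub> (x [^]\<^bsub>R\<^esub> k \<otimes>\<^bsub>R\<^esub> r) = x [^]\<^bsub>R\<^esub> Suc k \<otimes>\<^bsub>R\<^esub> r"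
      using r x by (simp add: C_def E.R.m_ac)
    ultimately show "r \<in> C (Suc k)" using r by (simp add: C_def)
  qed
  ultimately obtain N where N: "\<And>n. C (N + n) = C N" using ascending_ideals_stabilise[of C] by blast
  define p where "p = x [^]\<^bsub>R\<^esub> (N + n)"
  define q where "q = x [^]\<^bsub>R\<^esub> N"
  have pq: "p \<in> carrier R" "q \<in> carrier R" using x by (auto simp: p_def q_def)
  have key: "(q \<otimes>\<^bsub>R\<^esub> r) \<odot>\<^bsub>E\<^esub> y = \<zero>\<^bsub>E\<^esub>" if "r \<in> carrier R" "p \<otimes>\<^bsub>R\<^esub> r \<in> A" for r
  proof -
    have "r \<in> C (N + n)" using that by (simp add: C_def p_def)
    then have "r \<in> C N" using N by simp
    then show ?thesis by (simp add: C_def q_def A_def)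
  qed
  \<comment> \<open>\<open>P s r\<close>: \<open>s = p r\<close> modulo \<open>A\<close>; then \<open>s\<close> is sent to \<open>q r y\<close>.\<close>
  define P where "P s r \<longleftrightarrow> r \<in> carrier R \<and> s \<ominus>\<^bsub>R\<^esub> p \<otimes>\<^bsub>R\<^esub> r \<in> A" for s r
  define \<phi> where "\<phi> s = (q \<otimes>\<^bsub>R\<^esub> (SOME r. P s r)) \<odot>\<^bsub>E\<^esub> y" for s
  have phi: "\<phi> s = (q \<otimes>\<^bsub>R\<^esub> r) \<odot>\<^bsub>E\<^esub> y" if s: "s \<in> carrier R" and r: "P s r" for s r
  proof -
    define r' where "r' = (SOME r. P s r)"
    have r': "P s r'" unfolding r'_def using r by (rule someI)
    have R: "r \<in> carrier R" "r' \<in> carrier R" using r r' by (auto simp: P_def)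
    have "(s \<ominus>\<^bsub>R\<^esub> p \<otimes>\<^bsub>R\<^esub> r) \<ominus>\<^bsub>R\<^esub> (s \<ominus>\<^bsub>R\<^esub> p \<otimes>\<^bsub>R\<^esub> r') \<in> A" using r r' A'(4) by (auto simp: P_def)
    moreover have "(s \<ominus>\<^bsub>R\<^esub> p \<otimes>\<^bsub>R\<^esub> r) \<ominus>\<^bsub>R\<^esub> (s \<ominus>\<^bsub>R\<^esub> p \<otimes>\<^bsub>R\<^esub> r') = p \<otimes>\<^bsub>R\<^esub> (r' \<ominus>\<^bsub>R\<^esub> r)"
      using s R pq
      by (simp add: a_minus_def E.R.minus_add E.R.r_distr E.R.r_minus E.R.a_ac E.R.r_neg1 E.R.r_neg2)
    ultimately have "(q \<otimes>\<^bsub>R\<^esub> (r' \<ominus>\<^bsub>R\<^esub> r)) \<odot>\<^bsub>E\<^esub> y = \<zero>\<^bsub>E\<^esub>" using key R by simp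
    moreover have "q \<otimes>\<^bsub>R\<^esub> (r' \<ominus>\<^bsub>R\<^esub> r) = q \<otimes>\<^bsub>R\<^esub> r' \<ominus>\<^bsub>R\<^esub> q \<otimes>\<^bsub>R\<^esub> r"
      using R pq by (simp add: a_minus_def E.R.r_distr E.R.r_minus)
    ultimately have "(q \<otimes>\<^bsub>R\<^esub> r') \<odot>\<^bsub>E\<^esub> y \<ominus>\<^bsub>E\<^esub> (q \<otimes>\<^bsub>R\<^esub> r) \<odot>\<^bsub>E\<^esub> y = \<zero>\<^bsub>E\<^esub>"
      using R pq y by (simp add: E.smult_left_minus)
    then show ?thesis unfolding \<phi>_def r'_def[symmetric] using R pq y by (simp add: E.M.diff_zero_iff)
  qed
  define K where "K = adjoin R A [p]"
  have K: "ideal K R" unfolding K_def using pq by (intro E.R.adjoin_ideal A) auto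
  have KP: "s \<in> carrier R \<and> (\<exists>r. P s r)" if "s \<in> K" for s
  proof -
    obtain a r where ar: "a \<in> A" "r \<in> carrier R" "s = a \<oplus>\<^bsub>R\<^esub> p \<otimes>\<^bsub>R\<^esub> r" using \<open>s \<in> K\<close> by (auto simp: K_def)
    have "s \<ominus>\<^bsub>R\<^esub> p \<otimes>\<^bsub>R\<^esub> r = a" using ar A'(1) pq by (simp add: a_minus_def E.R.a_assoc E.R.r_neg)
    then show ?thesis using ar A'(1) pq by (auto simp: P_def)
  qed
  obtain w where w: "w \<in> carrier E" "\<And>s. s \<in> K \<Longrightarrow> \<phi> s = s \<odot>\<^bsub>E\<^esub> w"
  proof (rule injective_module_extend_ideal[OF E K cr, of \<phi>])
    fix s t assume s: "s \<in> K" and t: "t \<in> K"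
    obtain r r' where r: "P s r" "P t r'" using KP s t by blast
    have R: "s \<in> carrier R" "t \<in> carrier R" "r \<in> carrier R" "r' \<in> carrier R"
      using KP s t r by (auto simp: P_def)
    have "(s \<ominus>\<^bsub>R\<^esub> p \<otimes>\<^bsub>R\<^esub> r) \<oplus>\<^bsub>R\<^esub> (t \<ominus>\<^bsub>R\<^esub> p \<otimes>\<^bsub>R\<^esub> r') \<in> A" using r A'(3) by (auto simp: P_def)
    moreover have "(s \<ominus>\<^bsub>R\<^esub> p \<otimes>\<^bsub>R\<^esub> r) \<oplus>\<^bsub>R\<^esub> (t \<ominus>\<^bsub>R\<^esub> p \<otimes>\<^bsub>R\<^esub> r') = (s \<oplus>\<^bsub>R\<^esub> t) \<ominus>\<^bsub>R\<^esub> p \<otimes>\<^bsub>R\<^esub> (r \<oplus>\<^bsub>R\<^esub> r')"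
      using R pq by (simp add: a_minus_def E.R.minus_add E.R.r_distr E.R.a_ac)
    ultimately have "P (s \<oplus>\<^bsub>R\<^esub> t) (r \<oplus>\<^bsub>R\<^esub> r')" using R by (simp add: P_def)
    then show "\<phi> (s \<oplus>\<^bsub>R\<^esub> t) = \<phi> s \<oplus>\<^bsub>E\<^esub> \<phi> t"
      using phi[OF R(1) r(1)] phi[OF R(2) r(2)] phi[of "s \<oplus>\<^bsub>R\<^esub> t" "r \<oplus>\<^bsub>R\<^esub> r'"] R pq y
      by (simp add: E.R.r_distr E.smult_l_distr)
  next
    fix c s assume c: "c \<in> carrier R" and s: "s \<in> K"
    obtain r where r: "P s r" using KP s by blast
    have R: "s \<in> carrier R" "r \<in> carrier R" using KP s r by (auto simp: P_def)
    have "c \<otimes>\<^bsub>R\<^esub> (s \<ominus>\<^bsub>R\<^esub> p \<otimes>\<^bsub>R\<^esub> r) \<in> A" using r A'(5) c by (auto simp: P_def)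
    moreover have "c \<otimes>\<^bsub>R\<^esub> (s \<ominus>\<^bsub>R\<^esub> p \<otimes>\<^bsub>R\<^esub> r) = c \<otimes>\<^bsub>R\<^esub> s \<ominus>\<^bsub>R\<^esub> p \<otimes>\<^bsub>R\<^esub> (c \<otimes>\<^bsub>R\<^esub> r)"
      using R pq c by (simp add: a_minus_def E.R.r_distr E.R.r_minus E.R.m_lcomm)
    ultimately have "P (c \<otimes>\<^bsub>R\<^esub> s) (c \<otimes>\<^bsub>R\<^esub> r)" using R c by (simp add: P_def)
    then show "\<phi> (c \<otimes>\<^bsub>R\<^esub> s) = c \<odot>\<^bsub>E\<^esub> \<phi> s"
      using phi[OF R(1) r] phi[of "c \<otimes>\<^bsub>R\<^esub> s" "c \<otimes>\<^bsub>R\<^esub> r"] R pq y c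
      by (simp add: E.R.m_lcomm[of q c r] E.smult_assoc1[of c "q \<otimes>\<^bsub>R\<^esub> r" y])
  next
    fix s assume s: "s \<in> K"
    then obtain r where "P s r" "s \<in> carrier R" using KP by blast
    then show "\<phi> s \<in> carrier E" using phi[of s r] pq y by (simp add: P_def)
  qed blast
  have "p \<in> K" unfolding K_def using pq by (intro E.R.adjoin_member A) auto
  moreover have "P p \<one>\<^bsub>R\<^esub>" using pq A'(2) by (simp add: P_def a_minus_def E.R.r_neg)
  ultimately have "p \<odot>\<^bsub>E\<^esub> w = q \<odot>\<^bsub>E\<^esub> y" using w(2) phi[OF pq(1)] pq by fastforce
  moreover have "a \<odot>\<^bsub>E\<^esub> w = \<zero>\<^bsub>E\<^esub>" if "a \<in> carrier R" "a \<odot>\<^bsub>E\<^esub> y = \<zero>\<^bsub>E\<^esub>" for a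
  proof -
    have a: "a \<in> A" using that by (simp add: A_def)
    then have "a \<in> K" unfolding K_def using pq by (intro E.R.adjoin_base A) auto
    moreover have "P a \<zero>\<^bsub>R\<^esub>" using a A'(1) pq by (simp add: P_def a_minus_def)
    ultimately show ?thesis using w(2)[of a] phi[OF that(1), of "\<zero>\<^bsub>R\<^esub>"] pq y by simp
  qed
  ultimately show ?thesis using that[OF w(1)] unfolding p_def q_def by blast
qed

lemma torsion_divide:
  assumes noeth: "noetherian_ring R" and E: "injective_module R E"
    and y: "y \<in> torsion_on R S E" and x: "x \<in> carrier R" and S: "S \<subseteq> carrier R"
  obtains w g where "w \<in> torsion_on R S E" "g \<in> torsion_on R (insert x S) E"
    and "y = x [^]\<^bsub>R\<^esub> (n::nat) \<odot>\<^bsub>E\<^esub> w \<oplus>\<^bsub>E\<^esub> g"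
proof -
  have "module R E" using E by (simp add: injective_module_def)
  interpret E: module R E by fact
  have yE: "y \<in> carrier E" using y by (simp add: torsion_on_def)
  obtain w and N :: nat where w: "w \<in> carrier E"
    and eq: "x [^]\<^bsub>R\<^esub> (N + n) \<odot>\<^bsub>E\<^esub> w = x [^]\<^bsub>R\<^esub> N \<odot>\<^bsub>E\<^esub> y"
    and ann: "\<And>a. a \<in> carrier R \<Longrightarrow> a \<odot>\<^bsub>E\<^esub> y = \<zero>\<^bsub>E\<^esub> \<Longrightarrow> a \<odot>\<^bsub>E\<^esub> w = \<zero>\<^bsub>E\<^esub>"
    using injective_divide[OF noeth E yE x] by metis
  have wS: "w \<in> torsion_on R S E"
    unfolding torsion_on_def
  proof (intro CollectI conjI ballI w)
    fix z assume z: "z \<in> S"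
    then obtain k :: nat where "z [^]\<^bsub>R\<^esub> k \<odot>\<^bsub>E\<^esub> y = \<zero>\<^bsub>E\<^esub>" using torsion_onD(2)[OF y] by blast
    then show "\<exists>k::nat. z [^]\<^bsub>R\<^esub> k \<odot>\<^bsub>E\<^esub> w = \<zero>\<^bsub>E\<^esub>" using ann[of "z [^]\<^bsub>R\<^esub> k"] z S by auto
  qed
  define g where "g = y \<ominus>\<^bsub>E\<^esub> x [^]\<^bsub>R\<^esub> n \<odot>\<^bsub>E\<^esub> w"
  have "x [^]\<^bsub>R\<^esub> N \<odot>\<^bsub>E\<^esub> g = \<zero>\<^bsub>E\<^esub>"
    unfolding g_def using w x yE eq by (simp add: E.smult_minus E.M.diff_self flip: E.smult_pow_add)
  moreover have "g \<in> torsion_on R S E"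
    unfolding g_def using wS y x by (intro E.submodule_memD(5,6)[OF E.torsion_on_submodule[OF S]]) auto
  ultimately have "g \<in> torsion_on R (insert x S) E" by (auto simp: torsion_on_def)
  moreover have "y = x [^]\<^bsub>R\<^esub> n \<odot>\<^bsub>E\<^esub> w \<oplus>\<^bsub>E\<^esub> g"
    unfolding g_def using w x yE by (simp add: a_minus_def E.M.a_ac E.M.r_neg)
  ultimately show ?thesis using that wS by blast
qed

section \<open>Cohomology of the torsion subcomplexes\<close>

text \<open>The submodule \<open>(y\<^sub>1, \<dots>, y\<^sub>k) M\<close>, again with one generator split off at a time.\<close>

primrec lspan :: "('a, 'm) ring_scheme \<Rightarrow> ('a, 'b) module \<Rightarrow> 'a list \<Rightarrow> 'b set" where
  "lspan R M [] = {\<zero>\<^bsub>M\<^esub>}"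
| "lspan R M (y # ys) = {u \<oplus>\<^bsub>M\<^esub> y \<odot>\<^bsub>M\<^esub> m |u m. u \<in> lspan R M ys \<and> m \<in> carrier M}"

lemma lspan_ring_module: "lspan R (ring_module R) ys = adjoin R {\<zero>\<^bsub>R\<^esub>} ys"
  by (induction ys) (auto simp: ring_module_def)

lemma lspan_submodule:
  assumes "module R M" "set ys \<subseteq> carrier R"
  shows "submodule (lspan R M ys) R M"
  using assms(2)
proof (induction ys)
  case Nil
  interpret module R M by fact
  show ?case by (intro submoduleI) auto
next
  case (Cons y ys)
  interpret module R M by fact
  have "submodule (lspan R M ys) R M" using Cons by simp
  note S = submodule_memD[OF this]
  have yR: "y \<in> carrier R" using Cons.prems by simp
  have I: "u \<oplus>\<^bsub>M\<^esub> y \<odot>\<^bsub>M\<^esub> m \<in> lspan R M (y # ys)" if "u \<in> lspan R M ys" "m \<in> carrier M" for u m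
    using that by auto
  show ?case
  proof (rule submoduleI)
    show "lspan R M (y # ys) \<subseteq> carrier M" using S yR by auto
    show "\<zero>\<^bsub>M\<^esub> \<in> lspan R M (y # ys)" using I[OF S(2) zero_closed] yR by simp
  next
    fix a assume "a \<in> lspan R M (y # ys)"
    then obtain u m where um: "u \<in> lspan R M ys" "m \<in> carrier M" "a = u \<oplus>\<^bsub>M\<^esub> y \<odot>\<^bsub>M\<^esub> m" by auto
    have "\<ominus>\<^bsub>M\<^esub> a = \<ominus>\<^bsub>M\<^esub> u \<oplus>\<^bsub>M\<^esub> y \<odot>\<^bsub>M\<^esub> (\<ominus>\<^bsub>M\<^esub> m)"
      using um yR S(1)[OF um(1)] by (simp add: M.minus_add smult_r_minus M.a_comm)
    then show "\<ominus>\<^bsub>M\<^esub> a \<in> lspan R M (y # ys)" using I[OF S(4)[OF um(1)], of "\<ominus>\<^bsub>M\<^esub> m"] um by simp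
  next
    fix a b assume "a \<in> lspan R M (y # ys)" "b \<in> lspan R M (y # ys)"
    then obtain u m v n where um: "u \<in> lspan R M ys" "m \<in> carrier M" "a = u \<oplus>\<^bsub>M\<^esub> y \<odot>\<^bsub>M\<^esub> m"
      and vn: "v \<in> lspan R M ys" "n \<in> carrier M" "b = v \<oplus>\<^bsub>M\<^esub> y \<odot>\<^bsub>M\<^esub> n" by auto
    have "a \<oplus>\<^bsub>M\<^esub> b = (u \<oplus>\<^bsub>M\<^esub> v) \<oplus>\<^bsub>M\<^esub> y \<odot>\<^bsub>M\<^esub> (m \<oplus>\<^bsub>M\<^esub> n)"
      using um vn yR S(1)[OF um(1)] S(1)[OF vn(1)] by (simp add: smult_r_distr M.a_ac)
    then show "a \<oplus>\<^bsub>M\<^esub> b \<in> lspan R M (y # ys)"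
      using I[OF S(3)[OF um(1) vn(1)], of "m \<oplus>\<^bsub>M\<^esub> n"] um vn by simp
  next
    fix r a assume r: "r \<in> carrier R" and "a \<in> lspan R M (y # ys)"
    then obtain u m where um: "u \<in> lspan R M ys" "m \<in> carrier M" "a = u \<oplus>\<^bsub>M\<^esub> y \<odot>\<^bsub>M\<^esub> m" by auto
    have "r \<odot>\<^bsub>M\<^esub> a = r \<odot>\<^bsub>M\<^esub> u \<oplus>\<^bsub>M\<^esub> y \<odot>\<^bsub>M\<^esub> (r \<odot>\<^bsub>M\<^esub> m)"
      using um yR r S(1)[OF um(1)] by (simp add: smult_r_distr smult_lcomm)
    then show "r \<odot>\<^bsub>M\<^esub> a \<in> lspan R M (y # ys)"
      using I[OF S(6)[OF um(1) r], of "r \<odot>\<^bsub>M\<^esub> m"] um r by simp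
  qed
qed

lemma list_prod_power_smult_lspan:
  assumes "module R M" "set xs \<subseteq> carrier R" "m \<in> lspan R M (powers R n xs)"
  shows "list_prod R xs [^]\<^bsub>R\<^esub> c \<odot>\<^bsub>M\<^esub> m \<in> lspan R M (powers R (n + c) xs)"
  using assms(2,3)
proof (induction xs arbitrary: m)
  case Nil
  interpret module R M by fact
  show ?case using Nil by simp
next
  case (Cons x xs)
  interpret module R M by fact
  obtain u t where ut: "u \<in> lspan R M (powers R n xs)" "t \<in> carrier M" "m = u \<oplus>\<^bsub>M\<^esub> x [^]\<^bsub>R\<^esub> n \<odot>\<^bsub>M\<^esub> t"
    using Cons.prems(2) by auto
  have xR: "x \<in> carrier R" and R: "set xs \<subseteq> carrier R" using Cons.prems by auto
  have sub: "submodule (lspan R M (powers R k xs)) R M" for k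
    using R by (intro lspan_submodule assms(1)) auto
  have uM: "u \<in> carrier M" using submodule_memD(1)[OF sub ut(1)] .
  let ?p = "list_prod R xs [^]\<^bsub>R\<^esub> c"
  have pR: "?p \<in> carrier R" using R by simp
  have "list_prod R (x # xs) [^]\<^bsub>R\<^esub> c = x [^]\<^bsub>R\<^esub> c \<otimes>\<^bsub>R\<^esub> ?p" using xR R by (simp add: nat_pow_distrib)
  then have "list_prod R (x # xs) [^]\<^bsub>R\<^esub> c \<odot>\<^bsub>M\<^esub> m =
      x [^]\<^bsub>R\<^esub> c \<odot>\<^bsub>M\<^esub> (?p \<odot>\<^bsub>M\<^esub> u) \<oplus>\<^bsub>M\<^esub> x [^]\<^bsub>R\<^esub> c \<odot>\<^bsub>M\<^esub> (?p \<odot>\<^bsub>M\<^esub> (x [^]\<^bsub>R\<^esub> n \<odot>\<^bsub>M\<^esub> t))"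
    using ut uM xR pR by (simp add: smult_assoc1 smult_r_distr)
  also have "?p \<odot>\<^bsub>M\<^esub> (x [^]\<^bsub>R\<^esub> n \<odot>\<^bsub>M\<^esub> t) = x [^]\<^bsub>R\<^esub> n \<odot>\<^bsub>M\<^esub> (?p \<odot>\<^bsub>M\<^esub> t)"
    using ut xR pR by (simp add: smult_lcomm)
  also have "x [^]\<^bsub>R\<^esub> c \<odot>\<^bsub>M\<^esub> (x [^]\<^bsub>R\<^esub> n \<odot>\<^bsub>M\<^esub> (?p \<odot>\<^bsub>M\<^esub> t)) = x [^]\<^bsub>R\<^esub> (n + c) \<odot>\<^bsub>M\<^esub> (?p \<odot>\<^bsub>M\<^esub> t)"
    using ut xR pR by (subst add.commute) (simp add: smult_pow_add)
  finally have "list_prod R (x # xs) [^]\<^bsub>R\<^esub> c \<odot>\<^bsub>M\<^esub> m =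
      x [^]\<^bsub>R\<^esub> c \<odot>\<^bsub>M\<^esub> (?p \<odot>\<^bsub>M\<^esub> u) \<oplus>\<^bsub>M\<^esub> x [^]\<^bsub>R\<^esub> (n + c) \<odot>\<^bsub>M\<^esub> (?p \<odot>\<^bsub>M\<^esub> t)" .
  moreover have "x [^]\<^bsub>R\<^esub> c \<odot>\<^bsub>M\<^esub> (?p \<odot>\<^bsub>M\<^esub> u) \<in> lspan R M (powers R (n + c) xs)"
    using submodule_memD(6)[OF sub Cons.IH[OF R ut(1)]] xR by simp
  moreover have "?p \<odot>\<^bsub>M\<^esub> t \<in> carrier M" using ut pR by simp
  ultimately show ?case by auto
qed

lemma (in abelian_group) diff_zero: "x \<in> carrier G \<Longrightarrow> x \<ominus> \<zero> = x"
  using minus_equality[of \<zero> \<zero>] by (simp add: a_minus_def)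

lemma (in abelian_group) diff_exchange:
  assumes "(y \<oplus> g) \<ominus> z = b \<oplus> t"
    and G: "y \<in> carrier G" "g \<in> carrier G" "z \<in> carrier G" "b \<in> carrier G" "t \<in> carrier G"
  shows "t \<ominus> g = (y \<ominus> z) \<ominus> b"
proof -
  have "t = \<ominus> b \<oplus> ((y \<oplus> g) \<ominus> z)" unfolding assms(1) using G by (simp add: r_neg1)
  then have "t \<ominus> g = (\<ominus> b \<oplus> (y \<ominus> z)) \<oplus> (g \<oplus> \<ominus> g)" using G by (simp add: a_minus_def a_ac)
  also have "g \<oplus> \<ominus> g = \<zero>" using G by (simp add: r_neg)
  finally show ?thesis using G by (simp add: a_minus_def a_ac)
qed

text \<open>An injective resolution with its augmentation made explicit.\<close>

locale injective_res = module R M for R (structure) and M :: "('a, 'b) module" (structure) +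
  fixes J :: "nat \<Rightarrow> ('a, 'j) module" and d :: "nat \<Rightarrow> 'j \<Rightarrow> 'j" and e :: "'b \<Rightarrow> 'j"
  assumes noeth: "noetherian_ring R"
    and injJ: "injective_module R (J p)"
    and dhom: "d p \<in> mod_hom R (J p) (J (Suc p))"
    and ehom: "e \<in> mod_hom R M (J 0)"
    and einj: "inj_on e (carrier M)"
    and eimage: "e ` carrier M = {x \<in> carrier (J 0). d 0 x = \<zero>\<^bsub>J (Suc 0)\<^esub>}"
    and exact: "d p ` carrier (J p) = {x \<in> carrier (J (Suc p)). d (Suc p) x = \<zero>\<^bsub>J (Suc (Suc p))\<^esub>}"
begin

sublocale J: module R "J p" for p
  using injJ by (simp add: injective_module_def)

abbreviation T :: "'a set \<Rightarrow> nat \<Rightarrow> 'j set" where "T S p \<equiv> torsion_on R S (J p)"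

lemmas d_closed = mod_homD(1)[OF dhom]
lemmas d_add = mod_homD(2)[OF dhom]
lemmas d_smult = mod_homD(3)[OF dhom]

lemma d_zero: "d p \<zero>\<^bsub>J p\<^esub> = \<zero>\<^bsub>J (Suc p)\<^esub>"
  by (rule mod_hom_zero[OF J.module_axioms J.module_axioms dhom])

lemma d_minus: "x \<in> carrier (J p) \<Longrightarrow> y \<in> carrier (J p) \<Longrightarrow> d p (x \<ominus>\<^bsub>J p\<^esub> y) = d p x \<ominus>\<^bsub>J (Suc p)\<^esub> d p y"
  by (rule mod_hom_minus[OF J.module_axioms J.module_axioms dhom])

lemma d_d: "x \<in> carrier (J p) \<Longrightarrow> d (Suc p) (d p x) = \<zero>\<^bsub>J (Suc (Suc p))\<^esub>"
  using exact[of p] by blast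

lemma d_torsion: "S \<subseteq> carrier R \<Longrightarrow> y \<in> T S p \<Longrightarrow> d p y \<in> T S (Suc p)"
  by (rule torsion_on_hom[OF J.module_axioms J.module_axioms dhom])

lemma T_closed: "y \<in> T S p \<Longrightarrow> y \<in> carrier (J p)"
  by (rule torsion_onD(1))

lemmas T_sub = J.submodule_memD[OF J.torsion_on_submodule]

lemma T_divide:
  assumes "y \<in> T S p" "x \<in> carrier R" "S \<subseteq> carrier R"
  obtains w g where "w \<in> T S p" "g \<in> T (insert x S) p" "y = x [^] (n::nat) \<odot>\<^bsub>J p\<^esub> w \<oplus>\<^bsub>J p\<^esub> g"
  using torsion_divide[OF noeth injJ assms] by blast

text \<open>Adding one element to \<open>S\<close> raises the degree up to which the complex of \<open>S\<close>-torsion elements may have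
  cohomology by at most one. Lift the cocycle \<open>z\<close> to \<open>y\<close> in the larger complex; a multiple
  \<open>x\<^sup>m y\<close> is a cocycle there, hence a coboundary, and dividing a preimage by \<open>x\<^sup>m\<close> up to torsion
  corrects \<open>y\<close> to a torsion element.\<close>

lemma torsion_complex_exact:
  assumes "set xs \<subseteq> carrier R" "length xs \<le> p"
    and "z \<in> T (set xs) (Suc p)" "d (Suc p) z = \<zero>\<^bsub>J (Suc (Suc p))\<^esub>"
  shows "\<exists>y\<in>T (set xs) p. d p y = z"
  using assms
proof (induction xs arbitrary: p z)
  case Nil
  then have "z \<in> d p ` carrier (J p)" using exact[of p] by (auto simp: torsion_on_def)
  then show ?case by (auto simp: torsion_on_def)
next
  case (Cons x xs)
  have xR: "x \<in> carrier R" and S: "set xs \<subseteq> carrier R" "set (x # xs) \<subseteq> carrier R" using Cons.prems by auto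
  obtain q where p: "p = Suc q" and q: "length xs \<le> q" using Cons.prems(2) by (cases p) auto
  have "z \<in> T (set xs) (Suc p)" using Cons.prems(3) torsion_on_mono by simp
  then obtain y where y: "y \<in> T (set xs) p" "d p y = z"
    using Cons.IH[OF S(1), of p z] Cons.prems(2,4) by auto
  obtain m :: nat where m: "x [^] m \<odot>\<^bsub>J (Suc p)\<^esub> z = \<zero>\<^bsub>J (Suc p)\<^esub>"
    using torsion_onD(2)[OF Cons.prems(3), of x] by auto
  have xm: "x [^] m \<in> carrier R" using xR by simp
  have "x [^] m \<odot>\<^bsub>J p\<^esub> y \<in> T (set xs) p" using y(1) xm by (intro T_sub(6)[OF S(1)])
  moreover have "d p (x [^] m \<odot>\<^bsub>J p\<^esub> y) = \<zero>\<^bsub>J (Suc p)\<^esub>"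
    using y m xm T_closed by (simp add: d_smult)
  ultimately obtain w where w: "w \<in> T (set xs) q" "d q w = x [^] m \<odot>\<^bsub>J p\<^esub> y"
    using Cons.IH[OF S(1) q, of "x [^] m \<odot>\<^bsub>J p\<^esub> y"] p by auto
  obtain w' g where w': "w' \<in> T (set xs) q" and g: "g \<in> T (set (x # xs)) q"
    and weq: "w = x [^] m \<odot>\<^bsub>J q\<^esub> w' \<oplus>\<^bsub>J q\<^esub> g"
    using T_divide[OF w(1) xR S(1)] by auto
  have C: "w' \<in> carrier (J q)" "g \<in> carrier (J q)" "y \<in> carrier (J p)" using w' g y T_closed by auto
  have dw': "d q w' \<in> carrier (J p)" "d q g \<in> carrier (J p)" using C d_closed p by auto
  have "x [^] m \<odot>\<^bsub>J p\<^esub> (y \<ominus>\<^bsub>J p\<^esub> d q w') = d q w \<ominus>\<^bsub>J p\<^esub> x [^] m \<odot>\<^bsub>J p\<^esub> d q w'"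
    using C dw' xm w(2) by (simp add: J.smult_minus)
  also have "d q w = d q g \<oplus>\<^bsub>J p\<^esub> x [^] m \<odot>\<^bsub>J p\<^esub> d q w'"
    using C xm p weq dw' by (simp add: d_add d_smult J.M.a_comm)
  also have "\<dots> \<ominus>\<^bsub>J p\<^esub> x [^] m \<odot>\<^bsub>J p\<^esub> d q w' = d q g"
    using dw' xm by (simp add: a_minus_def J.M.a_assoc J.M.r_neg)
  finally have eq: "x [^] m \<odot>\<^bsub>J p\<^esub> (y \<ominus>\<^bsub>J p\<^esub> d q w') = d q g" .
  have "d q g \<in> T (set (x # xs)) p" using d_torsion[OF S(2) g] p by simp
  moreover have "y \<ominus>\<^bsub>J p\<^esub> d q w' \<in> T (set xs) p"
    using y(1) d_torsion[OF S(1) w'] p by (intro T_sub(5)[OF S(1)]) auto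
  ultimately have "y \<ominus>\<^bsub>J p\<^esub> d q w' \<in> T (set (x # xs)) p"
    using J.torsion_cancel[OF _ xR, of "y \<ominus>\<^bsub>J p\<^esub> d q w'" "set xs" p m] eq by simp
  moreover have "d p (y \<ominus>\<^bsub>J p\<^esub> d q w') = z"
  proof -
    have "d p (y \<ominus>\<^bsub>J p\<^esub> d q w') = d p y \<ominus>\<^bsub>J (Suc p)\<^esub> d p (d q w')" using C dw' by (intro d_minus)
    then show ?thesis using y(2) d_d[OF C(1)] p d_closed[OF C(3)] by (simp add: J.M.diff_zero)
  qed
  ultimately show ?case by blast
qed

text \<open>\<open>rep xs n m z\<close> means that the cocycle \<open>z\<close> represents the image of \<open>m\<close> under the \<open>n\<close>-th structure
  map of \<open>colim M/(x\<^sup>n)M \<cong> H\<^sup>i\<^sub>I(M)\<close>, where \<open>i\<close> is the length of \<open>xs\<close>. In the step from \<open>xs\<close> to \<open>x # xs\<close>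
  the class of a cocycle \<open>z\<close> is sent to the image of \<open>z/x\<^sup>n\<close> under the connecting homomorphism of
  \<open>0 \<rightarrow> \<Gamma>\<^sub>x \<rightarrow> id \<rightarrow> (-)\<^sub>x\<close>: write \<open>z = x\<^sup>n w + g\<close> with \<open>g\<close> torsion for \<open>x\<close> and take \<open>d w\<close>. A relation is
  used because \<open>w\<close>, and hence the cocycle, is determined only up to coboundaries.\<close>

fun rep :: "'a list \<Rightarrow> nat \<Rightarrow> 'b \<Rightarrow> 'j \<Rightarrow> bool" where
  "rep [] n m z \<longleftrightarrow> m \<in> carrier M \<and> z = e m"
| "rep (x # xs) n m z \<longleftrightarrow> (\<exists>w\<in>T (set xs) (length xs). \<exists>g\<in>T (set (x # xs)) (length xs).
     rep xs n m (x [^] n \<odot>\<^bsub>J (length xs)\<^esub> w \<oplus>\<^bsub>J (length xs)\<^esub> g) \<and> z = d (length xs) w)"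

lemma rep_ConsE:
  assumes "rep (x # xs) n m z"
  obtains w g where "w \<in> T (set xs) (length xs)" "g \<in> T (set (x # xs)) (length xs)"
    "rep xs n m (x [^] n \<odot>\<^bsub>J (length xs)\<^esub> w \<oplus>\<^bsub>J (length xs)\<^esub> g)" "z = d (length xs) w"
  using assms by auto

lemma rep_ConsI:
  assumes "w \<in> T (set xs) (length xs)" "g \<in> T (set (x # xs)) (length xs)"
    and "rep xs n m (x [^] n \<odot>\<^bsub>J (length xs)\<^esub> w \<oplus>\<^bsub>J (length xs)\<^esub> g)"
  shows "rep (x # xs) n m (d (length xs) w)"
  using assms by auto

declare rep.simps(2) [simp del]

lemma rep_cocycle:
  assumes "set xs \<subseteq> carrier R" "rep xs n m z"
  shows "m \<in> carrier M" "z \<in> T (set xs) (length xs)" "d (length xs) z = \<zero>\<^bsub>J (Suc (length xs))\<^esub>"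
proof -
  have "m \<in> carrier M \<and> z \<in> T (set xs) (length xs) \<and> d (length xs) z = \<zero>\<^bsub>J (Suc (length xs))\<^esub>"
    using assms
  proof (induction xs arbitrary: z)
    case Nil
    then have "m \<in> carrier M" "z = e m" by auto
    moreover from this have "z \<in> e ` carrier M" by blast
    ultimately show ?case unfolding eimage by (simp add: torsion_on_def)
  next
    case (Cons x xs)
    have xR: "x \<in> carrier R" and S: "set xs \<subseteq> carrier R" using Cons.prems by auto
    let ?p = "length xs"
    obtain w g where w: "w \<in> T (set xs) ?p" and g: "g \<in> T (set (x # xs)) ?p"
      and r: "rep xs n m (x [^] n \<odot>\<^bsub>J ?p\<^esub> w \<oplus>\<^bsub>J ?p\<^esub> g)" and z: "z = d ?p w"
      using Cons.prems(2) by (rule rep_ConsE)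
    have C: "w \<in> carrier (J ?p)" "g \<in> carrier (J ?p)" using w g T_closed by auto
    have D: "d ?p w \<in> carrier (J (Suc ?p))" "d ?p g \<in> carrier (J (Suc ?p))" using C d_closed by auto
    note IH = Cons.IH[OF S r]
    have "x [^] n \<odot>\<^bsub>J (Suc ?p)\<^esub> d ?p w \<oplus>\<^bsub>J (Suc ?p)\<^esub> d ?p g = \<zero>\<^bsub>J (Suc ?p)\<^esub>"
      using IH C xR by (simp add: d_add d_smult)
    then have "\<ominus>\<^bsub>J (Suc ?p)\<^esub> d ?p g = x [^] n \<odot>\<^bsub>J (Suc ?p)\<^esub> d ?p w"
      using D xR by (intro J.M.minus_equality) auto
    moreover have "\<ominus>\<^bsub>J (Suc ?p)\<^esub> d ?p g \<in> T (set (x # xs)) (Suc ?p)"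
      using d_torsion[OF Cons.prems(1) g] by (intro T_sub(4)[OF Cons.prems(1)])
    ultimately have "d ?p w \<in> T (set (x # xs)) (Suc ?p)"
      using J.torsion_cancel[OF d_torsion[OF S w] xR] by simp
    then show ?case using IH d_d[OF C(1)] z by simp
  qed
  then show "m \<in> carrier M" "z \<in> T (set xs) (length xs)" "d (length xs) z = \<zero>\<^bsub>J (Suc (length xs))\<^esub>"
    by auto
qed

lemma rep_add:
  assumes "set xs \<subseteq> carrier R" "rep xs n m z" "rep xs n m' z'"
  shows "rep xs n (m \<oplus>\<^bsub>M\<^esub> m') (z \<oplus>\<^bsub>J (length xs)\<^esub> z')"
  using assms
proof (induction xs arbitrary: z z')
  case Nil
  then show ?case by (simp add: mod_homD(2)[OF ehom])
next
  case (Cons x xs)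
  have xR: "x [^] n \<in> carrier R" and S: "set xs \<subseteq> carrier R" using Cons.prems by auto
  let ?p = "length xs"
  obtain w g where w: "w \<in> T (set xs) ?p" and g: "g \<in> T (set (x # xs)) ?p"
    and r: "rep xs n m (x [^] n \<odot>\<^bsub>J ?p\<^esub> w \<oplus>\<^bsub>J ?p\<^esub> g)" and z: "z = d ?p w"
    using Cons.prems(2) by (rule rep_ConsE)
  obtain w' g' where w': "w' \<in> T (set xs) ?p" and g': "g' \<in> T (set (x # xs)) ?p"
    and r': "rep xs n m' (x [^] n \<odot>\<^bsub>J ?p\<^esub> w' \<oplus>\<^bsub>J ?p\<^esub> g')" and z': "z' = d ?p w'"
    using Cons.prems(3) by (rule rep_ConsE)
  have C: "w \<in> carrier (J ?p)" "g \<in> carrier (J ?p)" "w' \<in> carrier (J ?p)" "g' \<in> carrier (J ?p)"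
    using w g w' g' T_closed by auto
  have "(x [^] n \<odot>\<^bsub>J ?p\<^esub> w \<oplus>\<^bsub>J ?p\<^esub> g) \<oplus>\<^bsub>J ?p\<^esub> (x [^] n \<odot>\<^bsub>J ?p\<^esub> w' \<oplus>\<^bsub>J ?p\<^esub> g') =
      x [^] n \<odot>\<^bsub>J ?p\<^esub> (w \<oplus>\<^bsub>J ?p\<^esub> w') \<oplus>\<^bsub>J ?p\<^esub> (g \<oplus>\<^bsub>J ?p\<^esub> g')"
    using C xR by (simp add: J.smult_r_distr J.M.a_ac)
  then have "rep xs n (m \<oplus>\<^bsub>M\<^esub> m') (x [^] n \<odot>\<^bsub>J ?p\<^esub> (w \<oplus>\<^bsub>J ?p\<^esub> w') \<oplus>\<^bsub>J ?p\<^esub> (g \<oplus>\<^bsub>J ?p\<^esub> g'))"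
    using Cons.IH[OF S r r'] by simp
  then have "rep (x # xs) n (m \<oplus>\<^bsub>M\<^esub> m') (d ?p (w \<oplus>\<^bsub>J ?p\<^esub> w'))"
    using T_sub(3)[OF S w w'] T_sub(3)[OF Cons.prems(1) g g'] by (intro rep_ConsI)
  then show ?case using z z' C by (simp add: d_add)
qed

lemma rep_smult:
  assumes "set xs \<subseteq> carrier R" "rep xs n m z" "a \<in> carrier R"
  shows "rep xs n (a \<odot>\<^bsub>M\<^esub> m) (a \<odot>\<^bsub>J (length xs)\<^esub> z)"
  using assms
proof (induction xs arbitrary: z)
  case Nil
  then show ?case by (simp add: mod_homD(3)[OF ehom])
next
  case (Cons x xs)
  have xR: "x [^] n \<in> carrier R" and S: "set xs \<subseteq> carrier R" using Cons.prems by auto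
  let ?p = "length xs"
  obtain w g where w: "w \<in> T (set xs) ?p" and g: "g \<in> T (set (x # xs)) ?p"
    and r: "rep xs n m (x [^] n \<odot>\<^bsub>J ?p\<^esub> w \<oplus>\<^bsub>J ?p\<^esub> g)" and z: "z = d ?p w"
    using Cons.prems(2) by (rule rep_ConsE)
  have C: "w \<in> carrier (J ?p)" "g \<in> carrier (J ?p)" using w g T_closed by auto
  have "a \<odot>\<^bsub>J ?p\<^esub> (x [^] n \<odot>\<^bsub>J ?p\<^esub> w \<oplus>\<^bsub>J ?p\<^esub> g) =
      x [^] n \<odot>\<^bsub>J ?p\<^esub> (a \<odot>\<^bsub>J ?p\<^esub> w) \<oplus>\<^bsub>J ?p\<^esub> a \<odot>\<^bsub>J ?p\<^esub> g"
    using C xR Cons.prems(3) by (simp add: J.smult_r_distr J.smult_lcomm)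
  then have "rep xs n (a \<odot>\<^bsub>M\<^esub> m) (x [^] n \<odot>\<^bsub>J ?p\<^esub> (a \<odot>\<^bsub>J ?p\<^esub> w) \<oplus>\<^bsub>J ?p\<^esub> a \<odot>\<^bsub>J ?p\<^esub> g)"
    using Cons.IH[OF S r Cons.prems(3)] by simp
  then have "rep (x # xs) n (a \<odot>\<^bsub>M\<^esub> m) (d ?p (a \<odot>\<^bsub>J ?p\<^esub> w))"
    using T_sub(6)[OF S w Cons.prems(3)] T_sub(6)[OF Cons.prems(1) g Cons.prems(3)]
    by (intro rep_ConsI)
  then show ?case using z C Cons.prems(3) by (simp add: d_smult)
qed

lemma rep_diff:
  assumes S: "set xs \<subseteq> carrier R" and r: "rep xs n m z" and r': "rep xs n m' z'"
  shows "rep xs n (m \<ominus>\<^bsub>M\<^esub> m') (z \<ominus>\<^bsub>J (length xs)\<^esub> z')"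
proof -
  have "m' \<in> carrier M" "z' \<in> carrier (J (length xs))" using rep_cocycle(1,2)[OF S r'] T_closed by auto
  moreover have "rep xs n (m \<oplus>\<^bsub>M\<^esub> (\<ominus> \<one>) \<odot>\<^bsub>M\<^esub> m') (z \<oplus>\<^bsub>J (length xs)\<^esub> (\<ominus> \<one>) \<odot>\<^bsub>J (length xs)\<^esub> z')"
    by (intro rep_add rep_smult S r r') simp
  ultimately show ?thesis by (simp add: a_minus_def smult_l_minus J.smult_l_minus)
qed

text \<open>Compatibility of the structure maps with the transition maps of the direct system.\<close>

lemma rep_Suc:
  assumes "set xs \<subseteq> carrier R" "rep xs n m z"
  shows "rep xs (Suc n) (list_prod R xs \<odot>\<^bsub>M\<^esub> m) z"
  using assms
proof (induction xs arbitrary: z)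
  case (Cons x xs)
  have xR: "x \<in> carrier R" "x [^] n \<in> carrier R" and S: "set xs \<subseteq> carrier R" using Cons.prems by auto
  let ?p = "length xs"
  obtain w g where w: "w \<in> T (set xs) ?p" and g: "g \<in> T (set (x # xs)) ?p"
    and r: "rep xs n m (x [^] n \<odot>\<^bsub>J ?p\<^esub> w \<oplus>\<^bsub>J ?p\<^esub> g)" and z: "z = d ?p w"
    using Cons.prems(2) by (rule rep_ConsE)
  have C: "w \<in> carrier (J ?p)" "g \<in> carrier (J ?p)" "m \<in> carrier M"
    using w g T_closed rep_cocycle(1)[OF S r] by auto
  have "x \<odot>\<^bsub>J ?p\<^esub> (x [^] n \<odot>\<^bsub>J ?p\<^esub> w \<oplus>\<^bsub>J ?p\<^esub> g) = x [^] (1 + n) \<odot>\<^bsub>J ?p\<^esub> w \<oplus>\<^bsub>J ?p\<^esub> x \<odot>\<^bsub>J ?p\<^esub> g"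
    using C xR by (subst J.smult_pow_add) (auto simp: J.smult_r_distr)
  moreover have "x \<odot>\<^bsub>M\<^esub> (list_prod R xs \<odot>\<^bsub>M\<^esub> m) = list_prod R (x # xs) \<odot>\<^bsub>M\<^esub> m"
    using C xR S by (simp add: smult_assoc1)
  ultimately have "rep xs (Suc n) (list_prod R (x # xs) \<odot>\<^bsub>M\<^esub> m)
      (x [^] Suc n \<odot>\<^bsub>J ?p\<^esub> w \<oplus>\<^bsub>J ?p\<^esub> x \<odot>\<^bsub>J ?p\<^esub> g)"
    using rep_smult[OF S Cons.IH[OF S r] xR(1)] by simp
  then show ?case unfolding z
    using w T_sub(6)[OF Cons.prems(1) g xR(1)] by (intro rep_ConsI)
qed simp

lemma rep_raise:
  assumes S: "set xs \<subseteq> carrier R" and r: "rep xs n m z"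
  shows "rep xs (n + k) (list_prod R xs [^] k \<odot>\<^bsub>M\<^esub> m) z"
proof (induction k)
  case 0
  show ?case using r rep_cocycle(1)[OF S r] by simp
next
  case (Suc k)
  have "list_prod R xs \<odot>\<^bsub>M\<^esub> (list_prod R xs [^] k \<odot>\<^bsub>M\<^esub> m) = list_prod R xs [^] Suc k \<odot>\<^bsub>M\<^esub> m"
    using rep_cocycle(1)[OF S r] S by (simp add: m_comm flip: smult_assoc1)
  then show ?case using rep_Suc[OF S Suc] by simp
qed

lemma rep_total:
  assumes "set xs \<subseteq> carrier R" "m \<in> carrier M"
  shows "\<exists>z. rep xs n m z"
  using assms
proof (induction xs)
  case (Cons x xs)
  have xR: "x \<in> carrier R" and S: "set xs \<subseteq> carrier R" using Cons.prems by auto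
  obtain y where y: "rep xs n m y" using Cons.IH[OF S Cons.prems(2)] by blast
  obtain w g where "w \<in> T (set xs) (length xs)" "g \<in> T (insert x (set xs)) (length xs)"
    "y = x [^] n \<odot>\<^bsub>J (length xs)\<^esub> w \<oplus>\<^bsub>J (length xs)\<^esub> g"
    using T_divide[OF rep_cocycle(2)[OF S y] xR S] by metis
  then show ?case using rep_ConsI[of w xs g x n m] y by auto
qed auto

text \<open>Every class comes from some level: a torsion cocycle of \<open>x # xs\<close> is \<open>d w\<close> in the complex of \<open>xs\<close>,
  because that complex is exact in this degree, and \<open>x\<^sup>N w\<close> is a cocycle there for some \<open>N\<close>.\<close>

lemma rep_surj:
  assumes "set xs \<subseteq> carrier R" "z \<in> T (set xs) (length xs)"
    and "d (length xs) z = \<zero>\<^bsub>J (Suc (length xs))\<^esub>"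
  shows "\<exists>n m. rep xs n m z"
  using assms
proof (induction xs arbitrary: z)
  case Nil
  then have "z \<in> e ` carrier M" unfolding eimage by (auto simp: torsion_on_def)
  then show ?case by auto
next
  case (Cons x xs)
  have xR: "x \<in> carrier R" and S: "set xs \<subseteq> carrier R" using Cons.prems by auto
  let ?p = "length xs"
  have "z \<in> T (set xs) (Suc ?p)" using Cons.prems(2) torsion_on_mono by simp
  then obtain w where w: "w \<in> T (set xs) ?p" "d ?p w = z"
    using torsion_complex_exact[OF S order.refl] Cons.prems(3) by auto
  have wC: "w \<in> carrier (J ?p)" using w T_closed by auto
  obtain N :: nat where N: "x [^] N \<odot>\<^bsub>J (Suc ?p)\<^esub> z = \<zero>\<^bsub>J (Suc ?p)\<^esub>"
    using torsion_onD(2)[OF Cons.prems(2), of x] by auto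
  have "x [^] N \<odot>\<^bsub>J ?p\<^esub> w \<in> T (set xs) ?p" using w xR by (intro T_sub(6)[OF S]) auto
  moreover have "d ?p (x [^] N \<odot>\<^bsub>J ?p\<^esub> w) = \<zero>\<^bsub>J (Suc ?p)\<^esub>" using w N wC xR by (simp add: d_smult)
  ultimately obtain n m where r: "rep xs n m (x [^] N \<odot>\<^bsub>J ?p\<^esub> w)" using Cons.IH[OF S] by blast
  have "rep xs (n + N) (x [^] n \<odot>\<^bsub>M\<^esub> (list_prod R xs [^] N \<odot>\<^bsub>M\<^esub> m))
      (x [^] n \<odot>\<^bsub>J ?p\<^esub> (x [^] N \<odot>\<^bsub>J ?p\<^esub> w))"
    using xR by (intro rep_smult rep_raise S r) auto
  moreover have "x [^] n \<odot>\<^bsub>J ?p\<^esub> (x [^] N \<odot>\<^bsub>J ?p\<^esub> w) = x [^] (n + N) \<odot>\<^bsub>J ?p\<^esub> w \<oplus>\<^bsub>J ?p\<^esub> \<zero>\<^bsub>J ?p\<^esub>"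
    using xR wC by (simp add: J.smult_pow_add)
  ultimately have "rep (x # xs) (n + N) (x [^] n \<odot>\<^bsub>M\<^esub> (list_prod R xs [^] N \<odot>\<^bsub>M\<^esub> m)) (d ?p w)"
    using w(1) T_sub(2)[OF Cons.prems(1), of ?p] by (intro rep_ConsI) auto
  then show ?case using w(2) by blast
qed

text \<open>For the empty sequence the module \<open>M\<close> itself stands in degree \<open>0\<close>, without coboundaries.\<close>

definition boundary :: "'a list \<Rightarrow> 'j set" where
  "boundary xs = (case xs of [] \<Rightarrow> {\<zero>\<^bsub>J 0\<^esub>} | y # ys \<Rightarrow> d (length ys) ` T (set xs) (length ys))"

lemma boundary_Nil: "boundary [] = {\<zero>\<^bsub>J 0\<^esub>}"
  and boundary_Cons: "boundary (x # xs) = d (length xs) ` T (set (x # xs)) (length xs)"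
  by (simp_all add: boundary_def)

lemma boundary_cocycle:
  assumes "set xs \<subseteq> carrier R" "b \<in> boundary xs"
  shows "b \<in> T (set xs) (length xs)" "d (length xs) b = \<zero>\<^bsub>J (Suc (length xs))\<^esub>"
proof -
  have "b \<in> T (set xs) (length xs) \<and> d (length xs) b = \<zero>\<^bsub>J (Suc (length xs))\<^esub>"
  proof (cases xs)
    case Nil
    then show ?thesis using assms d_zero[of 0] by (simp add: boundary_Nil torsion_on_def)
  next
    case (Cons y ys)
    then obtain v where v: "v \<in> T (set xs) (length ys)" "b = d (length ys) v"
      using assms(2) by (auto simp: boundary_Cons)
    then show ?thesis using d_torsion[OF assms(1) v(1)] d_d[OF T_closed[OF v(1)]] Cons by simp
  qed
  then show "b \<in> T (set xs) (length xs)" "d (length xs) b = \<zero>\<^bsub>J (Suc (length xs))\<^esub>" by auto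
qed

lemma zero_boundary: "set xs \<subseteq> carrier R \<Longrightarrow> \<zero>\<^bsub>J (length xs)\<^esub> \<in> boundary xs"
  by (cases xs) (auto simp: boundary_Nil boundary_Cons d_zero image_iff intro!: bexI[of _ "\<zero>\<^bsub>J _\<^esub>"] T_sub(2))

lemma boundary_divide:
  assumes S: "set xs \<subseteq> carrier R" and xR: "x \<in> carrier R" and b: "b \<in> boundary xs"
  obtains b' t where "b' \<in> boundary xs" "t \<in> T (set (x # xs)) (length xs)"
    "b = x [^] (n::nat) \<odot>\<^bsub>J (length xs)\<^esub> b' \<oplus>\<^bsub>J (length xs)\<^esub> t"
proof (cases xs)
  case Nil
  have "b = x [^] n \<odot>\<^bsub>J (length xs)\<^esub> \<zero>\<^bsub>J (length xs)\<^esub> \<oplus>\<^bsub>J (length xs)\<^esub> \<zero>\<^bsub>J (length xs)\<^esub>"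
    using b Nil xR by (simp add: boundary_Nil)
  moreover have "\<zero>\<^bsub>J (length xs)\<^esub> \<in> T (set (x # xs)) (length xs)"
    using S xR by (intro T_sub(2)) auto
  ultimately show ?thesis using that zero_boundary[OF S] by blast
next
  case (Cons y ys)
  let ?q = "length ys"
  obtain v where v: "v \<in> T (set xs) ?q" "b = d ?q v" using b Cons by (auto simp: boundary_Cons)
  obtain v' g where v': "v' \<in> T (set xs) ?q" and g: "g \<in> T (set (x # xs)) ?q"
    and eq: "v = x [^] n \<odot>\<^bsub>J ?q\<^esub> v' \<oplus>\<^bsub>J ?q\<^esub> g"
    using T_divide[OF v(1) xR S] by auto
  have "b = x [^] n \<odot>\<^bsub>J (length xs)\<^esub> d ?q v' \<oplus>\<^bsub>J (length xs)\<^esub> d ?q g"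
    using v(2) eq T_closed[OF v'] T_closed[OF g] xR Cons by (simp add: d_add d_smult)
  moreover have "d ?q v' \<in> boundary xs" using v' Cons by (auto simp: boundary_Cons)
  moreover have "d ?q g \<in> T (set (x # xs)) (length xs)"
    using d_torsion[OF _ g] S xR Cons by auto
  ultimately show ?thesis using that by blast
qed

text \<open>The kernel of the \<open>n\<close>-th structure map is that of \<open>M \<rightarrow> colim M/(x\<^sup>k)M\<close>. In the induction step
  \<open>z = d w\<close> is a coboundary if and only if \<open>w\<close> can be changed by torsion to a cocycle \<open>y\<close>, which says
  that the class of \<open>z\<^sub>0 = x\<^sup>n w + g\<close> is \<open>x\<^sup>n\<close> times the class of \<open>y\<close> up to \<open>x\<close>-torsion. The class of
  \<open>y\<close> comes from some level of the direct system for \<open>xs\<close>, and the induction hypothesis turns the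
  relation between classes into one between elements of \<open>M\<close>.\<close>

lemma rep_boundary_iff:
  assumes "set xs \<subseteq> carrier R" "rep xs n m z"
  shows "z \<in> boundary xs \<longleftrightarrow> (\<exists>k. list_prod R xs [^] k \<odot>\<^bsub>M\<^esub> m \<in> lspan R M (powers R (n + k) xs))"
  using assms
proof (induction xs arbitrary: n m z)
  case Nil
  then have "m \<in> carrier M" "z = e m" by auto
  moreover have "e m = \<zero>\<^bsub>J 0\<^esub> \<longleftrightarrow> m = \<zero>\<^bsub>M\<^esub>"
    using inj_onD[OF einj, of m "\<zero>\<^bsub>M\<^esub>"] mod_hom_zero[OF module_axioms J.module_axioms ehom] \<open>m \<in> carrier M\<close>
    by auto
  ultimately show ?case by (simp add: boundary_Nil)
next
  case (Cons x xs)
  let ?p = "length xs" and ?\<pi> = "list_prod R xs"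
  have xR: "x \<in> carrier R" and S: "set xs \<subseteq> carrier R" using Cons.prems by auto
  note SS = Cons.prems(1)
  have \<pi>R: "?\<pi> \<in> carrier R" using S by simp
  have sub: "submodule (lspan R M (powers R k xs)) R M" for k
    using S by (intro lspan_submodule module_axioms) auto
  obtain w g where w: "w \<in> T (set xs) ?p" and g: "g \<in> T (set (x # xs)) ?p"
    and r: "rep xs n m (x [^] n \<odot>\<^bsub>J ?p\<^esub> w \<oplus>\<^bsub>J ?p\<^esub> g)" and z: "z = d ?p w"
    using Cons.prems(2) by (rule rep_ConsE)
  define z0 where "z0 = x [^] n \<odot>\<^bsub>J ?p\<^esub> w \<oplus>\<^bsub>J ?p\<^esub> g"
  have r: "rep xs n m z0" using r by (simp add: z0_def)
  have mM: "m \<in> carrier M" using rep_cocycle(1)[OF S r] .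
  have C: "w \<in> carrier (J ?p)" "g \<in> carrier (J ?p)" "z0 \<in> carrier (J ?p)"
    using w g T_closed rep_cocycle(2)[OF S r] by auto
  have pow: "list_prod R (x # xs) [^] k = x [^] k \<otimes> ?\<pi> [^] k" for k :: nat
    using xR \<pi>R by (simp add: nat_pow_distrib)
  show ?case
  proof
    assume "z \<in> boundary (x # xs)"
    then obtain g' where g': "g' \<in> T (set (x # xs)) ?p" "d ?p w = d ?p g'"
      using z by (auto simp: boundary_Cons)
    have gC: "g' \<in> carrier (J ?p)" using g' T_closed by auto
    define y where "y = w \<ominus>\<^bsub>J ?p\<^esub> g'"
    have yC: "y \<in> carrier (J ?p)" using C gC by (simp add: y_def)
    have "y \<in> T (set xs) ?p"
      unfolding y_def using w g'(1) torsion_on_mono by (intro T_sub(5)[OF S]) auto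
    moreover have "d ?p y = \<zero>\<^bsub>J (Suc ?p)\<^esub>"
      using C gC g'(2) d_closed[OF gC] by (simp add: y_def d_minus J.M.diff_self)
    ultimately obtain N0 m0 where "rep xs N0 m0 y" using rep_surj[OF S] by blast
    then have "rep xs (N0 + n) (?\<pi> [^] n \<odot>\<^bsub>M\<^esub> m0) y" by (rule rep_raise[OF S])
    then obtain N m1 where N: "rep xs (n + N) m1 y" by (metis add.commute)
    have m1: "m1 \<in> carrier M" using rep_cocycle(1)[OF S N] .
    \<comment> \<open>This element is torsion for \<open>x\<close>; killing it by \<open>x\<^sup>k\<close> gives a representative of the zero class.\<close>
    define c where "c = z0 \<ominus>\<^bsub>J ?p\<^esub> x [^] n \<odot>\<^bsub>J ?p\<^esub> y"
    have "c = g \<oplus>\<^bsub>J ?p\<^esub> x [^] n \<odot>\<^bsub>J ?p\<^esub> g'"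
    proof -
      have "c = (x [^] n \<odot>\<^bsub>J ?p\<^esub> w \<oplus>\<^bsub>J ?p\<^esub> g) \<ominus>\<^bsub>J ?p\<^esub> (x [^] n \<odot>\<^bsub>J ?p\<^esub> w \<ominus>\<^bsub>J ?p\<^esub> x [^] n \<odot>\<^bsub>J ?p\<^esub> g')"
        using C gC xR by (simp add: c_def z0_def y_def J.smult_minus)
      then show ?thesis using C gC xR
        by (simp add: a_minus_def J.M.minus_add J.M.a_ac J.M.r_neg)
    qed
    then have "c \<in> T (set (x # xs)) ?p"
      using T_sub(3)[OF SS g T_sub(6)[OF SS g'(1)], of "x [^] n"] xR by simp
    then obtain k :: nat where k: "x [^] k \<odot>\<^bsub>J ?p\<^esub> c = \<zero>\<^bsub>J ?p\<^esub>"
      using torsion_onD(2)[of c R "set (x # xs)" "J ?p" x] by auto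
    define m2 where "m2 = x [^] k \<odot>\<^bsub>M\<^esub> (?\<pi> [^] N \<odot>\<^bsub>M\<^esub> m \<ominus>\<^bsub>M\<^esub> x [^] n \<odot>\<^bsub>M\<^esub> m1)"
    have "rep xs (n + N) m2 (x [^] k \<odot>\<^bsub>J ?p\<^esub> c)"
      unfolding m2_def c_def using xR by (intro rep_smult rep_diff rep_raise S r N) auto
    then have "rep xs (n + N) m2 \<zero>\<^bsub>J ?p\<^esub>" using k by simp
    from Cons.IH[OF S this] zero_boundary[OF S]
    obtain l where l: "?\<pi> [^] l \<odot>\<^bsub>M\<^esub> m2 \<in> lspan R M (powers R (n + N + l) xs)" by blast
    define u where "u = ?\<pi> [^] l \<odot>\<^bsub>M\<^esub> m2"
    have uM: "u \<in> carrier M" using l submodule_memD(1)[OF sub] by (simp add: u_def)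
    let ?m1 = "?\<pi> [^] l \<odot>\<^bsub>M\<^esub> m1"
    have m1': "?m1 \<in> carrier M" using m1 \<pi>R by simp
    have "u = x [^] k \<odot>\<^bsub>M\<^esub> (?\<pi> [^] (l + N) \<odot>\<^bsub>M\<^esub> m) \<ominus>\<^bsub>M\<^esub> x [^] (k + n) \<odot>\<^bsub>M\<^esub> ?m1"
      using xR \<pi>R mM m1
      by (simp add: u_def m2_def smult_minus smult_pow_add smult_lcomm[of "?\<pi> [^] l" "x [^] _"])
    then have e1: "x [^] k \<odot>\<^bsub>M\<^esub> (?\<pi> [^] (l + N) \<odot>\<^bsub>M\<^esub> m) = u \<oplus>\<^bsub>M\<^esub> x [^] (k + n) \<odot>\<^bsub>M\<^esub> ?m1"
      using xR \<pi>R mM m1 by (simp add: M.diff_add_cancel)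
    \<comment> \<open>This exponent has room for the factor \<open>\<pi>\<^bsup>l+N\<^esup>\<close> in \<open>u\<close> and for the factor \<open>x\<^sup>k\<close> that kills \<open>c\<close>.\<close>
    let ?K = "l + N + k"
    have "list_prod R (x # xs) [^] ?K \<odot>\<^bsub>M\<^esub> m =
        x [^] (l + N) \<odot>\<^bsub>M\<^esub> (?\<pi> [^] k \<odot>\<^bsub>M\<^esub> (x [^] k \<odot>\<^bsub>M\<^esub> (?\<pi> [^] (l + N) \<odot>\<^bsub>M\<^esub> m)))"
      using xR \<pi>R mM unfolding pow
      by (simp add: smult_assoc1 smult_pow_add smult_lcomm[of "x [^] k" "?\<pi> [^] _"]
          smult_lcomm[of "?\<pi> [^] k" "?\<pi> [^] _"])
    also have "\<dots> = x [^] (l + N) \<odot>\<^bsub>M\<^esub> (?\<pi> [^] k \<odot>\<^bsub>M\<^esub> u) \<oplus>\<^bsub>M\<^esub>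
        x [^] (l + N) \<odot>\<^bsub>M\<^esub> (x [^] (k + n) \<odot>\<^bsub>M\<^esub> (?\<pi> [^] k \<odot>\<^bsub>M\<^esub> ?m1))"
      unfolding e1 using xR \<pi>R uM m1' by (simp add: smult_r_distr smult_lcomm[of "?\<pi> [^] k" "x [^] _"])
    also have "x [^] (l + N) \<odot>\<^bsub>M\<^esub> (x [^] (k + n) \<odot>\<^bsub>M\<^esub> (?\<pi> [^] k \<odot>\<^bsub>M\<^esub> ?m1)) =
        x [^] (n + ?K) \<odot>\<^bsub>M\<^esub> (?\<pi> [^] k \<odot>\<^bsub>M\<^esub> ?m1)"
    proof -
      have e: "n + ?K = (l + N) + (k + n)" by simp
      show ?thesis unfolding e using xR \<pi>R m1' by (intro smult_pow_add[symmetric]) auto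
    qed
    finally have "list_prod R (x # xs) [^] ?K \<odot>\<^bsub>M\<^esub> m = x [^] (l + N) \<odot>\<^bsub>M\<^esub> (?\<pi> [^] k \<odot>\<^bsub>M\<^esub> u) \<oplus>\<^bsub>M\<^esub>
        x [^] (n + ?K) \<odot>\<^bsub>M\<^esub> (?\<pi> [^] k \<odot>\<^bsub>M\<^esub> ?m1)" .
    moreover have "x [^] (l + N) \<odot>\<^bsub>M\<^esub> (?\<pi> [^] k \<odot>\<^bsub>M\<^esub> u) \<in> lspan R M (powers R (n + ?K) xs)"
    proof -
      have "?\<pi> [^] k \<odot>\<^bsub>M\<^esub> u \<in> lspan R M (powers R (n + N + l + k) xs)"
        using list_prod_power_smult_lspan[OF module_axioms S] l by (simp add: u_def)
      moreover have "n + N + l + k = n + ?K" by simp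
      ultimately have "?\<pi> [^] k \<odot>\<^bsub>M\<^esub> u \<in> lspan R M (powers R (n + ?K) xs)" by metis
      from submodule_memD(6)[OF sub this] show ?thesis using xR by simp
    qed
    moreover have "?\<pi> [^] k \<odot>\<^bsub>M\<^esub> ?m1 \<in> carrier M" using \<pi>R m1' by simp
    ultimately have "list_prod R (x # xs) [^] ?K \<odot>\<^bsub>M\<^esub> m \<in> lspan R M (powers R (n + ?K) (x # xs))"
      by auto
    then show "\<exists>k. list_prod R (x # xs) [^] k \<odot>\<^bsub>M\<^esub> m \<in> lspan R M (powers R (n + k) (x # xs))" by blast
  next
    assume "\<exists>k. list_prod R (x # xs) [^] k \<odot>\<^bsub>M\<^esub> m \<in> lspan R M (powers R (n + k) (x # xs))"
    then obtain k u m1 where u: "u \<in> lspan R M (powers R (n + k) xs)" and m1: "m1 \<in> carrier M"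
      and eq: "list_prod R (x # xs) [^] k \<odot>\<^bsub>M\<^esub> m = u \<oplus>\<^bsub>M\<^esub> x [^] (n + k) \<odot>\<^bsub>M\<^esub> m1"
      by (auto simp del: list_prod.simps)
    have uM: "u \<in> carrier M" using u submodule_memD(1)[OF sub] by blast
    obtain z1 where z1: "rep xs (n + k) m1 z1" using rep_total[OF S m1] by blast
    note Z1 = rep_cocycle(2,3)[OF S z1]
    have z1C: "z1 \<in> carrier (J ?p)" using Z1 T_closed by auto
    let ?c = "x [^] k \<odot>\<^bsub>J ?p\<^esub> z0 \<ominus>\<^bsub>J ?p\<^esub> x [^] (n + k) \<odot>\<^bsub>J ?p\<^esub> z1"
    have "rep xs (n + k) (x [^] k \<odot>\<^bsub>M\<^esub> (?\<pi> [^] k \<odot>\<^bsub>M\<^esub> m) \<ominus>\<^bsub>M\<^esub> x [^] (n + k) \<odot>\<^bsub>M\<^esub> m1) ?c"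
      using xR by (intro rep_diff rep_smult rep_raise S r z1) auto
    moreover have "x [^] k \<odot>\<^bsub>M\<^esub> (?\<pi> [^] k \<odot>\<^bsub>M\<^esub> m) \<ominus>\<^bsub>M\<^esub> x [^] (n + k) \<odot>\<^bsub>M\<^esub> m1 = u"
    proof -
      have "x [^] k \<odot>\<^bsub>M\<^esub> (?\<pi> [^] k \<odot>\<^bsub>M\<^esub> m) = u \<oplus>\<^bsub>M\<^esub> x [^] (n + k) \<odot>\<^bsub>M\<^esub> m1"
        using eq xR \<pi>R mM unfolding pow by (simp add: smult_assoc1)
      then show ?thesis using uM m1 xR by (simp add: a_minus_def M.a_assoc M.r_neg)
    qed
    ultimately have "rep xs (n + k) u ?c" by simp
    moreover have "?\<pi> [^] (0::nat) \<odot>\<^bsub>M\<^esub> u \<in> lspan R M (powers R (n + k + 0) xs)" using u uM by simp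
    ultimately have "?c \<in> boundary xs" using Cons.IH[OF S] by blast
    then obtain b t where b: "b \<in> boundary xs" and t: "t \<in> T (set (x # xs)) ?p"
      and ceq: "?c = x [^] (n + k) \<odot>\<^bsub>J ?p\<^esub> b \<oplus>\<^bsub>J ?p\<^esub> t"
      using boundary_divide[OF S xR] by metis
    note B = boundary_cocycle[OF S b]
    have bC: "b \<in> carrier (J ?p)" "t \<in> carrier (J ?p)" using B t T_closed by auto
    \<comment> \<open>Correcting \<open>w\<close> by two cocycles leaves \<open>d w\<close> unchanged and makes it torsion for \<open>x\<close>.\<close>
    define v where "v = (w \<ominus>\<^bsub>J ?p\<^esub> z1) \<ominus>\<^bsub>J ?p\<^esub> b"
    have vT: "v \<in> T (set xs) ?p" unfolding v_def by (intro T_sub(5)[OF S] w Z1(1) B(1))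
    have "x [^] (n + k) \<odot>\<^bsub>J ?p\<^esub> v = t \<ominus>\<^bsub>J ?p\<^esub> x [^] k \<odot>\<^bsub>J ?p\<^esub> g"
    proof -
      let ?y = "x [^] (n + k) \<odot>\<^bsub>J ?p\<^esub> w" and ?g = "x [^] k \<odot>\<^bsub>J ?p\<^esub> g"
      let ?z = "x [^] (n + k) \<odot>\<^bsub>J ?p\<^esub> z1" and ?b = "x [^] (n + k) \<odot>\<^bsub>J ?p\<^esub> b"
      have yg: "?y \<in> carrier (J ?p)" "?g \<in> carrier (J ?p)" "?z \<in> carrier (J ?p)" "?b \<in> carrier (J ?p)"
        using C z1C bC xR by auto
      have "x [^] k \<odot>\<^bsub>J ?p\<^esub> z0 = ?y \<oplus>\<^bsub>J ?p\<^esub> ?g"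
        unfolding z0_def using C xR by (subst add.commute) (simp add: J.smult_r_distr J.smult_pow_add)
      then have "(?y \<oplus>\<^bsub>J ?p\<^esub> ?g) \<ominus>\<^bsub>J ?p\<^esub> ?z = ?b \<oplus>\<^bsub>J ?p\<^esub> t" using ceq by simp
      then have "t \<ominus>\<^bsub>J ?p\<^esub> ?g = (?y \<ominus>\<^bsub>J ?p\<^esub> ?z) \<ominus>\<^bsub>J ?p\<^esub> ?b"
        by (rule J.M.diff_exchange[OF _ yg bC(2)])
      also have "\<dots> = x [^] (n + k) \<odot>\<^bsub>J ?p\<^esub> v"
        unfolding v_def using C z1C bC xR by (simp add: J.smult_minus)
      finally show ?thesis by (rule sym)
    qed
    moreover have "t \<ominus>\<^bsub>J ?p\<^esub> x [^] k \<odot>\<^bsub>J ?p\<^esub> g \<in> T (set (x # xs)) ?p"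
      using t g xR by (intro T_sub(5)[OF SS] T_sub(6)[OF SS]) auto
    ultimately have "v \<in> T (set (x # xs)) ?p"
      using J.torsion_cancel[OF vT xR, of "n + k"] by simp
    moreover have "d ?p v = z"
    proof -
      have "d ?p v = (d ?p w \<ominus>\<^bsub>J (Suc ?p)\<^esub> d ?p z1) \<ominus>\<^bsub>J (Suc ?p)\<^esub> d ?p b"
        using C z1C bC by (simp add: v_def d_minus)
      then show ?thesis using Z1(2) B(2) z d_closed[OF C(1)] by (simp add: J.M.diff_zero)
    qed
    ultimately show "z \<in> boundary (x # xs)" by (auto simp: boundary_Cons)
  qed
qed

end

section \<open>Quotient modules and maps into injective modules\<close>

lemma quotient_module_facts:
  assumes M: "module R M" and N: "submodule N R M"
  shows quotient_module_carrier: "carrier (quotient_module M N) = (\<lambda>x. N +>\<^bsub>M\<^esub> x) ` carrier M"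
    and quotient_module_add: "x \<in> carrier M \<Longrightarrow> y \<in> carrier M \<Longrightarrow>
      (N +>\<^bsub>M\<^esub> x) \<oplus>\<^bsub>quotient_module M N\<^esub> (N +>\<^bsub>M\<^esub> y) = N +>\<^bsub>M\<^esub> (x \<oplus>\<^bsub>M\<^esub> y)"
    and quotient_module_smult: "r \<in> carrier R \<Longrightarrow> x \<in> carrier M \<Longrightarrow>
      r \<odot>\<^bsub>quotient_module M N\<^esub> (N +>\<^bsub>M\<^esub> x) = N +>\<^bsub>M\<^esub> (r \<odot>\<^bsub>M\<^esub> x)"
    and quotient_module_zero: "\<zero>\<^bsub>quotient_module M N\<^esub> = N +>\<^bsub>M\<^esub> \<zero>\<^bsub>M\<^esub>"
    and quotient_module_eq_iff: "x \<in> carrier M \<Longrightarrow> y \<in> carrier M \<Longrightarrow>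
      N +>\<^bsub>M\<^esub> x = N +>\<^bsub>M\<^esub> y \<longleftrightarrow> x \<ominus>\<^bsub>M\<^esub> y \<in> N"
proof -
  interpret M: module R M by fact
  interpret N: submodule N R M by fact
  interpret N: abelian_subgroup N M
    by (rule abelian_subgroupI3)
       (auto simp: additive_subgroup_def N.subgroup_axioms M.M.abelian_group_axioms)
  note S = M.submodule_memD[OF N]
  show car: "carrier (quotient_module M N) = (\<lambda>x. N +>\<^bsub>M\<^esub> x) ` carrier M"
    by (auto simp: quotient_module_def A_RCOSETS_def RCOSETS_def a_r_coset_def)
  show "(N +>\<^bsub>M\<^esub> x) \<oplus>\<^bsub>quotient_module M N\<^esub> (N +>\<^bsub>M\<^esub> y) = N +>\<^bsub>M\<^esub> (x \<oplus>\<^bsub>M\<^esub> y)"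
    if "x \<in> carrier M" "y \<in> carrier M" for x y
    using that N.a_rcos_sum by (simp add: quotient_module_def)
  show "\<zero>\<^bsub>quotient_module M N\<^esub> = N +>\<^bsub>M\<^esub> \<zero>\<^bsub>M\<^esub>"
    using M.M.a_coset_add_zero N.a_subset by (simp add: quotient_module_def)
  show eq: "N +>\<^bsub>M\<^esub> x = N +>\<^bsub>M\<^esub> y \<longleftrightarrow> x \<ominus>\<^bsub>M\<^esub> y \<in> N" if "x \<in> carrier M" "y \<in> carrier M" for x y
  proof
    assume "N +>\<^bsub>M\<^esub> x = N +>\<^bsub>M\<^esub> y"
    then have "x \<in> N +>\<^bsub>M\<^esub> y" using N.a_rcos_self[OF that(1)] by simp
    then obtain n where "n \<in> N" "x = n \<oplus>\<^bsub>M\<^esub> y" by (auto simp: a_r_coset_def r_coset_def)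
    then show "x \<ominus>\<^bsub>M\<^esub> y \<in> N" using S(1)[of n] that by (simp add: a_minus_def M.M.a_assoc M.M.r_neg)
  next
    assume n: "x \<ominus>\<^bsub>M\<^esub> y \<in> N"
    have "x = (x \<ominus>\<^bsub>M\<^esub> y) \<oplus>\<^bsub>M\<^esub> y" using that by (simp add: M.M.diff_add_cancel)
    then have "x \<in> N +>\<^bsub>M\<^esub> y" using n by (auto simp: a_r_coset_def r_coset_def)
    then show "N +>\<^bsub>M\<^esub> x = N +>\<^bsub>M\<^esub> y" using N.a_repr_independence' that by metis
  qed
  show "r \<odot>\<^bsub>quotient_module M N\<^esub> (N +>\<^bsub>M\<^esub> x) = N +>\<^bsub>M\<^esub> (r \<odot>\<^bsub>M\<^esub> x)"
    if r: "r \<in> carrier R" and x: "x \<in> carrier M" for r x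
  proof -
    have "N +>\<^bsub>M\<^esub> (r \<odot>\<^bsub>M\<^esub> y) = N +>\<^bsub>M\<^esub> (r \<odot>\<^bsub>M\<^esub> x)" if y: "y \<in> N +>\<^bsub>M\<^esub> x" for y
    proof -
      obtain n where n: "n \<in> N" "y = n \<oplus>\<^bsub>M\<^esub> x" using y by (auto simp: a_r_coset_def r_coset_def)
      have nM: "n \<in> carrier M" using n S(1) by blast
      have "r \<odot>\<^bsub>M\<^esub> y \<ominus>\<^bsub>M\<^esub> r \<odot>\<^bsub>M\<^esub> x = r \<odot>\<^bsub>M\<^esub> n"
        using n nM r x by (simp add: M.smult_r_distr a_minus_def M.M.a_assoc M.M.r_neg)
      then show ?thesis using eq[of "r \<odot>\<^bsub>M\<^esub> y" "r \<odot>\<^bsub>M\<^esub> x"] S(6)[OF n(1) r] n nM r x by simp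
    qed
    moreover have "x \<in> N +>\<^bsub>M\<^esub> x" using x N.a_rcos_self by simp
    ultimately have "(\<Union>y\<in>N +>\<^bsub>M\<^esub> x. N +>\<^bsub>M\<^esub> (r \<odot>\<^bsub>M\<^esub> y)) = N +>\<^bsub>M\<^esub> (r \<odot>\<^bsub>M\<^esub> x)" by blast
    then show ?thesis by (simp only: quotient_module_def module.select_convs)
  qed
qed

lemma submodule_minus:
  assumes "module R M" "submodule H R M" "x \<in> H" "y \<in> H"
  shows "x \<ominus>\<^bsub>M\<lparr>carrier := H\<rparr>\<^esub> y = x \<ominus>\<^bsub>M\<^esub> y"
proof -
  interpret M: module R M by fact
  interpret H: module R "M\<lparr>carrier := H\<rparr>" by (rule submodule.submodule_is_module) fact+
  note S = M.submodule_memD[OF assms(2)]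
  have "\<ominus>\<^bsub>M\<lparr>carrier := H\<rparr>\<^esub> y = \<ominus>\<^bsub>M\<^esub> y"
    using S(1,4) assms(4) by (intro H.M.minus_equality) (auto simp: M.M.l_neg)
  then show ?thesis by (simp add: a_minus_def)
qed

text \<open>A map on \<open>P\<close> that vanishes on the kernel of \<open>\<alpha>\<close> descends to the image of \<open>\<alpha>\<close> and extends from there
  to \<open>H\<close>.\<close>

lemma injective_factor:
  fixes P :: "('a, 'p) module" and H :: "('a, 'b) module" and E :: "('a, 'e) module"
  assumes E: "injective_module R E" and P: "module R P" and H: "module R H"
    and \<alpha>: "\<alpha> \<in> mod_hom R P H" and \<beta>: "\<beta> \<in> mod_hom R P E"
    and ker: "\<And>p. p \<in> carrier P \<Longrightarrow> \<alpha> p = \<zero>\<^bsub>H\<^esub> \<Longrightarrow> \<beta> p = \<zero>\<^bsub>E\<^esub>"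
  obtains f where "f \<in> carrier (hom_module R H E)" "\<And>p. p \<in> carrier P \<Longrightarrow> f (\<alpha> p) = \<beta> p"
proof -
  have EM: "module R E" using E by (simp add: injective_module_def)
  interpret P: module R P by fact
  interpret H: module R H by fact
  interpret E: module R E by fact
  define A where "A = \<alpha> ` carrier P"
  define \<phi> where "\<phi> a = \<beta> (SOME p. p \<in> carrier P \<and> \<alpha> p = a)" for a
  note \<alpha>D = mod_homD[OF \<alpha>] and \<beta>D = mod_homD[OF \<beta>]
  have phi: "\<phi> (\<alpha> p) = \<beta> p" if p: "p \<in> carrier P" for p
  proof -
    define q where "q = (SOME q. q \<in> carrier P \<and> \<alpha> q = \<alpha> p)"
    have q: "q \<in> carrier P \<and> \<alpha> q = \<alpha> p" unfolding q_def by (rule someI[of _ p]) (use p in simp)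
    then have "\<alpha> (q \<ominus>\<^bsub>P\<^esub> p) = \<zero>\<^bsub>H\<^esub>"
      using mod_hom_minus[OF P H \<alpha>, of q p] \<alpha>D(1) p by (simp add: H.M.diff_self)
    then have "\<beta> q \<ominus>\<^bsub>E\<^esub> \<beta> p = \<zero>\<^bsub>E\<^esub>"
      using ker[of "q \<ominus>\<^bsub>P\<^esub> p"] mod_hom_minus[OF P EM \<beta>, of q p] p q by simp
    then show ?thesis
      unfolding \<phi>_def q_def[symmetric] using \<beta>D(1) p q by (simp add: E.M.diff_zero_iff)
  qed
  have sub: "submodule A R H"
  proof (rule H.submoduleI)
    show "A \<subseteq> carrier H" using \<alpha>D(1) by (auto simp: A_def)
    show "\<zero>\<^bsub>H\<^esub> \<in> A" unfolding A_def using mod_hom_zero[OF P H \<alpha>] by (metis P.M.zero_closed imageI)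
  next
    fix a b assume "a \<in> A" "b \<in> A"
    then obtain p q where "p \<in> carrier P" "q \<in> carrier P" "a = \<alpha> p" "b = \<alpha> q" by (auto simp: A_def)
    then show "a \<oplus>\<^bsub>H\<^esub> b \<in> A" using \<alpha>D(2)[of p q] by (auto simp: A_def image_iff intro!: bexI[of _ "p \<oplus>\<^bsub>P\<^esub> q"])
  next
    fix a assume "a \<in> A"
    then obtain p where "p \<in> carrier P" "a = \<alpha> p" by (auto simp: A_def)
    then show "\<ominus>\<^bsub>H\<^esub> a \<in> A"
      using \<alpha>D(1)[of p] \<alpha>D(3)[of "\<ominus>\<^bsub>R\<^esub> \<one>\<^bsub>R\<^esub>" p] H.smult_l_minus[of "\<one>\<^bsub>R\<^esub>" a]
      by (auto simp: A_def image_iff intro!: bexI[of _ "\<ominus>\<^bsub>R\<^esub> \<one>\<^bsub>R\<^esub> \<odot>\<^bsub>P\<^esub> p"])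
  next
    fix r a assume r: "r \<in> carrier R" and "a \<in> A"
    then obtain p where "p \<in> carrier P" "a = \<alpha> p" by (auto simp: A_def)
    then show "r \<odot>\<^bsub>H\<^esub> a \<in> A"
      using \<alpha>D(3)[of r p] r by (auto simp: A_def image_iff intro!: bexI[of _ "r \<odot>\<^bsub>P\<^esub> p"])
  qed
  let ?A = "H\<lparr>carrier := A\<rparr>"
  have A: "module R ?A" using sub H by (rule submodule.submodule_is_module)
  have id: "(\<lambda>x. x) \<in> mod_hom R ?A H" using H.submodule_memD(1)[OF sub] by (auto simp: mod_hom_def)
  have "\<phi> \<in> mod_hom R ?A E"
    unfolding mod_hom_def
  proof (intro CollectI conjI ballI)
    show "\<phi> \<in> carrier ?A \<rightarrow> carrier E" using phi \<beta>D(1) by (auto simp: A_def)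
  next
    fix a b assume "a \<in> carrier ?A" "b \<in> carrier ?A"
    then obtain p q where pq: "p \<in> carrier P" "q \<in> carrier P" "a = \<alpha> p" "b = \<alpha> q" by (auto simp: A_def)
    then show "\<phi> (a \<oplus>\<^bsub>?A\<^esub> b) = \<phi> a \<oplus>\<^bsub>E\<^esub> \<phi> b"
      using phi[of "p \<oplus>\<^bsub>P\<^esub> q"] phi[of p] phi[of q] \<alpha>D(2)[of p q] \<beta>D(2)[of p q] by simp
  next
    fix r a assume r: "r \<in> carrier R" and "a \<in> carrier ?A"
    then obtain p where "p \<in> carrier P" "a = \<alpha> p" by (auto simp: A_def)
    then show "\<phi> (r \<odot>\<^bsub>?A\<^esub> a) = r \<odot>\<^bsub>E\<^esub> \<phi> a"
      using phi[of "r \<odot>\<^bsub>P\<^esub> p"] phi[of p] \<alpha>D(3)[of r p] \<beta>D(3)[of r p] r by simp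
  qed
  then obtain h where h: "h \<in> mod_hom R H E" "\<forall>a\<in>carrier ?A. h a = \<phi> a"
    using injective_module_lift[OF E A H id] by auto
  have "restrict h (carrier H) \<in> carrier (hom_module R H E)"
    using h(1) by (auto simp: hom_module_def mod_hom_def)
  moreover have "restrict h (carrier H) (\<alpha> p) = \<beta> p" if "p \<in> carrier P" for p
    using h(2) phi[OF that] \<alpha>D(1)[OF that] that by (simp add: A_def)
  ultimately show ?thesis using that by blast
qed

lemma hom_module_eval:
  assumes "f \<in> carrier (hom_module R M N)"
  shows "x \<in> carrier M \<Longrightarrow> f x \<in> carrier N"
    and "x \<in> carrier M \<Longrightarrow> y \<in> carrier M \<Longrightarrow> f (x \<oplus>\<^bsub>M\<^esub> y) = f x \<oplus>\<^bsub>N\<^esub> f y"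
    and "r \<in> carrier R \<Longrightarrow> x \<in> carrier M \<Longrightarrow> f (r \<odot>\<^bsub>M\<^esub> x) = r \<odot>\<^bsub>N\<^esub> f x"
  using assms by (auto simp: hom_module_def mod_hom_def)

lemma hom_module_ops:
  assumes "x \<in> carrier M"
  shows "(f \<oplus>\<^bsub>hom_module R M N\<^esub> g) x = f x \<oplus>\<^bsub>N\<^esub> g x"
    and "(r \<odot>\<^bsub>hom_module R M N\<^esub> f) x = r \<odot>\<^bsub>N\<^esub> f x"
    and "\<zero>\<^bsub>hom_module R M N\<^esub> x = \<zero>\<^bsub>N\<^esub>"
  using assms by (auto simp: hom_module_def)

lemma hom_module_minus:
  assumes M: "module R M" and N: "module R N" and x: "x \<in> carrier M"
    and f: "f \<in> carrier (hom_module R M N)" and g: "g \<in> carrier (hom_module R M N)"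
  shows "(f \<ominus>\<^bsub>hom_module R M N\<^esub> g) x = f x \<ominus>\<^bsub>N\<^esub> g x"
proof -
  interpret D: module R "hom_module R M N" by (rule module_hom_module[OF M N])
  interpret N: module R N by fact
  have "f \<ominus>\<^bsub>hom_module R M N\<^esub> g = f \<oplus>\<^bsub>hom_module R M N\<^esub> (\<ominus>\<^bsub>R\<^esub> \<one>\<^bsub>R\<^esub>) \<odot>\<^bsub>hom_module R M N\<^esub> g"
    using f g by (simp add: a_minus_def D.smult_l_minus)
  then show ?thesis using hom_module_eval(1)[OF g x] x
    by (simp add: hom_module_ops a_minus_def N.smult_l_minus)
qed

lemma lspan_hom_vanishes:
  assumes M: "module R M" and N: "module R N" and f: "f \<in> lspan R (hom_module R M N) ys"
    and ys: "set ys \<subseteq> carrier R" and u: "u \<in> carrier M" "\<And>y. y \<in> set ys \<Longrightarrow> y \<odot>\<^bsub>M\<^esub> u = \<zero>\<^bsub>M\<^esub>"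
  shows "f u = \<zero>\<^bsub>N\<^esub>"
  using f ys u(2)
proof (induction ys arbitrary: f)
  case Nil
  then show ?case using u(1) by (simp add: hom_module_ops)
next
  case (Cons y ys)
  interpret N: module R N by fact
  obtain g h where g: "g \<in> lspan R (hom_module R M N) ys" and h: "h \<in> carrier (hom_module R M N)"
    and f: "f = g \<oplus>\<^bsub>hom_module R M N\<^esub> y \<odot>\<^bsub>hom_module R M N\<^esub> h" using Cons.prems(1) by auto
  have yR: "y \<in> carrier R" using Cons.prems(2) by simp
  have hM: "h \<in> mod_hom R M N" using h by (simp add: hom_module_def)
  have "y \<odot>\<^bsub>N\<^esub> h u = h (y \<odot>\<^bsub>M\<^esub> u)" using mod_homD(3)[OF hM yR u(1)] by simp
  also have "\<dots> = \<zero>\<^bsub>N\<^esub>" using Cons.prems(3)[of y] mod_hom_zero[OF M N hM] by simp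
  finally show ?case using Cons.IH[OF g] Cons.prems f u(1) by (simp add: hom_module_ops)
qed

text \<open>This is \<open>Hom(H, E)/(y) Hom(H, E) \<cong> Hom(0 :\<^sub>H (y), E)\<close>, one generator at a time. On the submodule
  \<open>K\<close> killed by the other generators \<open>f\<close> factors through multiplication by \<open>y\<close>, hence agrees there with
  \<open>y h\<close> for some \<open>h\<close> defined on \<open>H\<close>; the difference \<open>f - y h\<close> vanishes on \<open>K\<close>.\<close>

lemma hom_in_lspan:
  fixes H :: "('a, 'b) module" and E :: "('a, 'e) module"
  assumes E: "injective_module R E" and H: "module R H" and "set ys \<subseteq> carrier R"
    and "f \<in> carrier (hom_module R H E)"
    and "\<And>u. u \<in> carrier H \<Longrightarrow> (\<And>y. y \<in> set ys \<Longrightarrow> y \<odot>\<^bsub>H\<^esub> u = \<zero>\<^bsub>H\<^esub>) \<Longrightarrow> f u = \<zero>\<^bsub>E\<^esub>"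
  shows "f \<in> lspan R (hom_module R H E) ys"
  using assms(3-)
proof (induction ys arbitrary: f)
  case Nil
  then have "f = \<zero>\<^bsub>hom_module R H E\<^esub>"
    by (auto simp: hom_module_def fun_eq_iff extensional_def)
  then show ?case by simp
next
  case (Cons y ys)
  have EM: "module R E" using E by (simp add: injective_module_def)
  interpret H: module R H by fact
  interpret E: module R E by fact
  interpret D: module R "hom_module R H E" by (rule module_hom_module[OF H EM])
  let ?D = "hom_module R H E"
  have yR: "y \<in> carrier R" and R: "set ys \<subseteq> carrier R" using Cons.prems(1) by auto
  note fD = hom_module_eval[OF Cons.prems(2)]
  define K where "K = {u \<in> carrier H. \<forall>a\<in>set ys. a \<odot>\<^bsub>H\<^esub> u = \<zero>\<^bsub>H\<^esub>}"
  have "submodule K R H"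
  proof (rule H.submoduleI)
    fix r u assume ru: "r \<in> carrier R" "u \<in> K"
    have "a \<odot>\<^bsub>H\<^esub> (r \<odot>\<^bsub>H\<^esub> u) = \<zero>\<^bsub>H\<^esub>" if "a \<in> set ys" for a
      using ru that R H.smult_lcomm[of a r u] by (auto simp: K_def)
    then show "r \<odot>\<^bsub>H\<^esub> u \<in> K" using ru by (simp add: K_def)
  qed (use R in \<open>auto simp: K_def H.smult_r_distr H.smult_r_minus subset_iff\<close>)
  then have K: "module R (H\<lparr>carrier := K\<rparr>)" using H by (rule submodule.submodule_is_module)
  have \<alpha>: "(\<lambda>u. y \<odot>\<^bsub>H\<^esub> u) \<in> mod_hom R (H\<lparr>carrier := K\<rparr>) H"
    using yR by (auto simp: mod_hom_def K_def H.smult_r_distr H.smult_lcomm)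
  have \<beta>: "f \<in> mod_hom R (H\<lparr>carrier := K\<rparr>) E"
    using fD by (auto simp: mod_hom_def K_def)
  obtain h where h: "h \<in> carrier ?D" "\<And>u. u \<in> K \<Longrightarrow> h (y \<odot>\<^bsub>H\<^esub> u) = f u"
  proof (rule injective_factor[OF E K H \<alpha> \<beta>])
    fix u assume "u \<in> carrier (H\<lparr>carrier := K\<rparr>)" "y \<odot>\<^bsub>H\<^esub> u = \<zero>\<^bsub>H\<^esub>"
    then show "f u = \<zero>\<^bsub>E\<^esub>" using Cons.prems(3)[of u] by (auto simp: K_def)
  qed auto
  define g where "g = f \<ominus>\<^bsub>?D\<^esub> y \<odot>\<^bsub>?D\<^esub> h"
  have yh: "y \<odot>\<^bsub>?D\<^esub> h \<in> carrier ?D" using yR h by simp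
  have "g \<in> lspan R ?D ys"
  proof (rule Cons.IH[OF R])
    show "g \<in> carrier ?D" unfolding g_def using Cons.prems(2) yh by simp
    fix u assume u: "u \<in> carrier H" "\<And>a. a \<in> set ys \<Longrightarrow> a \<odot>\<^bsub>H\<^esub> u = \<zero>\<^bsub>H\<^esub>"
    then have "u \<in> K" by (simp add: K_def)
    then have "h (y \<odot>\<^bsub>H\<^esub> u) = f u" by (rule h(2))
    then have "y \<odot>\<^bsub>E\<^esub> h u = f u" using hom_module_eval(3)[OF h(1) yR u(1)] by simp
    then show "g u = \<zero>\<^bsub>E\<^esub>" unfolding g_def
      using hom_module_minus[OF H EM u(1) Cons.prems(2) yh] u(1) fD(1)[OF u(1)]
      by (simp add: hom_module_ops E.M.diff_self)
  qed
  moreover have "f = g \<oplus>\<^bsub>?D\<^esub> y \<odot>\<^bsub>?D\<^esub> h"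
    unfolding g_def using Cons.prems(2) yh by (simp add: D.M.diff_add_cancel)
  ultimately show ?case using h(1) by auto
qed

section \<open>The injective hull of the residue field is torsion\<close>

lemma ring_module_simps:
  "carrier (ring_module R) = carrier R" "\<zero>\<^bsub>ring_module R\<^esub> = \<zero>\<^bsub>R\<^esub>"
  "a \<oplus>\<^bsub>ring_module R\<^esub> b = a \<oplus>\<^bsub>R\<^esub> b" "a \<odot>\<^bsub>ring_module R\<^esub> b = a \<otimes>\<^bsub>R\<^esub> b"
  by (simp_all add: ring_module_def)

lemma ideal_submodule_ring_module:
  assumes "cring R" "ideal A R" shows "submodule A R (ring_module R)"
proof -
  interpret cring R by fact
  interpret RM: module R "ring_module R" by (rule module_ring_module[OF assms(1)])
  note A = ideal_memD[OF assms(2)]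
  show ?thesis
  proof (rule RM.submoduleI)
    fix a assume a: "a \<in> A"
    have "\<ominus>\<^bsub>R\<^esub> \<one>\<^bsub>R\<^esub> \<otimes>\<^bsub>R\<^esub> a \<in> A" using a by (intro A(5)) auto
    moreover have "\<ominus>\<^bsub>ring_module R\<^esub> a = \<ominus>\<^bsub>R\<^esub> a"
      using A(1)[OF a] by (intro RM.M.minus_equality) (auto simp: ring_module_def l_neg)
    ultimately show "\<ominus>\<^bsub>ring_module R\<^esub> a \<in> A" using A(1)[OF a] by (simp add: l_minus)
  qed (use A in \<open>auto simp: ring_module_def\<close>)
qed

text \<open>If \<open>N\<close> is such that \<open>x\<^sup>N y\<close> and \<open>x\<^bsup>N+1\<^esup> y\<close> have the same annihilator, then \<open>x\<close> acts injectively
  on \<open>R x\<^sup>N y\<close>. A nonzero such submodule would meet the residue field, on which \<open>x\<close> acts as zero.\<close>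

lemma (in noetherian_local) injective_hull_torsion:
  fixes E :: "('a, 'e) module"
  assumes hull: "injective_hull R (residue_module R \<mm>) E"
    and x: "x \<in> \<mm>" and y: "y \<in> carrier E"
  shows "\<exists>n::nat. x [^] n \<odot>\<^bsub>E\<^esub> y = \<zero>\<^bsub>E\<^esub>"
proof -
  have E: "module R E" using hull by (simp add: injective_hull_def injective_module_def)
  interpret E: module R E by fact
  have xR: "x \<in> carrier R" using x ideal_memD(1)[OF max_ideal] by blast
  let ?k = "residue_module R \<mm>" and ?R = "ring_module R"
  have RM: "module R ?R" by (rule module_ring_module[OF is_cring])
  have sub: "submodule \<mm> R ?R" by (rule ideal_submodule_ring_module[OF is_cring max_ideal])
  have km: "module R ?k" unfolding residue_module_def by (rule module_quotient_module[OF RM sub])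
  obtain e where e: "e \<in> mod_hom R ?k E"
    and ess: "\<And>H. submodule H R E \<Longrightarrow> H \<noteq> {\<zero>\<^bsub>E\<^esub>} \<Longrightarrow> H \<inter> e ` carrier ?k \<noteq> {\<zero>\<^bsub>E\<^esub>}"
    using hull unfolding injective_hull_def by blast
  have kill: "x \<odot>\<^bsub>?k\<^esub> c = \<zero>\<^bsub>?k\<^esub>" if ck: "c \<in> carrier ?k" for c
  proof -
    obtain r where r: "r \<in> carrier R" "c = \<mm> +>\<^bsub>?R\<^esub> r"
      using ck quotient_module_carrier[OF RM sub] by (auto simp: residue_module_def ring_module_simps)
    have "x \<odot>\<^bsub>?k\<^esub> c = \<mm> +>\<^bsub>?R\<^esub> (x \<otimes> r)"
      using quotient_module_smult[OF RM sub xR, of r] r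
      by (simp add: residue_module_def ring_module_simps)
    moreover have "\<mm> +>\<^bsub>?R\<^esub> (x \<otimes> r) = \<mm> +>\<^bsub>?R\<^esub> \<zero>\<^bsub>?R\<^esub>"
    proof -
      interpret RM: module R ?R by (rule RM)
      have c: "x \<otimes> r \<in> carrier ?R" using xR r by (simp add: ring_module_simps)
      have "x \<otimes> r \<in> \<mm>" using x r ideal_memD(6)[OF max_ideal] by simp
      then show ?thesis
        using quotient_module_eq_iff[OF RM sub c, of "\<zero>\<^bsub>?R\<^esub>"] c RM.M.diff_zero[OF c] by simp
    qed
    ultimately show ?thesis using quotient_module_zero[OF RM sub] by (simp add: residue_module_def)
  qed
  define C where "C n = {r \<in> carrier R. r \<odot>\<^bsub>E\<^esub> (x [^] n \<odot>\<^bsub>E\<^esub> y) = \<zero>\<^bsub>E\<^esub>}" for n :: nat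
  have "ideal (C n) R" for n unfolding C_def using xR y by (intro E.annihilator_ideal) auto
  moreover have step: "r \<odot>\<^bsub>E\<^esub> (x [^] Suc n \<odot>\<^bsub>E\<^esub> y) = x \<odot>\<^bsub>E\<^esub> (r \<odot>\<^bsub>E\<^esub> (x [^] n \<odot>\<^bsub>E\<^esub> y))"
    if "r \<in> carrier R" for r n
    using that xR y by (simp add: m_ac flip: E.smult_assoc1)
  then have "C n \<subseteq> C (Suc n)" for n using xR by (auto simp: C_def simp del: nat_pow_Suc)
  ultimately obtain N where N: "\<And>n. C (N + n) = C N" using ascending_ideals_stabilise[of C] by blast
  define u where "u = x [^] N \<odot>\<^bsub>E\<^esub> y"
  have uE: "u \<in> carrier E" using xR y by (simp add: u_def)
  have "u = \<zero>\<^bsub>E\<^esub>"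
  proof (rule ccontr)
    assume nz: "u \<noteq> \<zero>\<^bsub>E\<^esub>"
    define H where "H = {r \<odot>\<^bsub>E\<^esub> u |r. r \<in> carrier R}"
    have HI: "r \<odot>\<^bsub>E\<^esub> u \<in> H" if "r \<in> carrier R" for r using that by (auto simp: H_def)
    have "submodule H R E"
    proof (rule E.submoduleI)
      show "H \<subseteq> carrier E" using uE by (auto simp: H_def)
      show "\<zero>\<^bsub>E\<^esub> \<in> H" using HI[of \<zero>] uE by simp
      show "\<ominus>\<^bsub>E\<^esub> a \<in> H" if "a \<in> H" for a
        using that uE by (auto simp: H_def E.smult_l_minus[symmetric])
      show "a \<oplus>\<^bsub>E\<^esub> b \<in> H" if "a \<in> H" "b \<in> H" for a b
        using that uE by (auto simp: H_def E.smult_l_distr[symmetric])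
      show "r \<odot>\<^bsub>E\<^esub> a \<in> H" if "r \<in> carrier R" "a \<in> H" for r a
        using that uE by (auto simp: H_def E.smult_assoc1[symmetric])
    qed
    moreover have "u \<in> H" using HI[OF one_closed] uE by simp
    ultimately have "H \<inter> e ` carrier ?k \<noteq> {\<zero>\<^bsub>E\<^esub>}" using ess nz by blast
    moreover have "\<zero>\<^bsub>E\<^esub> \<in> H \<inter> e ` carrier ?k"
    proof -
      interpret k: module R ?k by fact
      have "e \<zero>\<^bsub>?k\<^esub> = \<zero>\<^bsub>E\<^esub>" by (rule mod_hom_zero[OF km E e])
      then show ?thesis using HI[of \<zero>] uE k.M.zero_closed by (metis E.smult_l_null IntI image_eqI zero_closed)
    qed
    ultimately obtain v where v: "v \<in> H" "v \<in> e ` carrier ?k" "v \<noteq> \<zero>\<^bsub>E\<^esub>" by blast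
    obtain s where s: "s \<in> carrier R" "v = s \<odot>\<^bsub>E\<^esub> u" using v(1) by (auto simp: H_def)
    obtain c where c: "c \<in> carrier ?k" "v = e c" using v(2) by auto
    have "x \<odot>\<^bsub>E\<^esub> v = \<zero>\<^bsub>E\<^esub>"
      using mod_homD(3)[OF e xR c(1)] kill[OF c(1)] mod_hom_zero[OF km E e] c(2) by simp
    then have "s \<in> C (N + 1)" using s step[OF s(1), of N] by (simp add: C_def u_def del: nat_pow_Suc)
    then have "s \<in> C N" using N[of 1] by simp
    then show False using v(3) s by (simp add: C_def u_def)
  qed
  then show ?thesis by (auto simp: u_def)
qed

section \<open>Local cohomology modules as quotients\<close>

context injective_res
begin

abbreviation cocycles :: "'a list \<Rightarrow> 'j set" where
  "cocycles xs \<equiv> {z \<in> T (set xs) (length xs). d (length xs) z = \<zero>\<^bsub>J (Suc (length xs))\<^esub>}"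

abbreviation H :: "'a list \<Rightarrow> ('a, 'j set) module" where
  "H xs \<equiv> local_cohomology R (Idl (set xs)) (length xs) J d"

definition cls :: "'a list \<Rightarrow> 'j \<Rightarrow> 'j set" where
  "cls xs z = boundary xs +>\<^bsub>J (length xs)\<^esub> z"

lemma cocycles_submodule:
  assumes "set xs \<subseteq> carrier R" shows "submodule (cocycles xs) R (J (length xs))"
proof (rule J.submoduleI)
  let ?p = "length xs"
  note S = T_sub[OF assms]
  show "cocycles xs \<subseteq> carrier (J ?p)" using T_closed by auto
  show "\<zero>\<^bsub>J ?p\<^esub> \<in> cocycles xs" using S(2) d_zero[of ?p] by simp
  show add: "a \<oplus>\<^bsub>J ?p\<^esub> b \<in> cocycles xs" if "a \<in> cocycles xs" "b \<in> cocycles xs" for a b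
    using that S(3) T_closed[of a "set xs" ?p] T_closed[of b "set xs" ?p] by (simp add: d_add)
  show smult: "r \<odot>\<^bsub>J ?p\<^esub> a \<in> cocycles xs" if "r \<in> carrier R" "a \<in> cocycles xs" for r a
    using that S(6) T_closed[of a "set xs" ?p] by (simp add: d_smult)
  show "\<ominus>\<^bsub>J ?p\<^esub> a \<in> cocycles xs" if "a \<in> cocycles xs" for a
    using smult[of "\<ominus> \<one>" a] that T_closed[of a "set xs" ?p] by (simp add: J.smult_l_minus)
qed

lemma boundary_submodule:
  assumes S: "set xs \<subseteq> carrier R"
  shows "submodule (boundary xs) R ((J (length xs))\<lparr>carrier := cocycles xs\<rparr>)"
proof -
  let ?p = "length xs"
  interpret K: module R "(J ?p)\<lparr>carrier := cocycles xs\<rparr>"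
    by (rule submodule.submodule_is_module[OF cocycles_submodule[OF S] J.module_axioms])
  have sub: "boundary xs \<subseteq> cocycles xs" using boundary_cocycle[OF S] by blast
  have add: "a \<oplus>\<^bsub>J ?p\<^esub> b \<in> boundary xs" if "a \<in> boundary xs" "b \<in> boundary xs" for a b
  proof (cases xs)
    case Nil
    then show ?thesis using that by (simp add: boundary_Nil)
  next
    case (Cons y ys)
    then obtain v w where "v \<in> T (set xs) (length ys)" "w \<in> T (set xs) (length ys)"
      "a = d (length ys) v" "b = d (length ys) w" using \<open>a \<in> _\<close> \<open>b \<in> _\<close> by (auto simp: boundary_Cons)
    then show ?thesis using T_sub(3)[OF S, of v "length ys" w] d_add[of v "length ys" w] T_closed Cons
      by (auto simp: boundary_Cons image_iff intro!: bexI[of _ "v \<oplus>\<^bsub>J (length ys)\<^esub> w"])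
  qed
  have smult: "r \<odot>\<^bsub>J ?p\<^esub> a \<in> boundary xs" if r: "r \<in> carrier R" and a: "a \<in> boundary xs" for r a
  proof (cases xs)
    case Nil
    then show ?thesis using r a by (simp add: boundary_Nil)
  next
    case (Cons y ys)
    then obtain v where "v \<in> T (set xs) (length ys)" "a = d (length ys) v"
      using a by (auto simp: boundary_Cons)
    then show ?thesis using T_sub(6)[OF S, of v "length ys" r] d_smult[of r v "length ys"] T_closed r Cons
      by (auto simp: boundary_Cons image_iff intro!: bexI[of _ "r \<odot>\<^bsub>J (length ys)\<^esub> v"])
  qed
  show ?thesis
  proof (rule K.submoduleI)
    fix a assume a: "a \<in> boundary xs"
    then have "a \<in> cocycles xs" using sub by blast
    moreover from this have "a \<in> carrier (J ?p)" using T_closed by blast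
    ultimately have "\<ominus>\<^bsub>(J ?p)\<lparr>carrier := cocycles xs\<rparr>\<^esub> a = \<ominus> \<one> \<odot>\<^bsub>J ?p\<^esub> a"
      using K.smult_l_minus[of \<one> a] by simp
    then show "\<ominus>\<^bsub>(J ?p)\<lparr>carrier := cocycles xs\<rparr>\<^esub> a \<in> boundary xs" using smult[OF _ a] by simp
  qed (use sub add smult zero_boundary[OF S] in auto)
qed

lemma local_cohomology_eq:
  assumes S: "set xs \<subseteq> carrier R"
  shows "H xs = quotient_module ((J (length xs))\<lparr>carrier := cocycles xs\<rparr>) (boundary xs)"
  using torsion_part_eq_torsion_on[OF J.module_axioms S]
  by (cases xs) (simp_all add: local_cohomology_def boundary_Nil boundary_Cons)

lemma local_cohomology_facts:
  assumes S: "set xs \<subseteq> carrier R"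
  shows H_module: "module R (H xs)"
    and H_carrier: "carrier (H xs) = cls xs ` cocycles xs"
    and H_add: "z \<in> cocycles xs \<Longrightarrow> z' \<in> cocycles xs \<Longrightarrow>
      cls xs z \<oplus>\<^bsub>H xs\<^esub> cls xs z' = cls xs (z \<oplus>\<^bsub>J (length xs)\<^esub> z')"
    and H_smult: "r \<in> carrier R \<Longrightarrow> z \<in> cocycles xs \<Longrightarrow>
      r \<odot>\<^bsub>H xs\<^esub> cls xs z = cls xs (r \<odot>\<^bsub>J (length xs)\<^esub> z)"
    and H_zero_iff: "z \<in> cocycles xs \<Longrightarrow> cls xs z = \<zero>\<^bsub>H xs\<^esub> \<longleftrightarrow> z \<in> boundary xs"
    and H_eq_iff: "z \<in> cocycles xs \<Longrightarrow> z' \<in> cocycles xs \<Longrightarrow>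
      cls xs z = cls xs z' \<longleftrightarrow> z \<ominus>\<^bsub>J (length xs)\<^esub> z' \<in> boundary xs"
proof -
  let ?p = "length xs" let ?K = "(J ?p)\<lparr>carrier := cocycles xs\<rparr>"
  have K: "module R ?K"
    by (rule submodule.submodule_is_module[OF cocycles_submodule[OF S] J.module_axioms])
  note B = boundary_submodule[OF S]
  note Heq = local_cohomology_eq[OF S]
  have cls: "boundary xs +>\<^bsub>?K\<^esub> z = cls xs z" for z
    by (simp add: cls_def a_r_coset_def r_coset_def)
  show "module R (H xs)" unfolding Heq by (rule module_quotient_module[OF K B])
  show "carrier (H xs) = cls xs ` cocycles xs"
    unfolding Heq using quotient_module_carrier[OF K B] by (simp add: cls)
  show "cls xs z \<oplus>\<^bsub>H xs\<^esub> cls xs z' = cls xs (z \<oplus>\<^bsub>J ?p\<^esub> z')"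
    if "z \<in> cocycles xs" "z' \<in> cocycles xs" for z z'
    unfolding Heq using quotient_module_add[OF K B, of z z'] that by (simp add: cls)
  show "r \<odot>\<^bsub>H xs\<^esub> cls xs z = cls xs (r \<odot>\<^bsub>J ?p\<^esub> z)" if "r \<in> carrier R" "z \<in> cocycles xs" for r z
    unfolding Heq using quotient_module_smult[OF K B, of r z] that by (simp add: cls)
  show eq: "cls xs z = cls xs z' \<longleftrightarrow> z \<ominus>\<^bsub>J ?p\<^esub> z' \<in> boundary xs"
    if "z \<in> cocycles xs" "z' \<in> cocycles xs" for z z'
    using quotient_module_eq_iff[OF K B, of z z'] that
      submodule_minus[OF J.module_axioms cocycles_submodule[OF S] that] by (simp add: cls)
  show "cls xs z = \<zero>\<^bsub>H xs\<^esub> \<longleftrightarrow> z \<in> boundary xs" if z: "z \<in> cocycles xs" for z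
  proof -
    have "\<zero>\<^bsub>J ?p\<^esub> \<in> cocycles xs" using J.submodule_memD(2)[OF cocycles_submodule[OF S]] .
    moreover have "\<zero>\<^bsub>H xs\<^esub> = cls xs \<zero>\<^bsub>J ?p\<^esub>"
      unfolding Heq using quotient_module_zero[OF K B] by (simp add: cls)
    ultimately show ?thesis using eq[OF z] z T_closed[of z "set xs" ?p] by (simp add: J.M.diff_zero)
  qed
qed

lemma rep_in_cocycles: "set xs \<subseteq> carrier R \<Longrightarrow> rep xs n m z \<Longrightarrow> z \<in> cocycles xs"
  using rep_cocycle by blast

lemma rep_unique:
  assumes S: "set xs \<subseteq> carrier R" and r: "rep xs n m z" "rep xs n m z'"
  shows "cls xs z = cls xs z'"
proof -
  have m: "m \<in> carrier M" using rep_cocycle(1)[OF S r(1)] .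
  have "rep xs n \<zero>\<^bsub>M\<^esub> (z \<ominus>\<^bsub>J (length xs)\<^esub> z')"
    using rep_diff[OF S r] m by (simp add: M.diff_self)
  moreover have "set (powers R n xs) \<subseteq> carrier R" using S by auto
  then have "\<zero>\<^bsub>M\<^esub> \<in> lspan R M (powers R n xs)"
    using submodule_memD(2)[OF lspan_submodule[OF module_axioms]] by blast
  ultimately have "z \<ominus>\<^bsub>J (length xs)\<^esub> z' \<in> boundary xs"
    using rep_boundary_iff[OF S] by (metis M.zero_closed add_0_right nat_pow_0 smult_one)
  then show ?thesis using H_eq_iff[OF S] rep_in_cocycles[OF S] r by blast
qed

end

lemma injective_resolutionE:
  assumes "noetherian_ring R" "injective_resolution R M J d"
  obtains e where "injective_res R M J d e"
proof -
  have "module R M" using assms(2) by (simp add: injective_resolution_def)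
  moreover obtain e where "e \<in> mod_hom R M (J 0)" "inj_on e (carrier M)"
    "e ` carrier M = {x \<in> carrier (J 0). d 0 x = \<zero>\<^bsub>J 1\<^esub>}"
    using assms(2) unfolding injective_resolution_def by blast
  ultimately have "injective_res R M J d e"
    using assms unfolding injective_res_def injective_res_axioms_def injective_resolution_def by auto
  then show ?thesis by (rule that)
qed

section \<open>Duality for the local cohomology of the ring\<close>

text \<open>The classes of \<open>1\<close> at the levels of the direct system generate \<open>H\<^sup>i\<^sub>I(R)\<close>; their annihilators are as
  small as possible because the transition maps are injective.\<close>

lemma (in noetherian_local) local_cohomology_generators:
  fixes J :: "nat \<Rightarrow> ('a, 'j) module"
  assumes res: "injective_res R (ring_module R) J d e"
    and xs: "set xs \<subseteq> \<mm>" and reg: "weakly_regular R {\<zero>} xs"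
  defines "H \<equiv> local_cohomology R (Idl (set xs)) (length xs) J d"
  obtains h where "\<And>n. h n \<in> carrier H"
    and "\<And>n. list_prod R xs \<odot>\<^bsub>H\<^esub> h (Suc n) = h n"
    and "\<And>u. u \<in> carrier H \<Longrightarrow> \<exists>n. \<exists>r\<in>carrier R. u = r \<odot>\<^bsub>H\<^esub> h n"
    and "\<And>n r. r \<in> carrier R \<Longrightarrow> r \<odot>\<^bsub>H\<^esub> h n = \<zero>\<^bsub>H\<^esub> \<longleftrightarrow> r \<in> adjoin R {\<zero>} (powers R n xs)"
proof -
  interpret res: injective_res R "ring_module R" J d e by fact
  have S: "set xs \<subseteq> carrier R" using xs ideal_memD(1)[OF max_ideal] by blast
  note F = res.local_cohomology_facts[OF S, folded H_def]
  have "\<exists>z. res.rep xs n \<one> z" for n using res.rep_total[OF S, of \<one>] by (simp add: ring_module_simps)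
  then obtain z where z: "\<And>n. res.rep xs n \<one> (z n)" by metis
  note zc = res.rep_in_cocycles[OF S z]
  have r_rep: "res.rep xs n r (r \<odot>\<^bsub>J (length xs)\<^esub> z n)" if "r \<in> carrier R" for n r
    using res.rep_smult[OF S z[of n] that] that by (simp add: ring_module_simps)
  have smult: "r \<odot>\<^bsub>H\<^esub> res.cls xs (z n) = res.cls xs (r \<odot>\<^bsub>J (length xs)\<^esub> z n)" if "r \<in> carrier R" for r n
    by (rule F(4)[OF that zc])
  show ?thesis
  proof
    fix n
    show "res.cls xs (z n) \<in> carrier H" using F(2) zc by blast
    have "list_prod R xs \<in> carrier R" using S by simp
    moreover have "res.rep xs (Suc n) (list_prod R xs) (z n)"
      using res.rep_Suc[OF S z[of n]] S by (simp add: ring_module_simps)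
    ultimately show "list_prod R xs \<odot>\<^bsub>H\<^esub> res.cls xs (z (Suc n)) = res.cls xs (z n)"
      using res.rep_unique[OF S r_rep] smult by auto
  next
    fix u assume "u \<in> carrier H"
    then obtain y where y: "y \<in> res.cocycles xs" "u = res.cls xs y" using F(2) by auto
    then obtain n r where r: "res.rep xs n r y" using res.rep_surj[OF S] by blast
    have rR: "r \<in> carrier R" using res.rep_cocycle(1)[OF S r] by (simp add: ring_module_simps)
    have "u = r \<odot>\<^bsub>H\<^esub> res.cls xs (z n)"
      using res.rep_unique[OF S r r_rep[OF rR]] smult[OF rR] y(2) by simp
    then show "\<exists>n. \<exists>r\<in>carrier R. u = r \<odot>\<^bsub>H\<^esub> res.cls xs (z n)" using rR by blast
  next
    fix n r assume r: "r \<in> carrier R"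
    have "r \<odot>\<^bsub>H\<^esub> res.cls xs (z n) = \<zero>\<^bsub>H\<^esub> \<longleftrightarrow> r \<odot>\<^bsub>J (length xs)\<^esub> z n \<in> res.boundary xs"
      unfolding smult[OF r] by (rule F(5)[OF res.rep_in_cocycles[OF S r_rep[OF r]]])
    also have "\<dots> \<longleftrightarrow> (\<exists>k. list_prod R xs [^] k \<otimes> r \<in> adjoin R {\<zero>} (powers R (n + k) xs))"
      using res.rep_boundary_iff[OF S r_rep[OF r]] by (simp add: lspan_ring_module ring_module_simps)
    also have "\<dots> \<longleftrightarrow> r \<in> adjoin R {\<zero>} (powers R n xs)"
    proof
      assume "\<exists>k. list_prod R xs [^] k \<otimes> r \<in> adjoin R {\<zero>} (powers R (n + k) xs)"
      then show "r \<in> adjoin R {\<zero>} (powers R n xs)"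
        using cancel_list_prod_power[OF zeroideal xs reg r] by blast
    next
      assume "r \<in> adjoin R {\<zero>} (powers R n xs)"
      then show "\<exists>k. list_prod R xs [^] k \<otimes> r \<in> adjoin R {\<zero>} (powers R (n + k) xs)"
        using r by (intro exI[of _ 0]) simp
    qed
    finally show "r \<odot>\<^bsub>H\<^esub> res.cls xs (z n) = \<zero>\<^bsub>H\<^esub> \<longleftrightarrow> r \<in> adjoin R {\<zero>} (powers R n xs)" .
  qed
qed

text \<open>The structure of \<open>H\<^sup>i\<^sub>I(R)\<close> as the union of the modules \<open>R h n \<cong> R/(x\<^sup>n)\<close>, which is all that the
  duality argument uses about it.\<close>

locale cech_generators = noetherian_local R \<mm> + H: module R H
  for R :: "('a, 'm) ring_scheme" (structure) and \<mm> and H :: "('a, 'h) module" +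
  fixes xs :: "'a list" and h :: "nat \<Rightarrow> 'h"
  assumes xs_max: "set xs \<subseteq> \<mm>"
    and regular: "weakly_regular R {\<zero>} xs"
    and h_closed [simp]: "h n \<in> carrier H"
    and h_Suc: "list_prod R xs \<odot>\<^bsub>H\<^esub> h (Suc n) = h n"
    and h_generate: "u \<in> carrier H \<Longrightarrow> \<exists>n. \<exists>r\<in>carrier R. u = r \<odot>\<^bsub>H\<^esub> h n"
    and h_annihilator: "r \<in> carrier R \<Longrightarrow>
      r \<odot>\<^bsub>H\<^esub> h n = \<zero>\<^bsub>H\<^esub> \<longleftrightarrow> r \<in> adjoin R {\<zero>} (powers R n xs)"
begin

lemma xs_carrier: "set xs \<subseteq> carrier R"
  using xs_max ideal_memD(1)[OF max_ideal] by blast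

lemma list_prod_xs [simp]: "list_prod R xs \<in> carrier R"
  using xs_carrier by simp

lemma powers_carrier: "set (powers R n xs) \<subseteq> carrier R"
  using xs_carrier by auto

lemma h_raise: "list_prod R xs [^] k \<odot>\<^bsub>H\<^esub> h (n + k) = h n"
proof (induction k)
  case (Suc k)
  have "list_prod R xs [^] Suc k \<odot>\<^bsub>H\<^esub> h (n + Suc k) =
      list_prod R xs [^] k \<odot>\<^bsub>H\<^esub> (list_prod R xs \<odot>\<^bsub>H\<^esub> h (Suc (n + k)))"
    by (simp add: H.smult_assoc1)
  then show ?case using Suc by (simp add: h_Suc)
qed simp

lemma powers_kill_h:
  assumes "y \<in> set (powers R n xs)" shows "y \<odot>\<^bsub>H\<^esub> h n = \<zero>\<^bsub>H\<^esub>"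
  using assms powers_carrier adjoin_member[OF zeroideal powers_carrier assms] h_annihilator by blast

text \<open>Given \<open>u = r h (n + m)\<close>, the element \<open>r\<close> lies in \<open>(x\<^bsup>n+m\<^esup>) : (x\<^sup>n)\<close>, and the colon formula writes
  it as a multiple of the \<open>m\<close>-th power of the product, up to the annihilator.\<close>

lemma killed_by_powers:
  assumes u: "u \<in> carrier H" and kill: "\<And>y. y \<in> set (powers R n xs) \<Longrightarrow> y \<odot>\<^bsub>H\<^esub> u = \<zero>\<^bsub>H\<^esub>"
  shows "\<exists>s\<in>carrier R. u = s \<odot>\<^bsub>H\<^esub> h n"
proof -
  let ?\<pi> = "list_prod R xs"
  obtain m r' where r': "r' \<in> carrier R" "u = r' \<odot>\<^bsub>H\<^esub> h m" using h_generate[OF u] by blast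
  \<comment> \<open>Raising the level by \<open>n\<close> makes it at least \<open>n\<close>, as the colon formula requires.\<close>
  define r where "r = r' \<otimes> ?\<pi> [^] n"
  have rR: "r \<in> carrier R" using r' by (simp add: r_def)
  have ur: "u = r \<odot>\<^bsub>H\<^esub> h (n + m)"
    using r' h_raise[of n m] by (simp add: r_def H.smult_assoc1 add.commute)
  have "x [^] n \<otimes> r \<in> adjoin R {\<zero>} (powers R (n + m) xs)" if "x \<in> set xs" for x
  proof -
    have x: "x [^] n \<in> carrier R" using that xs_carrier by auto
    have "(x [^] n \<otimes> r) \<odot>\<^bsub>H\<^esub> h (n + m) = \<zero>\<^bsub>H\<^esub>"
      using kill[of "x [^] n"] that x rR by (simp add: H.smult_assoc1 flip: ur)
    then show ?thesis using h_annihilator x rR by simp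
  qed
  from colon_of_powers[OF zeroideal xs_max regular rR this]
  obtain s where s: "s \<in> carrier R" "r \<ominus> ?\<pi> [^] m \<otimes> s \<in> adjoin R {\<zero>} (powers R (n + m) xs)" by blast
  have "(r \<ominus> ?\<pi> [^] m \<otimes> s) \<odot>\<^bsub>H\<^esub> h (n + m) = \<zero>\<^bsub>H\<^esub>" using s rR h_annihilator by simp
  then have "u \<ominus>\<^bsub>H\<^esub> (?\<pi> [^] m \<otimes> s) \<odot>\<^bsub>H\<^esub> h (n + m) = \<zero>\<^bsub>H\<^esub>"
    using rR s(1) by (simp add: H.smult_left_minus ur)
  then have "u = (?\<pi> [^] m \<otimes> s) \<odot>\<^bsub>H\<^esub> h (n + m)" using u s(1) by (simp add: H.M.diff_zero_iff)
  also have "\<dots> = s \<odot>\<^bsub>H\<^esub> (?\<pi> [^] m \<odot>\<^bsub>H\<^esub> h (n + m))"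
    using s(1) by (simp add: H.smult_assoc1 H.smult_lcomm)
  also have "\<dots> = s \<odot>\<^bsub>H\<^esub> h n" using h_raise by simp
  finally show ?thesis using s(1) by blast
qed

text \<open>Evaluation at \<open>h n\<close> maps onto the elements of \<open>E\<close> killed by \<open>(x\<^sup>n)\<close>, since this ideal is the
  annihilator of \<open>h n\<close>.\<close>

lemma functional_with_value:
  fixes E :: "('a, 'e) module"
  assumes E: "injective_module R E" and v: "v \<in> carrier E"
    and kill: "\<And>x. x \<in> set xs \<Longrightarrow> x [^] n \<odot>\<^bsub>E\<^esub> v = \<zero>\<^bsub>E\<^esub>"
  shows "\<exists>f\<in>carrier (hom_module R H E). f (h n) = v"
proof -
  have EM: "module R E" using E by (simp add: injective_module_def)
  interpret E: module R E by fact
  have RM: "module R (ring_module R)" by (rule module_ring_module[OF is_cring])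
  have \<alpha>: "(\<lambda>r. r \<odot>\<^bsub>H\<^esub> h n) \<in> mod_hom R (ring_module R) H"
    by (auto simp: mod_hom_def ring_module_simps H.smult_l_distr H.smult_assoc1)
  have \<beta>: "(\<lambda>r. r \<odot>\<^bsub>E\<^esub> v) \<in> mod_hom R (ring_module R) E"
    using v by (auto simp: mod_hom_def ring_module_simps E.smult_l_distr E.smult_assoc1)
  have sub: "adjoin R {\<zero>} (powers R n xs) \<subseteq> {a \<in> carrier R. a \<odot>\<^bsub>E\<^esub> v = \<zero>\<^bsub>E\<^esub>}"
    using kill v powers_carrier xs_carrier
    by (intro adjoin_minimal zeroideal E.annihilator_ideal) auto
  obtain f where "f \<in> carrier (hom_module R H E)"
    "\<And>r. r \<in> carrier (ring_module R) \<Longrightarrow> f (r \<odot>\<^bsub>H\<^esub> h n) = r \<odot>\<^bsub>E\<^esub> v"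
  proof (rule injective_factor[OF E RM H.module_axioms \<alpha> \<beta>])
    fix r assume "r \<in> carrier (ring_module R)" "r \<odot>\<^bsub>H\<^esub> h n = \<zero>\<^bsub>H\<^esub>"
    then show "r \<odot>\<^bsub>E\<^esub> v = \<zero>\<^bsub>E\<^esub>" using h_annihilator sub by (auto simp: ring_module_simps)
  qed auto
  moreover from this(2)[of \<one>] have "f (h n) = v" using v by (simp add: ring_module_simps)
  ultimately show ?thesis by blast
qed

text \<open>The isomorphism sends a class represented at level \<open>n\<close> by \<open>f \<in> Hom(H, E)\<close> to \<open>f (h n)\<close>. It does not
  depend on the level because \<open>(\<pi> f) (h (n + 1)) = f (h n)\<close>, and two classes can always be represented
  at a common level, where they are equal precisely when the values at \<open>h n\<close> agree.\<close>

lemma local_cohomology_of_dual: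
  fixes E :: "('a, 'e) module" and L :: "nat \<Rightarrow> ('a, 'l) module"
  assumes E: "injective_module R E"
    and tors: "\<And>x v. x \<in> set xs \<Longrightarrow> v \<in> carrier E \<Longrightarrow> \<exists>n::nat. x [^] n \<odot>\<^bsub>E\<^esub> v = \<zero>\<^bsub>E\<^esub>"
    and res: "injective_res R (hom_module R H E) L \<delta> \<epsilon>"
  shows "mod_isomorphic R (local_cohomology R (Idl (set xs)) (length xs) L \<delta>) E"
proof -
  have EM: "module R E" using E by (simp add: injective_module_def)
  interpret E: module R E by fact
  let ?D = "hom_module R H E"
  interpret L: injective_res R ?D L \<delta> \<epsilon> by fact
  note S = xs_carrier
  let ?\<pi> = "list_prod R xs" and ?p = "length xs"
  let ?H = "L.H xs"
  note F = L.local_cohomology_facts[OF S]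
  have eval_smult: "(r \<odot>\<^bsub>?D\<^esub> f) u = f (r \<odot>\<^bsub>H\<^esub> u)"
    if "f \<in> carrier ?D" "u \<in> carrier H" "r \<in> carrier R" for f u r
    using that hom_module_eval(3)[OF that(1,3,2)] by (simp add: hom_module_ops)
  have raise: "(?\<pi> [^] k \<odot>\<^bsub>?D\<^esub> f) (h (n + k)) = f (h n)" if "f \<in> carrier ?D" for f n k
    using eval_smult[OF that h_closed, of "?\<pi> [^] k" "n + k"] h_raise by simp
  have key: "z \<in> L.boundary xs \<longleftrightarrow> f (h n) = \<zero>\<^bsub>E\<^esub>" if r: "L.rep xs n f z" for n f z
  proof -
    have f: "f \<in> carrier ?D" using L.rep_cocycle(1)[OF S r] .
    have "f (h n) = \<zero>\<^bsub>E\<^esub>" if "?\<pi> [^] k \<odot>\<^bsub>?D\<^esub> f \<in> lspan R ?D (powers R (n + k) xs)" for k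
    proof -
      have "(?\<pi> [^] k \<odot>\<^bsub>?D\<^esub> f) (h (n + k)) = \<zero>\<^bsub>E\<^esub>"
        by (rule lspan_hom_vanishes[OF H.module_axioms EM that powers_carrier h_closed powers_kill_h])
      then show ?thesis using raise[OF f] by simp
    qed
    moreover have "?\<pi> [^] (0::nat) \<odot>\<^bsub>?D\<^esub> f \<in> lspan R ?D (powers R (n + 0) xs)" if 0: "f (h n) = \<zero>\<^bsub>E\<^esub>"
    proof -
      have "f \<in> lspan R ?D (powers R n xs)"
      proof (rule hom_in_lspan[OF E H.module_axioms powers_carrier f])
        fix u assume "u \<in> carrier H" "\<And>y. y \<in> set (powers R n xs) \<Longrightarrow> y \<odot>\<^bsub>H\<^esub> u = \<zero>\<^bsub>H\<^esub>"
        then obtain s where s: "s \<in> carrier R" "u = s \<odot>\<^bsub>H\<^esub> h n" using killed_by_powers by blast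
        then show "f u = \<zero>\<^bsub>E\<^esub>" using hom_module_eval(3)[OF f s(1) h_closed] 0 by simp
      qed
      then show ?thesis using f by simp
    qed
    ultimately show ?thesis unfolding L.rep_boundary_iff[OF S r] by blast
  qed
  have eq_iff: "L.cls xs z = L.cls xs z' \<longleftrightarrow> f (h n) = f' (h n)"
    if r: "L.rep xs n f z" "L.rep xs n f' z'" for n f z f' z'
  proof -
    have f: "f \<in> carrier ?D" "f' \<in> carrier ?D" using L.rep_cocycle(1)[OF S] r by auto
    have "L.cls xs z = L.cls xs z' \<longleftrightarrow> (f \<ominus>\<^bsub>?D\<^esub> f') (h n) = \<zero>\<^bsub>E\<^esub>"
      using F(6) L.rep_in_cocycles[OF S] r key[OF L.rep_diff[OF S r]] by blast
    then show ?thesis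
      using hom_module_minus[OF H.module_axioms EM h_closed f] hom_module_eval(1)[OF f(1) h_closed]
        hom_module_eval(1)[OF f(2) h_closed] by (simp add: E.M.diff_zero_iff)
  qed
  define P where "P c v \<longleftrightarrow> (\<exists>n f z. L.rep xs n f z \<and> c = L.cls xs z \<and> v = f (h n))" for c v
  have common: "\<exists>n f z f' z'. L.rep xs n f z \<and> L.rep xs n f' z' \<and> c = L.cls xs z \<and> c' = L.cls xs z'
      \<and> v = f (h n) \<and> v' = f' (h n)" if P: "P c v" "P c' v'" for c v c' v'
  proof -
    obtain n f z n' f' z' where r: "L.rep xs n f z" "L.rep xs n' f' z'"
      and eq: "c = L.cls xs z" "v = f (h n)" "c' = L.cls xs z'" "v' = f' (h n')"
      using P unfolding P_def by blast
    have f: "f \<in> carrier ?D" "f' \<in> carrier ?D" using L.rep_cocycle(1)[OF S] r by auto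
    have "L.rep xs (n + n') (?\<pi> [^] n' \<odot>\<^bsub>?D\<^esub> f) z" "L.rep xs (n + n') (?\<pi> [^] n \<odot>\<^bsub>?D\<^esub> f') z'"
      using L.rep_raise[OF S r(1), of n'] L.rep_raise[OF S r(2), of n] by (auto simp: add.commute)
    moreover have "v = (?\<pi> [^] n' \<odot>\<^bsub>?D\<^esub> f) (h (n + n'))" "v' = (?\<pi> [^] n \<odot>\<^bsub>?D\<^esub> f') (h (n + n'))"
      using eq raise[OF f(1), of n' n] raise[OF f(2), of n n'] by (auto simp: add.commute)
    ultimately show ?thesis using eq by blast
  qed
  have P_ex: "\<exists>v. P c v" if "c \<in> carrier ?H" for c
  proof -
    obtain z where z: "z \<in> L.cocycles xs" "c = L.cls xs z" using \<open>c \<in> _\<close> unfolding F(2) by auto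
    then obtain n f where "L.rep xs n f z" using L.rep_surj[OF S] by blast
    then show ?thesis using z(2) by (auto simp: P_def)
  qed
  have P_iff: "c = c' \<longleftrightarrow> v = v'" if P: "P c v" "P c' v'" for c v c' v'
  proof -
    obtain n f z f' z' where r: "L.rep xs n f z" "L.rep xs n f' z'"
      and eq: "c = L.cls xs z" "c' = L.cls xs z'" "v = f (h n)" "v' = f' (h n)"
      using common[OF P] by blast
    show ?thesis unfolding eq by (rule eq_iff[OF r])
  qed
  have P_closed: "c \<in> carrier ?H \<and> v \<in> carrier E" if P: "P c v" for c v
  proof -
    obtain n f z where r: "L.rep xs n f z" and eq: "c = L.cls xs z" "v = f (h n)"
      using P unfolding P_def by blast
    have "c \<in> carrier ?H" unfolding F(2) eq using L.rep_in_cocycles[OF S r] by (rule imageI)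
    moreover have "v \<in> carrier E"
      unfolding eq using hom_module_eval(1)[OF L.rep_cocycle(1)[OF S r] h_closed] .
    ultimately show ?thesis ..
  qed
  define \<Phi> where "\<Phi> c = (THE v. P c v)" for c
  have \<Phi>I: "\<Phi> c = v" if "P c v" for c v
    unfolding \<Phi>_def
  proof (rule the_equality)
    show "P c v" by fact
    show "w = v" if "P c w" for w using P_iff[OF that \<open>P c v\<close>] by simp
  qed
  have \<Phi>P: "P c (\<Phi> c)" if cH: "c \<in> carrier ?H" for c
  proof -
    obtain v where "P c v" using P_ex[OF cH] by blast
    then show ?thesis using \<Phi>I by simp
  qed
  have "\<Phi> \<in> mod_hom R ?H E"
    unfolding mod_hom_def
  proof (intro CollectI conjI ballI)
    show "\<Phi> \<in> carrier ?H \<rightarrow> carrier E" using \<Phi>P P_closed by blast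
  next
    fix c c' assume c: "c \<in> carrier ?H" "c' \<in> carrier ?H"
    obtain n f z f' z' where r: "L.rep xs n f z" "L.rep xs n f' z'"
      and eq: "c = L.cls xs z" "c' = L.cls xs z'" "\<Phi> c = f (h n)" "\<Phi> c' = f' (h n)"
      using common[OF \<Phi>P[OF c(1)] \<Phi>P[OF c(2)]] by blast
    have "c \<oplus>\<^bsub>?H\<^esub> c' = L.cls xs (z \<oplus>\<^bsub>L ?p\<^esub> z')"
      unfolding eq by (rule F(3)[OF L.rep_in_cocycles[OF S r(1)] L.rep_in_cocycles[OF S r(2)]])
    moreover have "L.rep xs n (f \<oplus>\<^bsub>?D\<^esub> f') (z \<oplus>\<^bsub>L ?p\<^esub> z')" by (rule L.rep_add[OF S r])
    moreover have "\<Phi> c \<oplus>\<^bsub>E\<^esub> \<Phi> c' = (f \<oplus>\<^bsub>?D\<^esub> f') (h n)"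
      unfolding eq(3,4) by (simp add: hom_module_ops)
    ultimately show "\<Phi> (c \<oplus>\<^bsub>?H\<^esub> c') = \<Phi> c \<oplus>\<^bsub>E\<^esub> \<Phi> c'" by (intro \<Phi>I) (auto simp: P_def)
  next
    fix a c assume a: "a \<in> carrier R" and c: "c \<in> carrier ?H"
    obtain n f z where r: "L.rep xs n f z" and eq: "c = L.cls xs z" "\<Phi> c = f (h n)"
      using \<Phi>P[OF c] unfolding P_def by blast
    have "a \<odot>\<^bsub>?H\<^esub> c = L.cls xs (a \<odot>\<^bsub>L ?p\<^esub> z)" unfolding eq by (rule F(4)[OF a L.rep_in_cocycles[OF S r]])
    moreover have "L.rep xs n (a \<odot>\<^bsub>?D\<^esub> f) (a \<odot>\<^bsub>L ?p\<^esub> z)" by (rule L.rep_smult[OF S r a])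
    moreover have "a \<odot>\<^bsub>E\<^esub> \<Phi> c = (a \<odot>\<^bsub>?D\<^esub> f) (h n)"
      unfolding eq(2) by (simp add: hom_module_ops)
    ultimately show "\<Phi> (a \<odot>\<^bsub>?H\<^esub> c) = a \<odot>\<^bsub>E\<^esub> \<Phi> c" by (intro \<Phi>I) (auto simp: P_def)
  qed
  moreover have "bij_betw \<Phi> (carrier ?H) (carrier E)"
    unfolding bij_betw_def
  proof (intro conjI equalityI subsetI)
    show "inj_on \<Phi> (carrier ?H)"
    proof (rule inj_onI)
      fix c c' assume c: "c \<in> carrier ?H" "c' \<in> carrier ?H" and eq: "\<Phi> c = \<Phi> c'"
      show "c = c'" using P_iff[OF \<Phi>P[OF c(1)] \<Phi>P[OF c(2)]] eq by simp
    qed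
    show "v \<in> carrier E" if "v \<in> \<Phi> ` carrier ?H" for v using that \<Phi>P P_closed by blast
  next
    fix v assume v: "v \<in> carrier E"
    obtain k where k: "\<And>x. x \<in> set xs \<Longrightarrow> x [^] (k x :: nat) \<odot>\<^bsub>E\<^esub> v = \<zero>\<^bsub>E\<^esub>"
      using tors[OF _ v] by metis
    define n where "n = sum_list (map k xs)"
    have "x [^] n \<odot>\<^bsub>E\<^esub> v = \<zero>\<^bsub>E\<^esub>" if x: "x \<in> set xs" for x
    proof -
      have xR: "x \<in> carrier R" using x S by blast
      have "k x \<le> n" unfolding n_def using x by (intro member_le_sum_list) auto
      then obtain l where "n = l + k x" by (metis le_add_diff_inverse2)
      then show ?thesis using k[OF x] xR v by (simp add: E.smult_pow_add)
    qed
    then obtain f where f: "f \<in> carrier ?D" "f (h n) = v" using functional_with_value[OF E v] by blast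
    obtain z where z: "L.rep xs n f z" using L.rep_total[OF S f(1)] by blast
    then have P: "P (L.cls xs z) v" using f(2) by (auto simp: P_def)
    show "v \<in> \<Phi> ` carrier ?H"
      using \<Phi>I[OF P] P_closed[OF P] by (intro image_eqI[of _ _ "L.cls xs z"]) auto
  qed
  ultimately show ?thesis unfolding mod_isomorphic_def by blast
qed

end

theorem theorem3p1:
  fixes R :: "('a, 'm) ring_scheme"
    and \<mm> k I :: "'a set"
    and xs :: "'a list"
    and i :: nat
    and E :: "('a, 'e) module"
    and J :: "nat \<Rightarrow> ('a, 'j) module" and d :: "nat \<Rightarrow> 'j \<Rightarrow> 'j"
    and L :: "nat \<Rightarrow> ('a, 'l) module" and \<delta> :: "nat \<Rightarrow> 'l \<Rightarrow> 'l"
  assumes "noetherian_ring R" and "local_ring R \<mm>"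
    and "adic_complete R \<mm>"
    and "cohen_macaulay R \<mm>"
    and "coefficient_field R \<mm> k"
    and "i \<ge> 1"
    and "length xs = i" and "regular_sequence R xs"
    and "I = Idl\<^bsub>R\<^esub> (set xs)"
    and "injective_hull R (residue_module R \<mm>) E"
    and "injective_resolution R (ring_module R) J d"
    and "injective_resolution R (matlis_dual R E (local_cohomology R I i J d)) L \<delta>"
  shows "mod_isomorphic R (local_cohomology R I i L \<delta>) E"
proof -
  have "cring R" using assms(2) by (simp add: local_ring_def)
  then interpret loc: noetherian_local R \<mm>
    using assms(1,2) by (simp add: noetherian_local_def noetherian_local_axioms_def)
  have S: "set xs \<subseteq> carrier R" and proper: "Idl\<^bsub>R\<^esub> (set xs) \<noteq> carrier R"
    using assms(8) by (auto simp: regular_sequence_def)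
  have iI: "ideal (Idl\<^bsub>R\<^esub> (set xs)) R" by (rule loc.genideal_ideal[OF S])
  have "\<one>\<^bsub>R\<^esub> \<notin> Idl\<^bsub>R\<^esub> (set xs)" using proper ideal.one_imp_carrier[OF iI] by blast
  then have xs_max: "set xs \<subseteq> \<mm>"
    using loc.proper_ideal_subset_max[OF iI] loc.genideal_self[OF S] by blast
  have reg: "weakly_regular R {\<zero>\<^bsub>R\<^esub>} xs"
    by (rule loc.regular_sequence_imp_weakly_regular[OF assms(8)])
  let ?H = "local_cohomology R (Idl\<^bsub>R\<^esub> (set xs)) (length xs) J d"
  obtain e where J: "injective_res R (ring_module R) J d e"
    using injective_resolutionE[OF assms(1,11)] .
  obtain \<epsilon> where L: "injective_res R (hom_module R ?H E) L \<delta> \<epsilon>"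
    using injective_resolutionE[OF assms(1,12)] unfolding matlis_dual_def assms(9) assms(7)[symmetric] .
  have H: "module R ?H" by (rule injective_res.H_module[OF J S])
  obtain h where "cech_generators R \<mm> ?H xs h"
  proof (rule loc.local_cohomology_generators[OF J xs_max reg])
    fix h
    assume "\<And>n. h n \<in> carrier ?H" "\<And>n. list_prod R xs \<odot>\<^bsub>?H\<^esub> h (Suc n) = h n"
      "\<And>u. u \<in> carrier ?H \<Longrightarrow> \<exists>n. \<exists>r\<in>carrier R. u = r \<odot>\<^bsub>?H\<^esub> h n"
      "\<And>n r. r \<in> carrier R \<Longrightarrow> r \<odot>\<^bsub>?H\<^esub> h n = \<zero>\<^bsub>?H\<^esub> \<longleftrightarrow> r \<in> adjoin R {\<zero>\<^bsub>R\<^esub>} (powers R n xs)"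
    then have "cech_generators R \<mm> ?H xs h"
      by (intro cech_generators.intro cech_generators_axioms.intro loc.noetherian_local_axioms H
          xs_max reg)
    then show ?thesis by (rule that)
  qed
  then interpret gen: cech_generators R \<mm> ?H xs h .
  have E: "injective_module R E" using assms(10) by (simp add: injective_hull_def)
  have "mod_isomorphic R (local_cohomology R (Idl\<^bsub>R\<^esub> (set xs)) (length xs) L \<delta>) E"
    using xs_max by (intro gen.local_cohomology_of_dual[OF E _ L] loc.injective_hull_torsion[OF assms(10)]) auto
  then show ?thesis using assms(7,9) by simp
qed

end
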